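(* Let $\mathcal{A}$ be an abelian category, let $P\colon\mathcal{A}\to\mathcal{A}$ be a generating functor with a Nakayama functor $\nu$ relative to $P$, let $\nu^-$ be the right adjoint of $\nu$, and let $I:=\nu\circ P$. The following are equivalent: (a) $P$ is Iwanaga-Gorenstein; (b) $\dim_{\mathcal{GP}_P(\mathcal{A})}(\mathcal{A})<\infty$; (c) $\dim_{\mathcal{GI}_I(\mathcal{A})}(\mathcal{A})<\infty$. Moreover, if this holds, then the following numbers coincide: (1) $\dim_{\mathcal{GP}_P(\mathcal{A})}(\mathcal{A})$; (2) $\dim_{\mathcal{GI}_I(\mathcal{A})}(\mathcal{A})$; (3) the smallest integer $s\geq 0$ such that $L_i\nu(A)=0$ for all $i>s$ and $A\in\mathcal{A}$; (4) the smallest integer $t\geq 0$ such that $R^i\nu^-(A)=0$ for all $i>t$ and $A\in\mathcal{A}$.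
   Context: All categories are preadditive, all functors additive, all subcategories full. A functor $P\colon\mathcal{A}\to\mathcal{A}$ is generating if for every $A\in\mathcal{A}$ there are $A'\in\mathcal{A}$ and an epimorphism $P(A')\to A$. A Nakayama functor relative to a generating functor $P$ is a functor $\nu\colon\mathcal{A}\to\mathcal{A}$ with a right adjoint $\nu^-$ such that (i) $\nu\circ P$ is right adjoint to $P$; (ii) the unit $\lambda\colon 1_{\mathcal{A}}\to\nu^-\circ\nu$ is an isomorphism on all objects $P(A)$, $A\in\mathcal{A}$. An object is $P$-projective (resp. $I$-injective) if it is a direct summand of some $P(A')$ (resp. $I(A')$). Derived functors: $\nu$ is right exact and $\nu^-$ is left exact; no enough projectives/injectives are assumed. $L_i\nu(A)$ is the $i$-th homology of $\nu(Q_\bullet)$, where $\cdots\to Q_1\to Q_0\to A\to 0$ is exact with all $Q_i$ $P$-projective; $R^i\nu^-(A)$ is the $i$-th cohomology of $\nu^-(J_\bullet)$, where $0\to A\to J_0\to J_{-1}\to\cdots$ is exact with all $J_{-i}$ $I$-injective. (Such (co)resolutions exist, and these are the usual derived functors because the $P$-projectives are adapted to $\nu$ and the $I$-injectives are adapted to $\nu^-$.) $P$ is Iwanaga-Gorenstein if there exists $m\geq 0$ such that $L_i\nu(A)=0$ and $R^i\nu^-(A)=0$ for all $A\in\mathcal{A}$ and $i>m$. $\mathcal{GP}_P(\mathcal{A})$ is the subcategory of Gorenstein $P$-projective objects: those $A$ for which there is an exact sequence $A_\bullet=\cdots\to A_1\xrightarrow{s_1}A_0\xrightarrow{s_0}A_{-1}\to\cdots$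 (indexed by $\mathbb{Z}$) with all $A_i$ $P$-projective, with $\nu(A_\bullet)$ exact, and with $\operatorname{Ker}s_0=A$. $\mathcal{GI}_I(\mathcal{A})$ is the subcategory of Gorenstein $I$-injective objects: those $A$ for which there is an exact sequence $A_\bullet$ indexed by $\mathbb{Z}$ with all $A_i$ $I$-injective, with $\nu^-(A_\bullet)$ exact, and with $\operatorname{Ker}s_0=A$. These are a resolving and a coresolving subcategory of $\mathcal{A}$, respectively. For a resolving subcategory $\mathcal{X}$, $\dim_{\mathcal{X}}(A)$ is the smallest $n\geq 0$ for which there is an exact sequence $0\to X_n\to\cdots\to X_0\to A\to 0$ with all $X_i\in\mathcal{X}$ ($\infty$ if none exists), and $\dim_{\mathcal{X}}(\mathcal{A})=\sup_{A\in\mathcal{A}}\dim_{\mathcal{X}}(A)$. For a coresolving subcategory $\mathcal{Y}$, $\dim_{\mathcal{Y}}$ is defined dually using coresolutions $0\to A\to Y_0\to\cdots\to Y_n\to 0$. *)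

theory Defs
  imports "HOL-Algebra.Group" "HOL-Library.Extended_Nat"
begin

section \<open>Preadditive and abelian categories\<close>

text \<open>
  \<open>g \<cdot>\<^bsub>C\<^esub> f\<close> is ``first \<open>f\<close>, then \<open>g\<close>''. \<open>Add\<close> is only meaningful on parallel arrows, and
  \<open>Zero C a b\<close> is the neutral element of \<open>Hom C a b\<close>.
\<close>

record ('o, 'm) precat =
  Obj :: "'o set"
  Arr :: "'m set"
  Dom :: "'m \<Rightarrow> 'o"
  Cod :: "'m \<Rightarrow> 'o"
  Id :: "'o \<Rightarrow> 'm"
  Comp :: "'m \<Rightarrow> 'm \<Rightarrow> 'm" (infixr "\<cdot>\<index>" 70)
  Add :: "'m \<Rightarrow> 'm \<Rightarrow> 'm"
  Zero :: "'o \<Rightarrow> 'o \<Rightarrow> 'm"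

definition Hom :: "('o, 'm, 'z) precat_scheme \<Rightarrow> 'o \<Rightarrow> 'o \<Rightarrow> 'm set" where
  "Hom C a b = {f \<in> Arr C. Dom C f = a \<and> Cod C f = b}"

locale category =
  fixes C :: "('o, 'm, 'z) precat_scheme" (structure)
  assumes Dom_in_Obj: "f \<in> Arr C \<Longrightarrow> Dom C f \<in> Obj C"
    and Cod_in_Obj: "f \<in> Arr C \<Longrightarrow> Cod C f \<in> Obj C"
    and Id_in_Hom: "a \<in> Obj C \<Longrightarrow> Id C a \<in> Hom C a a"
    and Comp_in_Hom: "\<lbrakk>f \<in> Hom C a b; g \<in> Hom C b c\<rbrakk> \<Longrightarrow> g \<cdot> f \<in> Hom C a c"
    and Comp_Id: "f \<in> Hom C a b \<Longrightarrow> f \<cdot> Id C a = f"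
    and Id_Comp: "f \<in> Hom C a b \<Longrightarrow> Id C b \<cdot> f = f"
    and Comp_assoc:
      "\<lbrakk>f \<in> Hom C a b; g \<in> Hom C b c; h \<in> Hom C c d\<rbrakk> \<Longrightarrow> (h \<cdot> g) \<cdot> f = h \<cdot> (g \<cdot> f)"

definition hom_group :: "('o, 'm, 'z) precat_scheme \<Rightarrow> 'o \<Rightarrow> 'o \<Rightarrow> 'm monoid" where
  "hom_group C a b = \<lparr>carrier = Hom C a b, monoid.mult = Add C, one = Zero C a b\<rparr>"

locale preadditive_category = category +
  assumes hom_comm_group: "\<lbrakk>a \<in> Obj C; b \<in> Obj C\<rbrakk> \<Longrightarrow> comm_group (hom_group C a b)"
    and Comp_Add: "\<lbrakk>f \<in> Hom C a b; f' \<in> Hom C a b; g \<in> Hom C b c\<rbrakk>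
      \<Longrightarrow> g \<cdot> Add C f f' = Add C (g \<cdot> f) (g \<cdot> f')"
    and Add_Comp: "\<lbrakk>f \<in> Hom C a b; g \<in> Hom C b c; g' \<in> Hom C b c\<rbrakk>
      \<Longrightarrow> Add C g g' \<cdot> f = Add C (g \<cdot> f) (g' \<cdot> f)"

definition is_mono :: "('o, 'm, 'z) precat_scheme \<Rightarrow> 'm \<Rightarrow> bool" where
  "is_mono C f \<longleftrightarrow> f \<in> Arr C \<and>
    (\<forall>a \<in> Obj C. \<forall>g \<in> Hom C a (Dom C f). \<forall>h \<in> Hom C a (Dom C f).
      f \<cdot>\<^bsub>C\<^esub> g = f \<cdot>\<^bsub>C\<^esub> h \<longrightarrow> g = h)"

definition is_epi :: "('o, 'm, 'z) precat_scheme \<Rightarrow> 'm \<Rightarrow> bool" where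
  "is_epi C f \<longleftrightarrow> f \<in> Arr C \<and>
    (\<forall>b \<in> Obj C. \<forall>g \<in> Hom C (Cod C f) b. \<forall>h \<in> Hom C (Cod C f) b.
      g \<cdot>\<^bsub>C\<^esub> f = h \<cdot>\<^bsub>C\<^esub> f \<longrightarrow> g = h)"

definition is_iso :: "('o, 'm, 'z) precat_scheme \<Rightarrow> 'm \<Rightarrow> bool" where
  "is_iso C f \<longleftrightarrow> f \<in> Arr C \<and>
    (\<exists>g \<in> Hom C (Cod C f) (Dom C f).
      g \<cdot>\<^bsub>C\<^esub> f = Id C (Dom C f) \<and> f \<cdot>\<^bsub>C\<^esub> g = Id C (Cod C f))"

definition is_zero_object :: "('o, 'm, 'z) precat_scheme \<Rightarrow> 'o \<Rightarrow> bool" where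
  "is_zero_object C z \<longleftrightarrow> z \<in> Obj C \<and>
    (\<forall>a \<in> Obj C. (\<exists>!f. f \<in> Hom C z a) \<and> (\<exists>!f. f \<in> Hom C a z))"

definition is_kernel :: "('o, 'm, 'z) precat_scheme \<Rightarrow> 'm \<Rightarrow> 'm \<Rightarrow> bool" where
  "is_kernel C k f \<longleftrightarrow> f \<in> Arr C \<and> k \<in> Hom C (Dom C k) (Dom C f) \<and>
    f \<cdot>\<^bsub>C\<^esub> k = Zero C (Dom C k) (Cod C f) \<and>
    (\<forall>a \<in> Obj C. \<forall>h \<in> Hom C a (Dom C f). f \<cdot>\<^bsub>C\<^esub> h = Zero C a (Cod C f) \<longrightarrow>
      (\<exists>!u. u \<in> Hom C a (Dom C k) \<and> k \<cdot>\<^bsub>C\<^esub> u = h))"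

definition is_cokernel :: "('o, 'm, 'z) precat_scheme \<Rightarrow> 'm \<Rightarrow> 'm \<Rightarrow> bool" where
  "is_cokernel C c f \<longleftrightarrow> f \<in> Arr C \<and> c \<in> Hom C (Cod C f) (Cod C c) \<and>
    c \<cdot>\<^bsub>C\<^esub> f = Zero C (Dom C f) (Cod C c) \<and>
    (\<forall>b \<in> Obj C. \<forall>h \<in> Hom C (Cod C f) b. h \<cdot>\<^bsub>C\<^esub> f = Zero C (Dom C f) b \<longrightarrow>
      (\<exists>!u. u \<in> Hom C (Cod C c) b \<and> u \<cdot>\<^bsub>C\<^esub> c = h))"

definition is_biproduct ::
  "('o, 'm, 'z) precat_scheme \<Rightarrow> 'o \<Rightarrow> 'o \<Rightarrow> 'o \<Rightarrow> 'm \<Rightarrow> 'm \<Rightarrow> 'm \<Rightarrow> 'm \<Rightarrow> bool" where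
  "is_biproduct C a b s i j p q \<longleftrightarrow>
    a \<in> Obj C \<and> b \<in> Obj C \<and> s \<in> Obj C \<and>
    i \<in> Hom C a s \<and> j \<in> Hom C b s \<and> p \<in> Hom C s a \<and> q \<in> Hom C s b \<and>
    p \<cdot>\<^bsub>C\<^esub> i = Id C a \<and> q \<cdot>\<^bsub>C\<^esub> j = Id C b \<and>
    p \<cdot>\<^bsub>C\<^esub> j = Zero C b a \<and> q \<cdot>\<^bsub>C\<^esub> i = Zero C a b \<and>
    Add C (i \<cdot>\<^bsub>C\<^esub> p) (j \<cdot>\<^bsub>C\<^esub> q) = Id C s"

definition direct_summand :: "('o, 'm, 'z) precat_scheme \<Rightarrow> 'o \<Rightarrow> 'o \<Rightarrow> bool" where
  "direct_summand C a s \<longleftrightarrow> (\<exists>b i j p q. is_biproduct C a b s i j p q)"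

locale abelian_category = preadditive_category +
  assumes ex_zero_object: "\<exists>z. is_zero_object C z"
    and ex_biproduct:
      "\<lbrakk>a \<in> Obj C; b \<in> Obj C\<rbrakk> \<Longrightarrow> \<exists>s i j p q. is_biproduct C a b s i j p q"
    and ex_kernel: "f \<in> Arr C \<Longrightarrow> \<exists>k. is_kernel C k f"
    and ex_cokernel: "f \<in> Arr C \<Longrightarrow> \<exists>c. is_cokernel C c f"
    and mono_is_kernel: "is_mono C f \<Longrightarrow> \<exists>g. is_kernel C f g"
    and epi_is_cokernel: "is_epi C f \<Longrightarrow> \<exists>g. is_cokernel C f g"


section \<open>Exactness and homology\<close>

definition is_image :: "('o, 'm, 'z) precat_scheme \<Rightarrow> 'm \<Rightarrow> 'm \<Rightarrow> bool" where
  "is_image C k f \<longleftrightarrow> (\<exists>c. is_cokernel C c f \<and> is_kernel C k c)"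

text \<open>Exactness of \<open>f\<close> followed by \<open>g\<close>: the image of \<open>f\<close> is the kernel of \<open>g\<close>.\<close>

definition exact_pair :: "('o, 'm, 'z) precat_scheme \<Rightarrow> 'm \<Rightarrow> 'm \<Rightarrow> bool" where
  "exact_pair C f g \<longleftrightarrow> f \<in> Arr C \<and> g \<in> Arr C \<and> Cod C f = Dom C g \<and>
    (\<exists>k. is_image C k f \<and> is_kernel C k g)"

text \<open>
  \<open>h\<close> is a homology object of \<open>f\<close> followed by \<open>g\<close>: the cokernel of the map into
  the kernel of \<open>g\<close> that is induced by \<open>f\<close>.
\<close>

definition is_homology :: "('o, 'm, 'z) precat_scheme \<Rightarrow> 'm \<Rightarrow> 'm \<Rightarrow> 'o \<Rightarrow> bool" where
  "is_homology C f g h \<longleftrightarrow>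
    (\<exists>k u q. is_kernel C k g \<and> u \<in> Hom C (Dom C f) (Dom C k) \<and> k \<cdot>\<^bsub>C\<^esub> u = f \<and>
      is_cokernel C q u \<and> h = Cod C q)"


section \<open>Additive endofunctors and adjunctions\<close>

record ('o, 'm) endofunctor =
  on_obj :: "'o \<Rightarrow> 'o"
  on_arr :: "'m \<Rightarrow> 'm"

definition functor_comp ::
  "('o, 'm) endofunctor \<Rightarrow> ('o, 'm) endofunctor \<Rightarrow> ('o, 'm) endofunctor"
  (infixr "\<circ>\<^sub>F" 75) where
  "G \<circ>\<^sub>F F = \<lparr>on_obj = on_obj G \<circ> on_obj F, on_arr = on_arr G \<circ> on_arr F\<rparr>"

definition functor_id :: "('o, 'm) endofunctor" where
  "functor_id = \<lparr>on_obj = id, on_arr = id\<rparr>"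

locale additive_functor = preadditive_category C
  for C :: "('o, 'm, 'z) precat_scheme" (structure) +
  fixes F :: "('o, 'm) endofunctor"
  assumes on_obj_in_Obj: "a \<in> Obj C \<Longrightarrow> on_obj F a \<in> Obj C"
    and on_arr_in_Hom: "f \<in> Hom C a b \<Longrightarrow> on_arr F f \<in> Hom C (on_obj F a) (on_obj F b)"
    and on_arr_Id: "a \<in> Obj C \<Longrightarrow> on_arr F (Id C a) = Id C (on_obj F a)"
    and on_arr_Comp: "\<lbrakk>f \<in> Hom C a b; g \<in> Hom C b c\<rbrakk>
      \<Longrightarrow> on_arr F (g \<cdot> f) = on_arr F g \<cdot> on_arr F f"
    and on_arr_Add: "\<lbrakk>f \<in> Hom C a b; g \<in> Hom C a b\<rbrakk>
      \<Longrightarrow> on_arr F (Add C f g) = Add C (on_arr F f) (on_arr F g)"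

definition natural_transformation ::
  "('o, 'm, 'z) precat_scheme \<Rightarrow> ('o, 'm) endofunctor \<Rightarrow> ('o, 'm) endofunctor \<Rightarrow>
    ('o \<Rightarrow> 'm) \<Rightarrow> bool" where
  "natural_transformation C F G \<tau> \<longleftrightarrow>
    (\<forall>a \<in> Obj C. \<tau> a \<in> Hom C (on_obj F a) (on_obj G a)) \<and>
    (\<forall>a b. \<forall>f \<in> Hom C a b. on_arr G f \<cdot>\<^bsub>C\<^esub> \<tau> a = \<tau> b \<cdot>\<^bsub>C\<^esub> on_arr F f)"

text \<open>\<open>F\<close> is left adjoint to \<open>G\<close> with unit \<open>\<eta>\<close> and counit \<open>\<epsilon>\<close>.\<close>

locale adjunction = additive_functor C F + right: additive_functor C G
  for C :: "('o, 'm, 'z) precat_scheme" (structure)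
    and F :: "('o, 'm) endofunctor" and G :: "('o, 'm) endofunctor" +
  fixes \<eta> :: "'o \<Rightarrow> 'm" and \<epsilon> :: "'o \<Rightarrow> 'm"
  assumes unit_natural: "natural_transformation C functor_id (G \<circ>\<^sub>F F) \<eta>"
    and counit_natural: "natural_transformation C (F \<circ>\<^sub>F G) functor_id \<epsilon>"
    and triangle_left: "a \<in> Obj C \<Longrightarrow> \<epsilon> (on_obj F a) \<cdot> on_arr F (\<eta> a) = Id C (on_obj F a)"
    and triangle_right: "b \<in> Obj C \<Longrightarrow> on_arr G (\<epsilon> b) \<cdot> \<eta> (on_obj G b) = Id C (on_obj G b)"

definition is_right_adjoint ::
  "('o, 'm, 'z) precat_scheme \<Rightarrow> ('o, 'm) endofunctor \<Rightarrow> ('o, 'm) endofunctor \<Rightarrow> bool" where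
  "is_right_adjoint C G F \<longleftrightarrow> (\<exists>\<eta> \<epsilon>. adjunction C F G \<eta> \<epsilon>)"

locale generating_functor = additive_functor C P
  for C :: "('o, 'm, 'z) precat_scheme" (structure) and P :: "('o, 'm) endofunctor" +
  assumes generating:
    "a \<in> Obj C \<Longrightarrow> \<exists>a' \<in> Obj C. \<exists>f \<in> Hom C (on_obj P a') a. is_epi C f"

locale nakayama_functor = generating_functor C P + adjunction C \<nu> \<nu>' unit counit
  for C :: "('o, 'm, 'z) precat_scheme" (structure)
    and P :: "('o, 'm) endofunctor"
    and \<nu> :: "('o, 'm) endofunctor" and \<nu>' :: "('o, 'm) endofunctor"
    and unit :: "'o \<Rightarrow> 'm" and counit :: "'o \<Rightarrow> 'm" +
  assumes right_adjoint_of_P: "is_right_adjoint C (\<nu> \<circ>\<^sub>F P) P"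
    and unit_iso: "a \<in> Obj C \<Longrightarrow> is_iso C (unit (on_obj P a))"


section \<open>Resolutions, derived functors and dimensions\<close>

text \<open>
  The objects that are direct summands of some \<open>F(a)\<close>: the \<open>P\<close>-projective objects for
  \<open>F = P\<close> and the \<open>I\<close>-injective objects for \<open>F = I\<close>.
\<close>

definition image_summands ::
  "('o, 'm, 'z) precat_scheme \<Rightarrow> ('o, 'm) endofunctor \<Rightarrow> 'o set" where
  "image_summands C F = {x \<in> Obj C. \<exists>a \<in> Obj C. direct_summand C x (on_obj F a)}"

text \<open>
  \<open>\<cdots> \<rightarrow> X 1 \<rightarrow> X 0 \<rightarrow> a \<rightarrow> 0\<close> exact, with differentials \<open>d n : X (n+1) \<rightarrow> X n\<close>
  and augmentation \<open>e : X 0 \<rightarrow> a\<close>.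
\<close>

definition is_resolution ::
  "('o, 'm, 'z) precat_scheme \<Rightarrow> 'o set \<Rightarrow> 'o \<Rightarrow> (nat \<Rightarrow> 'o) \<Rightarrow> (nat \<Rightarrow> 'm) \<Rightarrow> 'm \<Rightarrow> bool" where
  "is_resolution C S a X d e \<longleftrightarrow>
    (\<forall>n. X n \<in> S) \<and> (\<forall>n. d n \<in> Hom C (X (Suc n)) (X n)) \<and> e \<in> Hom C (X 0) a \<and>
    (\<forall>n. exact_pair C (d (Suc n)) (d n)) \<and> exact_pair C (d 0) e \<and>
    (\<exists>z. is_zero_object C z \<and> exact_pair C e (Zero C a z))"

text \<open>
  \<open>0 \<rightarrow> a \<rightarrow> X 0 \<rightarrow> X 1 \<rightarrow> \<cdots>\<close> exact, with differentials \<open>d n : X n \<rightarrow> X (n+1)\<close>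
  and coaugmentation \<open>e : a \<rightarrow> X 0\<close>; so \<open>X n\<close> is what is written \<open>J\<close> with index \<open>-n\<close>
  in homological indexing.
\<close>

definition is_coresolution ::
  "('o, 'm, 'z) precat_scheme \<Rightarrow> 'o set \<Rightarrow> 'o \<Rightarrow> (nat \<Rightarrow> 'o) \<Rightarrow> (nat \<Rightarrow> 'm) \<Rightarrow> 'm \<Rightarrow> bool" where
  "is_coresolution C S a X d e \<longleftrightarrow>
    (\<forall>n. X n \<in> S) \<and> (\<forall>n. d n \<in> Hom C (X n) (X (Suc n))) \<and> e \<in> Hom C a (X 0) \<and>
    (\<forall>n. exact_pair C (d n) (d (Suc n))) \<and> exact_pair C e (d 0) \<and>
    (\<exists>z. is_zero_object C z \<and> exact_pair C (Zero C z a) e)"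

text \<open>
  The value at \<open>a\<close> of the \<open>i\<close>-th left derived functor of \<open>F\<close>, computed with a chosen
  resolution by objects of \<open>S\<close> and a chosen homology object; it is well defined up to
  isomorphism when such resolutions exist and \<open>S\<close> is adapted to \<open>F\<close>. The zero arrow
  in the case \<open>i = 0\<close> is the end \<open>F (X 0) \<rightarrow> 0\<close> of the complex; for \<open>i > 0\<close> the
  complex is \<open>F (X (i+1)) \<rightarrow> F (X i) \<rightarrow> F (X (i-1))\<close>.
\<close>

definition left_derived ::
  "('o, 'm, 'z) precat_scheme \<Rightarrow> 'o set \<Rightarrow> ('o, 'm) endofunctor \<Rightarrow> nat \<Rightarrow> 'o \<Rightarrow> 'o" where
  "left_derived C S F i a =
    (SOME h. \<exists>X d e z. is_resolution C S a X d e \<and> is_zero_object C z \<and>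
      is_homology C (on_arr F (d i))
        (case i of 0 \<Rightarrow> Zero C (on_obj F (X 0)) z | Suc j \<Rightarrow> on_arr F (d j)) h)"

definition right_derived ::
  "('o, 'm, 'z) precat_scheme \<Rightarrow> 'o set \<Rightarrow> ('o, 'm) endofunctor \<Rightarrow> nat \<Rightarrow> 'o \<Rightarrow> 'o" where
  "right_derived C S F i a =
    (SOME h. \<exists>X d e z. is_coresolution C S a X d e \<and> is_zero_object C z \<and>
      is_homology C
        (case i of 0 \<Rightarrow> Zero C z (on_obj F (X 0)) | Suc j \<Rightarrow> on_arr F (d j))
        (on_arr F (d i)) h)"

text \<open>
  Exact sequences \<open>0 \<rightarrow> X n \<rightarrow> \<cdots> \<rightarrow> X 0 \<rightarrow> a \<rightarrow> 0\<close> with \<open>X i\<close> in \<open>S\<close>; here \<open>d 0\<close> is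
  the augmentation \<open>X 0 \<rightarrow> a\<close> and \<open>d (i+1) : X (i+1) \<rightarrow> X i\<close>. Dually for
  \<open>has_coresolution_of_length\<close>.
\<close>

definition has_resolution_of_length ::
  "('o, 'm, 'z) precat_scheme \<Rightarrow> 'o set \<Rightarrow> 'o \<Rightarrow> nat \<Rightarrow> bool" where
  "has_resolution_of_length C S a n \<longleftrightarrow>
    (\<exists>X d z. is_zero_object C z \<and> (\<forall>i\<le>n. X i \<in> S) \<and>
      d 0 \<in> Hom C (X 0) a \<and> (\<forall>i<n. d (Suc i) \<in> Hom C (X (Suc i)) (X i)) \<and>
      exact_pair C (Zero C z (X n)) (d n) \<and>
      (\<forall>i<n. exact_pair C (d (Suc i)) (d i)) \<and>
      exact_pair C (d 0) (Zero C a z))"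

definition has_coresolution_of_length ::
  "('o, 'm, 'z) precat_scheme \<Rightarrow> 'o set \<Rightarrow> 'o \<Rightarrow> nat \<Rightarrow> bool" where
  "has_coresolution_of_length C S a n \<longleftrightarrow>
    (\<exists>X d z. is_zero_object C z \<and> (\<forall>i\<le>n. X i \<in> S) \<and>
      d 0 \<in> Hom C a (X 0) \<and> (\<forall>i<n. d (Suc i) \<in> Hom C (X i) (X (Suc i))) \<and>
      exact_pair C (Zero C z a) (d 0) \<and>
      (\<forall>i<n. exact_pair C (d i) (d (Suc i))) \<and>
      exact_pair C (d n) (Zero C (X n) z))"

text \<open>The infimum of the empty set of extended naturals is \<open>\<infinity>\<close>.\<close>

definition resolution_dim :: "('o, 'm, 'z) precat_scheme \<Rightarrow> 'o set \<Rightarrow> 'o \<Rightarrow> enat" where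
  "resolution_dim C S a = Inf {enat n |n. has_resolution_of_length C S a n}"

definition coresolution_dim :: "('o, 'm, 'z) precat_scheme \<Rightarrow> 'o set \<Rightarrow> 'o \<Rightarrow> enat" where
  "coresolution_dim C S a = Inf {enat n |n. has_coresolution_of_length C S a n}"

definition global_resolution_dim :: "('o, 'm, 'z) precat_scheme \<Rightarrow> 'o set \<Rightarrow> enat" where
  "global_resolution_dim C S = (SUP a \<in> Obj C. resolution_dim C S a)"

definition global_coresolution_dim :: "('o, 'm, 'z) precat_scheme \<Rightarrow> 'o set \<Rightarrow> enat" where
  "global_coresolution_dim C S = (SUP a \<in> Obj C. coresolution_dim C S a)"


section \<open>Gorenstein objects and the Iwanaga-Gorenstein condition\<close>

text \<open>
  Kernel objects \<open>Ker (s 0)\<close> of exact sequences \<open>\<cdots> \<rightarrow> X 1 \<rightarrow> X 0 \<rightarrow> X (-1) \<rightarrow> \<cdots>\<close>,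
  \<open>s i : X i \<rightarrow> X (i-1)\<close>, with terms in \<open>S\<close> that stay exact under \<open>F\<close>. All kernel
  objects are taken, so the class is closed under isomorphism.
\<close>

definition acyclic_kernels ::
  "('o, 'm, 'z) precat_scheme \<Rightarrow> 'o set \<Rightarrow> ('o, 'm) endofunctor \<Rightarrow> 'o set" where
  "acyclic_kernels C S F = {a \<in> Obj C. \<exists>(X :: int \<Rightarrow> 'o) s k.
    (\<forall>i. X i \<in> S) \<and> (\<forall>i. s i \<in> Hom C (X i) (X (i - 1))) \<and>
    (\<forall>i. exact_pair C (s (i + 1)) (s i)) \<and>
    (\<forall>i. exact_pair C (on_arr F (s (i + 1))) (on_arr F (s i))) \<and>
    k \<in> Hom C a (X 0) \<and> is_kernel C k (s 0)}"

definition gorenstein_projectives ::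
  "('o, 'm, 'z) precat_scheme \<Rightarrow> ('o, 'm) endofunctor \<Rightarrow> ('o, 'm) endofunctor \<Rightarrow> 'o set" where
  "gorenstein_projectives C P \<nu> = acyclic_kernels C (image_summands C P) \<nu>"

definition gorenstein_injectives ::
  "('o, 'm, 'z) precat_scheme \<Rightarrow> ('o, 'm) endofunctor \<Rightarrow> ('o, 'm) endofunctor \<Rightarrow> 'o set" where
  "gorenstein_injectives C I \<nu>' = acyclic_kernels C (image_summands C I) \<nu>'"

definition left_derived_vanishes_above ::
  "('o, 'm, 'z) precat_scheme \<Rightarrow> ('o, 'm) endofunctor \<Rightarrow> ('o, 'm) endofunctor \<Rightarrow> nat \<Rightarrow> bool" where
  "left_derived_vanishes_above C P \<nu> m \<longleftrightarrow>
    (\<forall>i>m. \<forall>a \<in> Obj C. is_zero_object C (left_derived C (image_summands C P) \<nu> i a))"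

definition right_derived_vanishes_above ::
  "('o, 'm, 'z) precat_scheme \<Rightarrow> ('o, 'm) endofunctor \<Rightarrow> ('o, 'm) endofunctor \<Rightarrow> nat \<Rightarrow> bool" where
  "right_derived_vanishes_above C I \<nu>' m \<longleftrightarrow>
    (\<forall>i>m. \<forall>a \<in> Obj C. is_zero_object C (right_derived C (image_summands C I) \<nu>' i a))"

definition iwanaga_gorenstein ::
  "('o, 'm, 'z) precat_scheme \<Rightarrow> ('o, 'm) endofunctor \<Rightarrow>
    ('o, 'm) endofunctor \<Rightarrow> ('o, 'm) endofunctor \<Rightarrow> bool" where
  "iwanaga_gorenstein C P \<nu> \<nu>' \<longleftrightarrow>
    (\<exists>m. left_derived_vanishes_above C P \<nu> m \<and>
      right_derived_vanishes_above C (\<nu> \<circ>\<^sub>F P) \<nu>' m)"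

end

theory Submission imports Defs begin

text \<open>
  \<^bold>\<open>Setting.\<close> Put \<open>I = \<nu> \<circ> P\<close>. Since \<open>P\<close> is left adjoint to \<open>I\<close> and \<open>P\<close> is generating, the counit
  \<open>P (I a) \<rightarrow> a\<close> is epi. Both functors are exact: \<open>I\<close> is a right adjoint and a composite of left
  adjoints, and \<open>P\<close> is a left adjoint that is isomorphic to the composite \<open>\<nu>' \<circ> I\<close> of right
  adjoints. Passing to the opposite category exchanges \<open>P\<close> with \<open>I\<close> and \<open>\<nu>\<close> with \<open>\<nu>'\<close>. The locale
  \<open>nakayama_duality\<close> records a set of properties that is invariant under this exchange, so one half
  of every argument suffices.

  \<^bold>\<open>Derived functors.\<close> The kernel \<open>\<Omega> a\<close> of the counit \<open>P (I a) \<rightarrow> a\<close> is an exact construction because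
  \<open>P\<close> and \<open>I\<close> are exact. An object is called flat if \<open>\<nu>\<close> preserves the short exact sequences that end
  in it, that is, if its first left derived functor vanishes; \<open>L\<^sub>n\<^sub>+\<^sub>1 \<nu> (a) = 0\<close> is encoded as flatness of
  \<open>\<Omega>\<^sup>n a\<close>. For this predicate the three pieces of the long exact sequence that are needed
  (\<open>Tor_extension\<close>, \<open>Tor_left\<close>, \<open>Tor_right\<close>) have elementary proofs. The objects \<open>P y\<close> need not
  be projective, but they are acyclic for \<open>\<nu>\<close> (\<open>Tor_P\<close>), and dimension shifting then shows that every
  resolution by \<open>P\<close>-projectives computes the predicate (\<open>exact_nu_resolution\<close>).

  \<^bold>\<open>Gorenstein objects.\<close> An object \<open>a\<close> is Gorenstein \<open>P\<close>-projective iff \<open>a\<close> is acyclic for \<open>\<nu>\<close>, the unit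
  \<open>a \<rightarrow> \<nu>' (\<nu> a)\<close> is an isomorphism, and \<open>\<nu> a\<close> is acyclic for \<open>\<nu>'\<close> (\<open>gorenstein_projectives_iff\<close>). Closure
  of the class under extensions and suitable quotients follows from this description.

  \<^bold>\<open>Dimensions.\<close> Let \<open>g\<close> and \<open>h\<close> be the two Gorenstein dimensions of the category and \<open>l\<close>, \<open>r\<close> the optimal
  bounds for the left and right derived functors.
  If \<open>l\<close> and \<open>r\<close> are finite, then \<open>\<Omega>\<^sup>l a\<close> is acyclic for \<open>\<nu>\<close>, so \<open>\<nu>\<close> maps its resolution to an exact
  sequence whose middle terms are acyclic for \<open>\<nu>'\<close>; shifting down from \<open>r\<close> along it shows that \<open>\<Omega>\<^sup>l a\<close> is
  Gorenstein (\<open>acyclic_gorenstein\<close>), hence \<open>g \<le> l\<close>. Conversely \<open>l \<le> g\<close> by dimension shifting.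

  The heart is \<open>r \<le> g\<close>. Let \<open>J\<^sub>0 \<rightarrow> J\<^sub>1 \<rightarrow> \<dots>\<close> be the canonical coresolution of \<open>a\<close>, with \<open>J\<^sub>j\<close> of the form
  \<open>I (P b)\<close>, and let \<open>Q\<^sub>j = \<nu>' J\<^sub>j\<close>, which is \<open>P\<close>-projective. The \<open>(k + 1)\<close>-st cohomology of \<open>Q\<close> is the kernel
  of the arrow from \<open>M = Coker (Q\<^sub>k \<rightarrow> Q\<^sub>k\<^sub>+\<^sub>1)\<close> to \<open>Q\<^sub>k\<^sub>+\<^sub>2\<close>. If \<open>\<Omega>\<^sup>m M\<close> is Gorenstein for some \<open>m \<le> k\<close>, then the
  projection \<open>Q\<^sub>k\<^sub>+\<^sub>1 \<rightarrow> M\<close> followed by a suitable mono \<open>M \<rightarrow> L\<close> extends along \<open>Q\<^sub>k\<^sub>+\<^sub>1 \<rightarrow> Q\<^sub>k\<^sub>+\<^sub>2\<close>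
  (\<open>syzygy_gorenstein_extend\<close>), so the kernel is zero. If \<open>g\<close> is finite, then \<open>\<Omega>\<^sup>g M\<close> is Gorenstein for
  every \<open>M\<close>, because it is acyclic and has a finite Gorenstein resolution.

  Together with the dual statements \<open>h \<le> r\<close>, \<open>r \<le> h\<close> and \<open>l \<le> h\<close> all four numbers agree.
\<close>

section \<open>Opposite categories\<close>

text \<open>
  The opposite category has the same objects and arrows, so a statement about it is a statement
  about the same objects and functors with all arrows reversed. Each dual lemma below is
  obtained from its partner by instantiation at \<open>opposite C\<close>.
\<close>

definition opposite :: "('o, 'm, 'z) precat_scheme \<Rightarrow> ('o, 'm, 'z) precat_scheme" where
  "opposite C = C\<lparr>Dom := Cod C, Cod := Dom C, Comp := (\<lambda>g f. Comp C f g), Zero := (\<lambda>a b. Zero C b a)\<rparr>"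

lemma opposite_simps [simp]:
  "Obj (opposite C) = Obj C" "Arr (opposite C) = Arr C"
  "Dom (opposite C) = Cod C" "Cod (opposite C) = Dom C" "Id (opposite C) = Id C"
  "g \<cdot>\<^bsub>opposite C\<^esub> f = f \<cdot>\<^bsub>C\<^esub> g" "Add (opposite C) = Add C"
  "Zero (opposite C) a b = Zero C b a"
  by (simp_all add: opposite_def)

lemma opposite_opposite [simp]: "opposite (opposite C) = C"
  by (simp add: opposite_def)

lemma Hom_opposite [simp]: "Hom (opposite C) a b = Hom C b a"
  by (auto simp: Hom_def)

lemma hom_group_opposite [simp]: "hom_group (opposite C) a b = hom_group C b a"
  by (simp add: hom_group_def)

lemma is_mono_opposite [simp]: "is_mono (opposite C) f = is_epi C f"
  by (simp add: is_mono_def is_epi_def)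

lemma is_epi_opposite [simp]: "is_epi (opposite C) f = is_mono C f"
  by (simp add: is_mono_def is_epi_def)

lemma is_iso_opposite [simp]: "is_iso (opposite C) f = is_iso C f"
  by (auto simp: is_iso_def)

lemma is_kernel_opposite [simp]: "is_kernel (opposite C) k f = is_cokernel C k f"
  by (simp add: is_kernel_def is_cokernel_def)

lemma is_cokernel_opposite [simp]: "is_cokernel (opposite C) k f = is_kernel C k f"
  by (simp add: is_kernel_def is_cokernel_def)

lemma is_zero_object_opposite [simp]: "is_zero_object (opposite C) z = is_zero_object C z"
  by (auto simp: is_zero_object_def)

lemma is_biproduct_opposite:
  "is_biproduct (opposite C) a b s i j p q = is_biproduct C a b s p q i j"
  by (auto simp: is_biproduct_def)

lemma direct_summand_opposite [simp]: "direct_summand (opposite C) = direct_summand C"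
  unfolding direct_summand_def is_biproduct_opposite fun_eq_iff by fast

lemma image_summands_opposite [simp]: "image_summands (opposite C) F = image_summands C F"
  by (simp add: image_summands_def)

section \<open>Arrows, monomorphisms and isomorphisms\<close>

context category begin

lemma HomD:
  assumes "f \<in> Hom C a b"
  shows "f \<in> Arr C" "Dom C f = a" "Cod C f = b" "a \<in> Obj C" "b \<in> Obj C"
  using assms Dom_in_Obj Cod_in_Obj by (auto simp: Hom_def)

text \<open>
  Composition is only associative for composable arrows. The proofs below declare the domains and
  codomains of the arrows in play as simplification rules, which lets the simplifier discharge the
  side conditions and normalize composites to the right.
\<close>

lemma hom_simps:
  "f \<in> Hom C a b \<Longrightarrow> f \<in> Arr C \<and> Dom C f = a \<and> Cod C f = b \<and> a \<in> Obj C \<and> b \<in> Obj C"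
  using HomD by blast

lemma HomI [intro]: "\<lbrakk>f \<in> Arr C; Dom C f = a; Cod C f = b\<rbrakk> \<Longrightarrow> f \<in> Hom C a b"
  by (simp add: Hom_def)

lemma Hom_iff: "f \<in> Hom C a b \<longleftrightarrow> f \<in> Arr C \<and> Dom C f = a \<and> Cod C f = b"
  by (simp add: Hom_def)

lemma Comp_arr [simp]:
  assumes "f \<in> Arr C" "g \<in> Arr C" "Dom C g = Cod C f"
  shows "g \<cdot> f \<in> Arr C" "Dom C (g \<cdot> f) = Dom C f" "Cod C (g \<cdot> f) = Cod C g"
  using Comp_in_Hom[of f "Dom C f" "Cod C f" g "Cod C g"] assms by (auto simp: Hom_def)

lemma Comp_assoc_arr [simp]:
  assumes "f \<in> Arr C" "g \<in> Arr C" "h \<in> Arr C" "Dom C g = Cod C f" "Dom C h = Cod C g"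
  shows "(h \<cdot> g) \<cdot> f = h \<cdot> (g \<cdot> f)"
  using Comp_assoc[of f "Dom C f" "Cod C f" g "Cod C g" h "Cod C h"] assms by (auto simp: Hom_def)

text \<open>
  In a right-nested composite the left-hand side of an equation \<open>g \<cdot> f = h\<close> is not a subterm; the
  reassociated forms make such an equation applicable there.
\<close>

lemma Comp_reassoc:
  assumes "g \<cdot> f = h" "f \<in> Arr C" "g \<in> Arr C" "Dom C g = Cod C f" "x \<in> Arr C" "Cod C x = Dom C f"
  shows "g \<cdot> (f \<cdot> x) = h \<cdot> x"
  using Comp_assoc_arr[of x f g] assms by simp

lemma Comp_reassoc2:
  assumes "g \<cdot> f = h \<cdot> k" "f \<in> Arr C" "g \<in> Arr C" "Dom C g = Cod C f"
    "h \<in> Arr C" "k \<in> Arr C" "Dom C h = Cod C k"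
    "x \<in> Arr C" "Cod C x = Dom C f"
  shows "g \<cdot> (f \<cdot> x) = h \<cdot> (k \<cdot> x)"
proof -
  have "Dom C f = Dom C k"
    using Comp_arr(2)[OF assms(2-4)] Comp_arr(2)[OF assms(6,5,7)] assms(1) by simp
  then show ?thesis
    using Comp_assoc_arr[of x f g] Comp_assoc_arr[of x k h] assms by simp
qed

lemma Id_arr [simp]:
  assumes "a \<in> Obj C"
  shows "Id C a \<in> Arr C" "Dom C (Id C a) = a" "Cod C (Id C a) = a"
  using Id_in_Hom[OF assms] by (auto simp: Hom_def)

lemma Comp_Id_arr [simp]: "\<lbrakk>f \<in> Arr C; Dom C f = a\<rbrakk> \<Longrightarrow> f \<cdot> Id C a = f"
  using Comp_Id[of f "Dom C f" "Cod C f"] by (auto simp: Hom_def)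

lemma Id_Comp_arr [simp]: "\<lbrakk>f \<in> Arr C; Cod C f = a\<rbrakk> \<Longrightarrow> Id C a \<cdot> f = f"
  using Id_Comp[of f "Dom C f" "Cod C f"] by (auto simp: Hom_def)

lemma opposite_category: "category (opposite C)"
proof
  fix f g h a b c d
  assume "f \<in> Hom (opposite C) a b" "g \<in> Hom (opposite C) b c" "h \<in> Hom (opposite C) c d"
  then show "(h \<cdot>\<^bsub>opposite C\<^esub> g) \<cdot>\<^bsub>opposite C\<^esub> f = h \<cdot>\<^bsub>opposite C\<^esub> (g \<cdot>\<^bsub>opposite C\<^esub> f)"
    using Comp_assoc[of h d c g b f a] by simp
qed (simp_all add: Dom_in_Obj Cod_in_Obj Id_in_Hom Comp_in_Hom Comp_Id Id_Comp)

lemma mono_cancel: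
  assumes "is_mono C f" "f \<in> Hom C a b" "x \<in> Hom C t a" "y \<in> Hom C t a" "f \<cdot> x = f \<cdot> y"
  shows "x = y"
proof -
  have "t \<in> Obj C" "Dom C f = a" using assms HomD by blast+
  then show ?thesis using assms unfolding is_mono_def by blast
qed

lemma epi_cancel:
  assumes "is_epi C f" "f \<in> Hom C a b" "x \<in> Hom C b t" "y \<in> Hom C b t" "x \<cdot> f = y \<cdot> f"
  shows "x = y"
proof -
  have "t \<in> Obj C" "Cod C f = b" using assms HomD by blast+
  then show ?thesis using assms unfolding is_epi_def by blast
qed

lemma epi_comp:
  assumes "is_epi C f" "is_epi C g" "f \<in> Hom C a b" "g \<in> Hom C b c"
  shows "is_epi C (g \<cdot> f)"
proof -
  note [THEN hom_simps, simp] = assms(3,4)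
  have "x = y" if "x \<in> Hom C c t" "y \<in> Hom C c t" "x \<cdot> (g \<cdot> f) = y \<cdot> (g \<cdot> f)" for x y t
  proof -
    note [THEN hom_simps, simp] = that(1,2)
    have e: "(x \<cdot> g) \<cdot> f = (y \<cdot> g) \<cdot> f" using that by simp
    have "x \<cdot> g = y \<cdot> g"
      by (rule epi_cancel[OF assms(1,3) _ _ e, of t]) (simp_all add: Hom_iff)
    then show ?thesis using epi_cancel[OF assms(2,4)] that by blast
  qed
  then show ?thesis unfolding is_epi_def by auto
qed

lemma epi_left:
  assumes "is_epi C (g \<cdot> f)" "f \<in> Hom C a b" "g \<in> Hom C b c"
  shows "is_epi C g"
proof -
  note [THEN hom_simps, simp] = assms(2,3)
  have "x = y" if "x \<in> Hom C c t" "y \<in> Hom C c t" "x \<cdot> g = y \<cdot> g" for x y t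
  proof -
    note [THEN hom_simps, simp] = that(1,2)
    have e: "x \<cdot> (g \<cdot> f) = y \<cdot> (g \<cdot> f)"
      using Comp_assoc[OF assms(2,3) that(1)] Comp_assoc[OF assms(2,3) that(2)] that(3) by simp
    show ?thesis
      by (rule epi_cancel[OF assms(1) _ that(1,2) e]) (simp add: Hom_iff)
  qed
  then show ?thesis unfolding is_epi_def by auto
qed

lemma mono_comp:
  assumes "is_mono C f" "is_mono C g" "f \<in> Hom C a b" "g \<in> Hom C b c"
  shows "is_mono C (g \<cdot> f)"
  using category.epi_comp[OF opposite_category, of g f c b a] assms by simp

lemma mono_right:
  assumes "is_mono C (g \<cdot> f)" "f \<in> Hom C a b" "g \<in> Hom C b c"
  shows "is_mono C f"
  using category.epi_left[OF opposite_category, of f g c b a] assms by simp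

lemma iso_obtain:
  assumes "is_iso C f" "f \<in> Hom C a b"
  obtains g where "g \<in> Hom C b a" "g \<cdot> f = Id C a" "f \<cdot> g = Id C b"
  using assms by (auto simp: is_iso_def Hom_iff)

lemma isoI:
  assumes "f \<in> Hom C a b" "g \<in> Hom C b a" "g \<cdot> f = Id C a" "f \<cdot> g = Id C b"
  shows "is_iso C f"
  using assms by (auto simp: is_iso_def Hom_iff)

lemma Id_mono: "a \<in> Obj C \<Longrightarrow> is_mono C (Id C a)"
  by (auto simp: is_mono_def Hom_iff)

lemma retraction_mono:
  assumes "f \<in> Hom C a b" "g \<in> Hom C b a" "g \<cdot> f = Id C a"
  shows "is_mono C f"
  using mono_right[of g f a b a] Id_mono assms HomD(4)[OF assms(1)] by simp

lemma section_epi: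
  assumes "f \<in> Hom C a b" "g \<in> Hom C b a" "f \<cdot> g = Id C b"
  shows "is_epi C f"
  using category.retraction_mono[OF opposite_category, of f b a g] assms by simp

lemma iso_mono: "is_iso C f \<Longrightarrow> f \<in> Hom C a b \<Longrightarrow> is_mono C f"
  by (metis iso_obtain retraction_mono)

lemma iso_epi: "is_iso C f \<Longrightarrow> f \<in> Hom C a b \<Longrightarrow> is_epi C f"
  by (metis iso_obtain section_epi)

end

section \<open>Differences, kernels and cokernels\<close>

context preadditive_category begin

lemma hom_group_simps:
  "carrier (hom_group C a b) = Hom C a b" "x \<otimes>\<^bsub>hom_group C a b\<^esub> y = Add C x y"
  "\<one>\<^bsub>hom_group C a b\<^esub> = Zero C a b"
  by (simp_all add: hom_group_def)

lemma hom_group_group: "\<lbrakk>a \<in> Obj C; b \<in> Obj C\<rbrakk> \<Longrightarrow> group (hom_group C a b)"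
  using hom_comm_group comm_group.axioms(2) by blast

lemma hom_group_monoid: "\<lbrakk>a \<in> Obj C; b \<in> Obj C\<rbrakk> \<Longrightarrow> monoid (hom_group C a b)"
  using hom_group_group group.is_monoid by blast

lemma Zero_hom:
  assumes "a \<in> Obj C" "b \<in> Obj C"
  shows "Zero C a b \<in> Hom C a b"
  using monoid.one_closed[OF hom_group_monoid[OF assms]] by (simp only: hom_group_simps)

lemma Zero_arr [simp]:
  assumes "a \<in> Obj C" "b \<in> Obj C"
  shows "Zero C a b \<in> Arr C" "Dom C (Zero C a b) = a" "Cod C (Zero C a b) = b"
  using HomD(1-3)[OF Zero_hom[OF assms]] by blast+

text \<open>
  The hom-groups are separate structures; this difference finds the relevant one from its second
  argument.
\<close>

definition Sub :: "'b \<Rightarrow> 'b \<Rightarrow> 'b" where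
  "Sub f g = Add C f (m_inv (hom_group C (Dom C g) (Cod C g)) g)"

lemma Sub_eq: "g \<in> Hom C a b \<Longrightarrow> Sub f g = Add C f (m_inv (hom_group C a b) g)"
  using HomD(2,3) by (simp add: Sub_def)

lemma Add_hom:
  assumes "f \<in> Hom C a b" "g \<in> Hom C a b"
  shows "Add C f g \<in> Hom C a b"
  using monoid.m_closed[OF hom_group_monoid[OF HomD(4,5)[OF assms(1)]], of f g] assms
  by (simp only: hom_group_simps)

lemma inv_hom:
  assumes "g \<in> Hom C a b"
  shows "m_inv (hom_group C a b) g \<in> Hom C a b"
  using group.inv_closed[OF hom_group_group[OF HomD(4,5)[OF assms]], of g] assms
  by (simp only: hom_group_simps)

lemma Sub_hom: "\<lbrakk>f \<in> Hom C a b; g \<in> Hom C a b\<rbrakk> \<Longrightarrow> Sub f g \<in> Hom C a b"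
  using Add_hom inv_hom Sub_eq by metis

lemma Sub_self:
  assumes "f \<in> Hom C a b"
  shows "Sub f f = Zero C a b"
  using group.r_inv[OF hom_group_group[OF HomD(4,5)[OF assms]], of f] assms
  by (simp only: hom_group_simps Sub_eq[OF assms])

lemma Add_Zero:
  assumes "x \<in> Hom C a b"
  shows "Add C x (Zero C a b) = x" "Add C (Zero C a b) x = x"
  using monoid.r_one[OF hom_group_monoid[OF HomD(4,5)[OF assms]], of x]
    monoid.l_one[OF hom_group_monoid[OF HomD(4,5)[OF assms]], of x] assms
  by (simp_all only: hom_group_simps)

lemma Sub_Add:
  assumes "f \<in> Hom C a b" "g \<in> Hom C a b"
  shows "Add C (Sub f g) g = f"
proof -
  note G = HomD(4,5)[OF assms(1)]
  have "Add C (Add C f (m_inv (hom_group C a b) g)) g = Add C f (Add C (m_inv (hom_group C a b) g) g)"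
    using monoid.m_assoc[OF hom_group_monoid[OF G], of f "m_inv (hom_group C a b) g" g]
      assms inv_hom[OF assms(2)] by (simp only: hom_group_simps)
  also have "Add C (m_inv (hom_group C a b) g) g = Zero C a b"
    using group.l_inv[OF hom_group_group[OF G], of g] assms by (simp only: hom_group_simps)
  finally show ?thesis using Add_Zero(1)[OF assms(1)] by (simp only: Sub_eq[OF assms(2)])
qed

lemma Sub_eq_Zero:
  assumes "f \<in> Hom C a b" "g \<in> Hom C a b" "Sub f g = Zero C a b"
  shows "f = g"
  using Sub_Add[OF assms(1,2)] Add_Zero(2)[OF assms(2)] assms(3) by simp

lemma Add_left_cancel:
  assumes "x \<in> Hom C a b" "y \<in> Hom C a b" "z \<in> Hom C a b" "Add C x z = Add C y z"
  shows "x = y"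
proof -
  have "(Add C x z = Add C y z) = (x = y)"
    using group.right_cancel[OF hom_group_group[OF HomD(4,5)[OF assms(1)]], of z x y] assms(1-3)
    by (simp add: hom_group_simps)
  then show ?thesis using assms(4) by blast
qed

lemma Comp_Sub:
  assumes "f \<in> Hom C a b" "f' \<in> Hom C a b" "g \<in> Hom C b c"
  shows "g \<cdot> Sub f f' = Sub (g \<cdot> f) (g \<cdot> f')"
proof (rule Add_left_cancel[of _ a c _ "g \<cdot> f'"])
  note h = Sub_hom[OF assms(1,2)] Comp_in_Hom[OF assms(1,3)] Comp_in_Hom[OF assms(2,3)]
  show "Add C (g \<cdot> Sub f f') (g \<cdot> f') = Add C (Sub (g \<cdot> f) (g \<cdot> f')) (g \<cdot> f')"
    using Comp_Add[OF h(1) assms(2,3)] Sub_Add[OF assms(1,2)] Sub_Add[OF h(2,3)] by simp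
  show "g \<cdot> Sub f f' \<in> Hom C a c" "Sub (g \<cdot> f) (g \<cdot> f') \<in> Hom C a c" "g \<cdot> f' \<in> Hom C a c"
    using h Sub_hom[OF h(2,3)] Comp_in_Hom[OF h(1) assms(3)] by blast+
qed

lemma opposite_preadditive: "preadditive_category (opposite C)"
  unfolding preadditive_category_def preadditive_category_axioms_def
  by (simp add: opposite_category hom_comm_group Comp_Add Add_Comp)

lemma Sub_opposite: "preadditive_category.Sub (opposite C) f g = Sub f g"
  by (simp add: Sub_def preadditive_category.Sub_def[OF opposite_preadditive])

lemma Sub_Comp:
  assumes "f \<in> Hom C a b" "g \<in> Hom C b c" "g' \<in> Hom C b c"
  shows "Sub g g' \<cdot> f = Sub (g \<cdot> f) (g' \<cdot> f)"
  using preadditive_category.Comp_Sub[OF opposite_preadditive, of g c b g' f a] assms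
  by (simp add: Sub_opposite)

lemma Comp_Zero [simp]:
  assumes "f \<in> Arr C" "Dom C f = b" "a \<in> Obj C"
  shows "f \<cdot> Zero C a b = Zero C a (Cod C f)"
proof -
  have b: "b \<in> Obj C" using assms Dom_in_Obj by auto
  have f: "f \<in> Hom C b (Cod C f)" using assms by auto
  note z = Zero_hom[OF assms(3) b]
  show ?thesis
    using Comp_Sub[OF z z f] Sub_self[OF Comp_in_Hom[OF z f]] by (simp only: Sub_self[OF z])
qed

lemma Zero_Comp [simp]:
  assumes "f \<in> Arr C" "Cod C f = b" "c \<in> Obj C"
  shows "Zero C b c \<cdot> f = Zero C (Dom C f) c"
  using preadditive_category.Comp_Zero[OF opposite_preadditive, of f b c] assms by simp

lemma monoI:
  assumes f: "f \<in> Hom C a b"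
    and cancel: "\<And>t x. x \<in> Hom C t a \<Longrightarrow> f \<cdot> x = Zero C t b \<Longrightarrow> x = Zero C t a"
  shows "is_mono C f"
proof -
  note [THEN hom_simps, simp] = f
  have "x = y" if "x \<in> Hom C t a" "y \<in> Hom C t a" "f \<cdot> x = f \<cdot> y" for x y t
  proof -
    have "f \<cdot> Sub x y = Zero C t b"
      using Comp_Sub[OF that(1,2) f] that Sub_self[OF Comp_in_Hom[OF that(2) f]] by simp
    then show ?thesis using cancel[OF Sub_hom[OF that(1,2)]] Sub_eq_Zero that by blast
  qed
  then show ?thesis unfolding is_mono_def by auto
qed

lemma mono_Zero:
  assumes "is_mono C f" "f \<in> Hom C a b" "x \<in> Hom C t a" "f \<cdot> x = Zero C t b"
  shows "x = Zero C t a"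
  by (rule mono_cancel[OF assms(1-3)]) (use assms HomD in auto)

lemma epiI:
  assumes f: "f \<in> Hom C a b"
    and cancel: "\<And>t x. x \<in> Hom C b t \<Longrightarrow> x \<cdot> f = Zero C a t \<Longrightarrow> x = Zero C b t"
  shows "is_epi C f"
  using preadditive_category.monoI[OF opposite_preadditive, of f b a] assms by simp

lemma epi_Zero:
  assumes "is_epi C f" "f \<in> Hom C a b" "x \<in> Hom C b t" "x \<cdot> f = Zero C a t"
  shows "x = Zero C b t"
  using preadditive_category.mono_Zero[OF opposite_preadditive, of f b a x t] assms by simp

lemma kernel_ex1:
  assumes "is_kernel C k f" "s \<in> Obj C" "h \<in> Hom C s (Dom C f)" "f \<cdot> h = Zero C s (Cod C f)"
  shows "\<exists>!u. u \<in> Hom C s (Dom C k) \<and> k \<cdot> u = h"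
  using assms unfolding is_kernel_def by blast

lemma kernelD:
  assumes "is_kernel C k f" "f \<in> Hom C a b"
  shows "k \<in> Hom C (Dom C k) a" "f \<cdot> k = Zero C (Dom C k) b" "is_mono C k"
proof -
  note [THEN hom_simps, simp] = assms(2)
  show k: "k \<in> Hom C (Dom C k) a" and fk: "f \<cdot> k = Zero C (Dom C k) b"
    using assms by (auto simp: is_kernel_def)
  note [simp] = HomD(1,3,4,5)[OF k]
  show "is_mono C k"
  proof (rule monoI[OF k])
    fix t x assume x: "x \<in> Hom C t (Dom C k)" "k \<cdot> x = Zero C t a"
    note [THEN hom_simps, simp] = x(1)
    have "\<exists>!u. u \<in> Hom C t (Dom C k) \<and> k \<cdot> u = Zero C t a"
      by (rule kernel_ex1[OF assms(1)]) (simp_all add: Zero_hom)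
    moreover have "k \<cdot> Zero C t (Dom C k) = Zero C t a" "Zero C t (Dom C k) \<in> Hom C t (Dom C k)"
      by auto
    ultimately show "x = Zero C t (Dom C k)" using x by blast
  qed
qed

lemma kernel_lift:
  assumes "is_kernel C k f" "f \<in> Hom C a b" "h \<in> Hom C t a" "f \<cdot> h = Zero C t b"
  obtains u where "u \<in> Hom C t (Dom C k)" "k \<cdot> u = h"
proof -
  have "t \<in> Obj C" "Dom C f = a" "Cod C f = b"
    using HomD(4)[OF assms(3)] HomD(2,3)[OF assms(2)] by blast+
  then have "\<exists>!u. u \<in> Hom C t (Dom C k) \<and> k \<cdot> u = h"
    using assms(3,4) by (intro kernel_ex1[OF assms(1)]) (simp_all only:)
  then show thesis using that by blast
qed

lemma kernelI:
  assumes f: "f \<in> Hom C a b" and k: "k \<in> Hom C c a" and "f \<cdot> k = Zero C c b" and m: "is_mono C k"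
    and lift: "\<And>t h. h \<in> Hom C t a \<Longrightarrow> f \<cdot> h = Zero C t b \<Longrightarrow> \<exists>u\<in>Hom C t c. k \<cdot> u = h"
  shows "is_kernel C k f"
proof -
  note [THEN hom_simps, simp] = f k
  have "\<exists>!u. u \<in> Hom C t (Dom C k) \<and> k \<cdot> u = h"
    if h: "h \<in> Hom C t (Dom C f)" "f \<cdot> h = Zero C t (Cod C f)" for t h
  proof -
    obtain u where "u \<in> Hom C t c" "k \<cdot> u = h" using lift[of h t] h by auto
    then show ?thesis using mono_cancel[OF m k] h(1)
      by (intro ex1I[of _ u]) (simp_all, blast)
  qed
  then show ?thesis unfolding is_kernel_def using assms(3) k by simp
qed

lemma cokernelD:
  assumes "is_cokernel C c f" "f \<in> Hom C a b"
  shows "c \<in> Hom C b (Cod C c)" "c \<cdot> f = Zero C a (Cod C c)" "is_epi C c"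
  using preadditive_category.kernelD[OF opposite_preadditive, of c f b a] assms by simp_all

lemma cokernel_lift:
  assumes "is_cokernel C c f" "f \<in> Hom C a b" "h \<in> Hom C b t" "h \<cdot> f = Zero C a t"
  obtains u where "u \<in> Hom C (Cod C c) t" "u \<cdot> c = h"
  using preadditive_category.kernel_lift[OF opposite_preadditive, of c f b a h t] assms by auto

lemma cokernelI:
  assumes "f \<in> Hom C a b" "k \<in> Hom C b c" "k \<cdot> f = Zero C a c" "is_epi C k"
    and "\<And>t h. h \<in> Hom C b t \<Longrightarrow> h \<cdot> f = Zero C a t \<Longrightarrow> \<exists>u\<in>Hom C c t. u \<cdot> k = h"
  shows "is_cokernel C k f"
  using preadditive_category.kernelI[OF opposite_preadditive, of f b a k c] assms by simp

end

section \<open>Short exact sequences and the five lemma\<close>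

text \<open>
  The objects are arguments so that they can be read off from the predicate; with
  \<open>C\<close> replaced by its opposite the sequence is read backwards.
\<close>

definition ses :: "('o, 'm, 'z) precat_scheme \<Rightarrow> 'o \<Rightarrow> 'm \<Rightarrow> 'o \<Rightarrow> 'm \<Rightarrow> 'o \<Rightarrow> bool" where
  "ses C a f b g c \<longleftrightarrow> f \<in> Hom C a b \<and> g \<in> Hom C b c \<and> is_kernel C f g \<and> is_cokernel C g f"

lemma ses_opposite [simp]: "ses (opposite C) a f b g c = ses C c g b f a"
  by (auto simp: ses_def)

context preadditive_category begin

text \<open>
  The cancellation rules with the equation as first premise, so that a chained fact selects the
  arrow that is cancelled.
\<close>

lemma mono_eqI:
  "\<lbrakk>f \<cdot> x = f \<cdot> y; is_mono C f; f \<in> Hom C a b; x \<in> Hom C t a; y \<in> Hom C t a\<rbrakk> \<Longrightarrow> x = y"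
  by (rule mono_cancel)

lemma epi_eqI:
  "\<lbrakk>x \<cdot> f = y \<cdot> f; is_epi C f; f \<in> Hom C a b; x \<in> Hom C b t; y \<in> Hom C b t\<rbrakk> \<Longrightarrow> x = y"
  by (rule epi_cancel)

lemma mono_ZeroI:
  "\<lbrakk>f \<cdot> x = Zero C t b; is_mono C f; f \<in> Hom C a b; x \<in> Hom C t a\<rbrakk> \<Longrightarrow> x = Zero C t a"
  by (rule mono_Zero)

lemma epi_ZeroI:
  "\<lbrakk>x \<cdot> f = Zero C a t; is_epi C f; f \<in> Hom C a b; x \<in> Hom C b t\<rbrakk> \<Longrightarrow> x = Zero C b t"
  by (rule epi_Zero)

lemma mono_IdI:
  assumes "f \<cdot> x = f" "is_mono C f" "f \<in> Hom C a b" "x \<in> Hom C a a"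
  shows "x = Id C a"
  by (rule mono_eqI[OF _ assms(2-4) Id_in_Hom]) (use assms(1) HomD[OF assms(3)] in simp_all)

lemma kernel_lift_hom:
  assumes "is_kernel C k f" "f \<in> Hom C a b" "k \<in> Hom C c a" "h \<in> Hom C t a" "f \<cdot> h = Zero C t b"
  obtains u where "u \<in> Hom C t c" "k \<cdot> u = h"
  using kernel_lift[OF assms(1,2,4,5)] HomD(2)[OF assms(3)] by metis

lemma cokernel_lift_hom:
  assumes "is_cokernel C k f" "f \<in> Hom C b a" "k \<in> Hom C a c" "h \<in> Hom C a t" "h \<cdot> f = Zero C b t"
  obtains u where "u \<in> Hom C c t" "u \<cdot> k = h"
  using cokernel_lift[OF assms(1,2,4,5)] HomD(3)[OF assms(3)] by metis

lemma kernel_Zero: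
  assumes "is_kernel C k f" "f \<in> Hom C a b" "k \<in> Hom C c a"
  shows "f \<cdot> k = Zero C c b"
  using kernelD(2)[OF assms(1,2)] HomD(2)[OF assms(3)] by metis

lemma cokernel_Zero:
  assumes "is_cokernel C k f" "f \<in> Hom C b a" "k \<in> Hom C a c"
  shows "k \<cdot> f = Zero C b c"
  using cokernelD(2)[OF assms(1,2)] HomD(3)[OF assms(3)] by metis

lemma sesD:
  assumes "ses C a f b g c"
  shows "f \<in> Hom C a b" "g \<in> Hom C b c" "is_kernel C f g" "is_cokernel C g f"
    "is_mono C f" "is_epi C g" "g \<cdot> f = Zero C a c"
proof -
  show *: "f \<in> Hom C a b" "g \<in> Hom C b c" "is_kernel C f g" "is_cokernel C g f"
    using assms by (simp_all add: ses_def)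
  show "is_mono C f" "is_epi C g" using kernelD(3)[OF *(3,2)] cokernelD(3)[OF *(4,1)] by blast+
  show "g \<cdot> f = Zero C a c" by (rule kernel_Zero[OF *(3,2,1)])
qed

lemma ses_lift:
  assumes "ses C a f b g c" "h \<in> Hom C t b" "g \<cdot> h = Zero C t c"
  obtains u where "u \<in> Hom C t a" "f \<cdot> u = h"
  using kernel_lift_hom[OF sesD(3,2,1)[OF assms(1)] assms(2,3)] by blast

lemma ses_colift:
  assumes "ses C a f b g c" "h \<in> Hom C b t" "h \<cdot> f = Zero C a t"
  obtains u where "u \<in> Hom C c t" "u \<cdot> g = h"
  using cokernel_lift_hom[OF sesD(4,1,2)[OF assms(1)] assms(2,3)] by blast

text \<open>
  The inverse of \<open>\<beta>\<close> carries \<open>f'\<close> into the kernel of \<open>g\<close> because \<open>\<gamma>\<close> is mono; factoring through \<open>f\<close>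
  yields the inverse of \<open>\<alpha>\<close>.
\<close>

lemma five_kernel:
  assumes f: "f \<in> Hom C a b" "g \<in> Hom C b c" "is_kernel C f g"
    and f': "f' \<in> Hom C a' b'" "g' \<in> Hom C b' c'" "is_kernel C f' g'"
    and v: "\<alpha> \<in> Hom C a a'" "\<beta> \<in> Hom C b b'" "\<gamma> \<in> Hom C c c'"
    and e: "f' \<cdot> \<alpha> = \<beta> \<cdot> f" "g' \<cdot> \<beta> = \<gamma> \<cdot> g"
    and i: "is_iso C \<beta>" "is_mono C \<gamma>"
  shows "is_iso C \<alpha>"
proof -
  obtain \<beta>' where \<beta>': "\<beta>' \<in> Hom C b' b" "\<beta>' \<cdot> \<beta> = Id C b" "\<beta> \<cdot> \<beta>' = Id C b'"
    using iso_obtain[OF i(1) v(2)] by blast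
  note [THEN hom_simps, simp] = f(1,2) f'(1,2) v(1,2,3) \<beta>'(1)
  note [simp] = \<beta>'(2,3) Comp_reassoc[OF \<beta>'(2)] Comp_reassoc[OF \<beta>'(3)]
  have g'f': "g' \<cdot> f' = Zero C a' c'" by (rule kernel_Zero[OF f'(3,2,1)])
  have "\<gamma> \<cdot> (g \<cdot> (\<beta>' \<cdot> f')) = Zero C a' c'"
    using g'f' by (simp flip: Comp_reassoc2[OF e(2)])
  then have "g \<cdot> (\<beta>' \<cdot> f') = Zero C a' c"
    by (rule mono_ZeroI[OF _ i(2) v(3)]) (simp_all add: Hom_iff)
  moreover have "\<beta>' \<cdot> f' \<in> Hom C a' b" by (simp add: Hom_iff)
  ultimately obtain w where w: "w \<in> Hom C a' a" "f \<cdot> w = \<beta>' \<cdot> f'"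
    using kernel_lift_hom[OF f(3,2,1)] by blast
  note [THEN hom_simps, simp] = w(1)
  have "f' \<cdot> (\<alpha> \<cdot> w) = f'"
    using w(2) by (simp add: Comp_reassoc2[OF e(1)])
  then have 1: "\<alpha> \<cdot> w = Id C a'"
    by (rule mono_IdI[OF _ kernelD(3)[OF f'(3,2)] f'(1)]) (simp_all add: Hom_iff)
  have "f \<cdot> (w \<cdot> \<alpha>) = f" by (simp add: Comp_reassoc2[OF w(2)] e(1))
  then have 2: "w \<cdot> \<alpha> = Id C a"
    by (rule mono_IdI[OF _ kernelD(3)[OF f(3,2)] f(1)]) (simp_all add: Hom_iff)
  show ?thesis by (rule isoI[OF v(1) w(1) 2 1])
qed

lemma five_cokernel:
  assumes "f \<in> Hom C a b" "g \<in> Hom C b c" "is_cokernel C g f"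
    and "f' \<in> Hom C a' b'" "g' \<in> Hom C b' c'" "is_cokernel C g' f'"
    and "\<alpha> \<in> Hom C a a'" "\<beta> \<in> Hom C b b'" "\<gamma> \<in> Hom C c c'"
    and "f' \<cdot> \<alpha> = \<beta> \<cdot> f" "g' \<cdot> \<beta> = \<gamma> \<cdot> g"
    and "is_iso C \<beta>" "is_epi C \<alpha>"
  shows "is_iso C \<gamma>"
  using preadditive_category.five_kernel[OF opposite_preadditive,
      of g' c' b' f' a' g c b f a \<gamma> \<beta> \<alpha>] assms by simp

lemma four_mono:
  assumes f: "ses C a f b g c" and f': "f' \<in> Hom C a' b'" "g' \<in> Hom C b' c'" "is_mono C f'"
    and v: "\<alpha> \<in> Hom C a a'" "\<beta> \<in> Hom C b b'" "\<gamma> \<in> Hom C c c'"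
    and e: "f' \<cdot> \<alpha> = \<beta> \<cdot> f" "g' \<cdot> \<beta> = \<gamma> \<cdot> g"
    and i: "is_mono C \<alpha>" "is_mono C \<gamma>"
  shows "is_mono C \<beta>"
proof (rule monoI[OF v(2)])
  fix t x assume x: "x \<in> Hom C t b" "\<beta> \<cdot> x = Zero C t b'"
  note [THEN hom_simps, simp] = sesD(1)[OF f] sesD(2)[OF f] f'(1,2) v(1,2,3) x(1)
  note [simp] = x(2)
  have "\<gamma> \<cdot> (g \<cdot> x) = Zero C t c'" by (simp flip: Comp_reassoc2[OF e(2)])
  then have "g \<cdot> x = Zero C t c"
    by (rule mono_ZeroI[OF _ i(2) v(3)]) (simp_all add: Hom_iff)
  then obtain w where w: "w \<in> Hom C t a" "f \<cdot> w = x" using ses_lift[OF f x(1)] by blast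
  note [THEN hom_simps, simp] = w(1)
  have "f' \<cdot> (\<alpha> \<cdot> w) = Zero C t b'" by (simp add: Comp_reassoc2[OF e(1)] w(2))
  then have "\<alpha> \<cdot> w = Zero C t a'"
    by (rule mono_ZeroI[OF _ f'(3,1)]) (simp_all add: Hom_iff)
  then have "w = Zero C t a" using mono_Zero[OF i(1) v(1) w(1)] by blast
  then show "x = Zero C t b" using w(2) by simp
qed

lemma four_epi:
  assumes "ses C a' f' b' g' c'" "f \<in> Hom C a b" "g \<in> Hom C b c" "is_epi C g"
    and "\<alpha> \<in> Hom C a a'" "\<beta> \<in> Hom C b b'" "\<gamma> \<in> Hom C c c'"
    and "f' \<cdot> \<alpha> = \<beta> \<cdot> f" "g' \<cdot> \<beta> = \<gamma> \<cdot> g"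
    and "is_epi C \<alpha>" "is_epi C \<gamma>"
  shows "is_epi C \<beta>"
  using preadditive_category.four_mono[OF opposite_preadditive,
      of c' g' b' f' a' g c b f a \<gamma> \<beta> \<alpha>] assms by simp

end

section \<open>Images and exactness\<close>

context abelian_category begin

lemma opposite_abelian: "abelian_category (opposite C)"
  unfolding abelian_category_def abelian_category_axioms_def
proof (intro conjI allI impI)
  fix a b assume "a \<in> Obj (opposite C)" "b \<in> Obj (opposite C)"
  then obtain s i j p q where "is_biproduct C a b s i j p q" using ex_biproduct[of a b] by auto
  then show "\<exists>s i j p q. is_biproduct (opposite C) a b s i j p q"
    unfolding is_biproduct_opposite by blast
qed (simp_all add: opposite_preadditive ex_zero_object ex_kernel ex_cokernel
  mono_is_kernel epi_is_cokernel)

lemma kernel_exists: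
  assumes "f \<in> Hom C a b"
  obtains k c where "k \<in> Hom C c a" "is_kernel C k f"
  using ex_kernel[OF HomD(1)[OF assms]] kernelD(1)[OF _ assms] by blast

lemma cokernel_exists:
  assumes "f \<in> Hom C a b"
  obtains k c where "k \<in> Hom C b c" "is_cokernel C k f"
  using ex_cokernel[OF HomD(1)[OF assms]] cokernelD(1)[OF _ assms] by blast

text \<open>
  A mono is a kernel of some \<open>g\<close>; as \<open>g\<close> factors through the cokernel of the mono, whatever the
  cokernel kills is killed by \<open>g\<close>.
\<close>

lemma mono_kernel_of_cokernel:
  assumes m: "is_mono C m" "m \<in> Hom C a b" and c: "is_cokernel C c m" "c \<in> Hom C b d"
  shows "is_kernel C m c"
proof (rule kernelI[OF c(2) m(2) cokernel_Zero[OF c(1) m(2) c(2)] m(1)])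
  obtain g where g: "is_kernel C m g" using mono_is_kernel[OF m(1)] by blast
  define b' where "b' = Cod C g"
  have gm: "g \<in> Arr C" "m \<in> Hom C (Dom C m) (Dom C g)" using g by (simp_all add: is_kernel_def)
  have gh: "g \<in> Hom C b b'" using gm HomD(3)[OF gm(2)] HomD(3)[OF m(2)] by (simp add: Hom_iff b'_def)
  obtain g' where g': "g' \<in> Hom C d b'" "g' \<cdot> c = g"
    using cokernel_lift_hom[OF c(1) m(2) c(2) gh kernel_Zero[OF g gh m(2)]] by blast
  fix t h assume h: "h \<in> Hom C t b" "c \<cdot> h = Zero C t d"
  note [THEN hom_simps, simp] = h(1) c(2) g'(1)
  have "g \<cdot> h = Zero C t b'" using h(2) by (simp flip: g'(2))
  then show "\<exists>u\<in>Hom C t a. m \<cdot> u = h" using kernel_lift_hom[OF g gh m(2) h(1)] by blast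
qed

lemma epi_cokernel_of_kernel:
  assumes "is_epi C m" "m \<in> Hom C b a" "is_kernel C c m" "c \<in> Hom C d b"
  shows "is_cokernel C m c"
  using abelian_category.mono_kernel_of_cokernel[OF opposite_abelian, of m a b c d] assms by simp

lemma ses_of_kernel:
  assumes "is_kernel C f g" "f \<in> Hom C a b" "g \<in> Hom C b c" "is_epi C g"
  shows "ses C a f b g c"
  using assms epi_cokernel_of_kernel by (auto simp: ses_def)

lemma ses_of_cokernel:
  assumes "is_cokernel C g f" "f \<in> Hom C a b" "g \<in> Hom C b c" "is_mono C f"
  shows "ses C a f b g c"
  using assms mono_kernel_of_cokernel by (auto simp: ses_def)

text \<open>
  This is where normality of monos enters. If \<open>h\<close> kills \<open>u\<close>, then \<open>f\<close> factors through the mono \<open>k \<cdot> k'\<close>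
  with \<open>k'\<close> a kernel of \<open>h\<close>. This mono is a kernel of some \<open>g\<close>; since \<open>g \<cdot> f = 0\<close>, the arrow \<open>g\<close> factors
  through the cokernel of \<open>f\<close> and kills \<open>k\<close>, so \<open>k'\<close> has a right inverse and \<open>h = 0\<close>.
\<close>

lemma image_lift_epi:
  assumes f: "f \<in> Hom C a b" and c: "is_cokernel C c f" "c \<in> Hom C b d"
    and k: "is_kernel C k c" "k \<in> Hom C x b" and u: "u \<in> Hom C a x" "k \<cdot> u = f"
  shows "is_epi C u"
proof (rule epiI[OF u(1)])
  fix t h assume h: "h \<in> Hom C x t" "h \<cdot> u = Zero C a t"
  obtain k' y where k': "k' \<in> Hom C y x" "is_kernel C k' h" using kernel_exists[OF h(1)] by blast
  obtain u' where u': "u' \<in> Hom C a y" "k' \<cdot> u' = u"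
    using kernel_lift_hom[OF k'(2) h(1) k'(1) u(1) h(2)] by blast
  note [THEN hom_simps, simp] = f c(2) k(2) u(1) h(1) k'(1) u'(1)
  have mk: "is_mono C k" by (rule kernelD(3)[OF k(1) c(2)])
  have m: "is_mono C (k \<cdot> k')" by (rule mono_comp[OF kernelD(3)[OF k'(2) h(1)] mk k'(1) k(2)])
  have mh: "k \<cdot> k' \<in> Hom C y b" by (simp add: Hom_iff)
  obtain g z where g: "g \<in> Hom C b z" "is_cokernel C g (k \<cdot> k')" using cokernel_exists[OF mh] by blast
  note [THEN hom_simps, simp] = g(1)
  have gm: "is_kernel C (k \<cdot> k') g" by (rule mono_kernel_of_cokernel[OF m mh g(2,1)])
  have 0: "g \<cdot> (k \<cdot> k') = Zero C y z" by (rule kernel_Zero[OF gm g(1) mh])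
  have "g \<cdot> f = Zero C a z"
    using arg_cong[OF 0, of "\<lambda>w. w \<cdot> u'"] by (simp add: u' u(2))
  then obtain g' where g': "g' \<in> Hom C d z" "g' \<cdot> c = g"
    using cokernel_lift_hom[OF c(1) f c(2) g(1)] by blast
  note [THEN hom_simps, simp] = g'(1)
  have "g \<cdot> k = Zero C x z"
    using kernel_Zero[OF k(1) c(2) k(2)] by (simp flip: g'(2))
  then obtain s where s: "s \<in> Hom C x y" "(k \<cdot> k') \<cdot> s = k"
    using kernel_lift_hom[OF gm g(1) mh k(2)] by blast
  note [THEN hom_simps, simp] = s(1)
  have "k \<cdot> (k' \<cdot> s) = k" using s(2) by simp
  then have ks: "k' \<cdot> s = Id C x"
    by (rule mono_IdI[OF _ mk k(2)]) (simp_all add: Hom_iff)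
  \<comment> \<open>The arrow \<open>s\<close> is a right inverse of the kernel \<open>k'\<close> of \<open>h\<close>.\<close>
  have "h \<cdot> (k' \<cdot> s) = Zero C x t"
    using kernel_Zero[OF k'(2) h(1) k'(1)] by (simp add: Comp_reassoc)
  then show "h = Zero C x t" by (simp add: ks)
qed

lemma epi_mono_factor:
  assumes f: "f \<in> Hom C a b"
  obtains e m x where "e \<in> Hom C a x" "m \<in> Hom C x b" "is_epi C e" "is_mono C m" "m \<cdot> e = f"
proof -
  obtain c d where c: "c \<in> Hom C b d" "is_cokernel C c f" using cokernel_exists[OF f] by blast
  obtain k x where k: "k \<in> Hom C x b" "is_kernel C k c" using kernel_exists[OF c(1)] by blast
  obtain u where u: "u \<in> Hom C a x" "k \<cdot> u = f"
    using kernel_lift_hom[OF k(2) c(1) k(1) f cokernel_Zero[OF c(2) f c(1)]] by blast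
  show thesis
    using that[OF u(1) k(1) image_lift_epi[OF f c(2,1) k(2,1) u] kernelD(3)[OF k(2) c(1)] u(2)] .
qed

lemma cokernel_precomp_epi:
  assumes "is_cokernel C c f" "f \<in> Hom C a b" "c \<in> Hom C b d"
    and "e \<in> Hom C a' a" "is_epi C e"
  shows "is_cokernel C c (f \<cdot> e)"
proof -
  note [THEN hom_simps, simp] = assms(2,3,4)
  show ?thesis
  proof (rule cokernelI[of _ a' b _ d])
    show "f \<cdot> e \<in> Hom C a' b" by (simp add: Hom_iff)
    show "c \<in> Hom C b d" by fact
    show "c \<cdot> (f \<cdot> e) = Zero C a' d" by (simp add: Comp_reassoc[OF cokernel_Zero[OF assms(1-3)]])
    show "is_epi C c" by (rule cokernelD(3)[OF assms(1,2)])
    fix t h assume h: "h \<in> Hom C b t" "h \<cdot> (f \<cdot> e) = Zero C a' t"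
    note [THEN hom_simps, simp] = h(1)
    have "(h \<cdot> f) \<cdot> e = Zero C a' t" using h by simp
    then have "h \<cdot> f = Zero C a t" by (rule epi_ZeroI[OF _ assms(5,4)]) (simp_all add: Hom_iff)
    then show "\<exists>u\<in>Hom C d t. u \<cdot> c = h" using cokernel_lift_hom[OF assms(1-3) h(1)] by blast
  qed
qed

lemma cokernel_of_precomp_epi:
  assumes "is_cokernel C c (f \<cdot> e)" "f \<in> Hom C a b" "c \<in> Hom C b d"
    and "e \<in> Hom C a' a" "is_epi C e"
  shows "is_cokernel C c f"
proof -
  note [THEN hom_simps, simp] = assms(2,3,4)
  have fe: "f \<cdot> e \<in> Hom C a' b" by (simp add: Hom_iff)
  show ?thesis
  proof (rule cokernelI[of _ a b _ d])
    show "f \<in> Hom C a b" "c \<in> Hom C b d" by fact+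
    have "(c \<cdot> f) \<cdot> e = Zero C a' d" using cokernel_Zero[OF assms(1) fe assms(3)] by simp
    then show "c \<cdot> f = Zero C a d" by (rule epi_ZeroI[OF _ assms(5,4)]) (simp_all add: Hom_iff)
    show "is_epi C c" by (rule cokernelD(3)[OF assms(1) fe])
    fix t h assume h: "h \<in> Hom C b t" "h \<cdot> f = Zero C a t"
    note [THEN hom_simps, simp] = h(1)
    have "h \<cdot> (f \<cdot> e) = Zero C a' t" by (simp add: Comp_reassoc[OF h(2)])
    then show "\<exists>u\<in>Hom C d t. u \<cdot> c = h" using cokernel_lift_hom[OF assms(1) fe assms(3) h(1)] by blast
  qed
qed

text \<open>
  The working form of exactness: the first arrow is an epi onto a kernel of the second.
\<close>

lemma exact_pair_iff_cover:
  assumes f: "f \<in> Hom C a b" and g: "g \<in> Hom C b c"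
  shows "exact_pair C f g \<longleftrightarrow>
    (\<exists>x k e. k \<in> Hom C x b \<and> e \<in> Hom C a x \<and> is_kernel C k g \<and> is_epi C e \<and> k \<cdot> e = f)"
proof
  assume "exact_pair C f g"
  then obtain k c' where k: "is_cokernel C c' f" "is_kernel C k c'" "is_kernel C k g"
    by (auto simp: exact_pair_def is_image_def)
  define x d where "x = Dom C k" and "d = Cod C c'"
  have h: "c' \<in> Hom C b d" "k \<in> Hom C x b"
    using cokernelD(1)[OF k(1) f] kernelD(1)[OF k(3) g] by (simp_all add: x_def d_def)
  obtain u where u: "u \<in> Hom C a x" "k \<cdot> u = f"
    using kernel_lift_hom[OF k(2) h(1,2) f cokernel_Zero[OF k(1) f h(1)]] by blast
  show "\<exists>x k e. k \<in> Hom C x b \<and> e \<in> Hom C a x \<and> is_kernel C k g \<and> is_epi C e \<and> k \<cdot> e = f"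
    using h(2) u k(3) image_lift_epi[OF f k(1) h(1) k(2) h(2) u] by blast
next
  assume "\<exists>x k e. k \<in> Hom C x b \<and> e \<in> Hom C a x \<and> is_kernel C k g \<and> is_epi C e \<and> k \<cdot> e = f"
  then obtain x k e where k: "k \<in> Hom C x b" "e \<in> Hom C a x" "is_kernel C k g" "is_epi C e" "k \<cdot> e = f"
    by blast
  obtain c' d where c': "c' \<in> Hom C b d" "is_cokernel C c' f" using cokernel_exists[OF f] by blast
  have "is_cokernel C c' k"
    by (rule cokernel_of_precomp_epi[OF _ k(1) c'(1) k(2,4)]) (simp add: k(5) c'(2))
  then have "is_kernel C k c'"
    by (rule mono_kernel_of_cokernel[OF kernelD(3)[OF k(3) g] k(1) _ c'(1)])
  then show "exact_pair C f g"
    using f g k c' HomD[OF f] HomD[OF g] by (auto simp: exact_pair_def is_image_def)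
qed

text \<open>
  The definition uses images and not coimages, so self-duality needs the epi-mono factorization of
  the second arrow.
\<close>

lemma exact_pair_opposite:
  assumes "exact_pair C f g"
  shows "exact_pair (opposite C) g f"
proof -
  define a b c where "a = Dom C f" and "b = Cod C f" and "c = Cod C g"
  have f: "f \<in> Hom C a b" and g: "g \<in> Hom C b c"
    using assms by (simp_all add: exact_pair_def a_def b_def c_def Hom_iff)
  obtain x k e where k: "k \<in> Hom C x b" "e \<in> Hom C a x" "is_kernel C k g" "is_epi C e" "k \<cdot> e = f"
    using assms unfolding exact_pair_iff_cover[OF f g] by blast
  obtain q m y where q: "q \<in> Hom C b y" "m \<in> Hom C y c" "is_epi C q" "is_mono C m" "m \<cdot> q = g"
    using epi_mono_factor[OF g] by blast
  note [THEN hom_simps, simp] = f g k(1,2) q(1,2)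
  have "is_kernel C k q"
  proof (rule kernelI[OF q(1) k(1) _ kernelD(3)[OF k(3) g]])
    have "m \<cdot> (q \<cdot> k) = Zero C x c"
      using kernel_Zero[OF k(3) g k(1)] by (simp flip: q(5))
    then show "q \<cdot> k = Zero C x y" by (rule mono_ZeroI[OF _ q(4,2)]) (simp_all add: Hom_iff)
    fix t h assume h: "h \<in> Hom C t b" "q \<cdot> h = Zero C t y"
    note [THEN hom_simps, simp] = h(1)
    have "g \<cdot> h = Zero C t c" by (simp add: h(2) flip: q(5))
    then show "\<exists>u\<in>Hom C t x. k \<cdot> u = h" using kernel_lift_hom[OF k(3) g k(1) h(1)] by blast
  qed
  then have "is_cokernel C q k" by (rule epi_cokernel_of_kernel[OF q(3,1) _ k(1)])
  then have "is_cokernel C q f"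
    using cokernel_precomp_epi[OF _ k(1) q(1) k(2,4)] k(5) by simp
  then show ?thesis
    unfolding abelian_category.exact_pair_iff_cover[OF opposite_abelian, of g c b f a, simplified, OF g f]
    using q by auto
qed

lemma exact_pair_opposite_iff [simp]: "exact_pair (opposite C) g f = exact_pair C f g"
  using exact_pair_opposite abelian_category.exact_pair_opposite[OF opposite_abelian, of g f]
  by auto

lemma mono_epi_iso:
  assumes f: "f \<in> Hom C a b" and "is_mono C f" "is_epi C f"
  shows "is_iso C f"
proof -
  note [THEN hom_simps, simp] = f
  obtain c d where c: "c \<in> Hom C b d" "is_cokernel C c f" using cokernel_exists[OF f] by blast
  note [THEN hom_simps, simp] = c(1)
  have "c = Zero C b d"
    by (rule epi_Zero[OF assms(3) f c(1)]) (rule cokernel_Zero[OF c(2) f c(1)])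
  then have "c \<cdot> Id C b = Zero C b d" by simp
  moreover have "Id C b \<in> Hom C b b" by (simp add: Id_in_Hom)
  ultimately obtain u where u: "u \<in> Hom C b a" "f \<cdot> u = Id C b"
    using kernel_lift_hom[OF mono_kernel_of_cokernel[OF assms(2) f c(2,1)] c(1) f] by blast
  note [THEN hom_simps, simp] = u(1)
  have "f \<cdot> (u \<cdot> f) = f" by (simp add: Comp_reassoc[OF u(2)])
  then have "u \<cdot> f = Id C a"
    by (rule mono_IdI[OF _ assms(2) f]) (simp_all add: Hom_iff)
  then show ?thesis using isoI[OF f u(1)] u(2) by blast
qed

end

context preadditive_category begin

lemma Sub_Zero:
  assumes "f \<in> Hom C a b"
  shows "Sub f (Zero C a b) = f"
proof -
  note z = Zero_hom[OF HomD(4,5)[OF assms]]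
  show ?thesis using Sub_Add[OF assms z] Add_Zero(1)[OF Sub_hom[OF assms z]] by simp
qed

lemma biproductD:
  assumes "is_biproduct C a b s i j p q"
  shows "i \<in> Hom C a s" "j \<in> Hom C b s" "p \<in> Hom C s a" "q \<in> Hom C s b"
    "p \<cdot> i = Id C a" "q \<cdot> j = Id C b" "p \<cdot> j = Zero C b a" "q \<cdot> i = Zero C a b"
    "Add C (i \<cdot> p) (j \<cdot> q) = Id C s"
  using assms by (simp_all add: is_biproduct_def)

lemma biproduct_ext:
  assumes B: "is_biproduct C a b s i j p q" and x: "x \<in> Hom C t s" and y: "y \<in> Hom C t s"
    and e: "p \<cdot> x = p \<cdot> y" "q \<cdot> x = q \<cdot> y"
  shows "x = y"
proof -
  note b = biproductD[OF B]
  note [THEN hom_simps, simp] = b(1,2,3,4)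
  have h: "i \<cdot> p \<in> Hom C s s" "j \<cdot> q \<in> Hom C s s" by (simp_all add: Hom_iff)
  have "z = Add C (i \<cdot> (p \<cdot> z)) (j \<cdot> (q \<cdot> z))" if z: "z \<in> Hom C t s" for z
  proof -
    note [THEN hom_simps, simp] = z
    have "z = Add C (i \<cdot> p) (j \<cdot> q) \<cdot> z" by (simp add: b(9))
    also have "\<dots> = Add C (i \<cdot> (p \<cdot> z)) (j \<cdot> (q \<cdot> z))" using Add_Comp[OF z h] by simp
    finally show ?thesis .
  qed
  from this[OF x] this[OF y] show ?thesis by (simp add: e)
qed

lemma biproduct_pair:
  assumes B: "is_biproduct C a b s i j p q" and x: "x \<in> Hom C t a" and y: "y \<in> Hom C t b"
  obtains w where "w \<in> Hom C t s" "p \<cdot> w = x" "q \<cdot> w = y"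
proof -
  note b = biproductD[OF B]
  note [THEN hom_simps, simp] = b(1,2,3,4) x y
  have h: "i \<cdot> x \<in> Hom C t s" "j \<cdot> y \<in> Hom C t s" by (simp_all add: Hom_iff)
  show thesis
  proof (rule that)
    show "Add C (i \<cdot> x) (j \<cdot> y) \<in> Hom C t s" by (rule Add_hom[OF h])
    show "p \<cdot> Add C (i \<cdot> x) (j \<cdot> y) = x"
      using Add_Zero(1)[OF x] by (simp add: Comp_Add[OF h b(3)] Comp_reassoc[OF b(5)] Comp_reassoc[OF b(7)])
    show "q \<cdot> Add C (i \<cdot> x) (j \<cdot> y) = y"
      using Add_Zero(2)[OF y] by (simp add: Comp_Add[OF h b(4)] Comp_reassoc[OF b(6)] Comp_reassoc[OF b(8)])
  qed
qed

end

section \<open>Pullbacks, pushouts and generalized elements\<close>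

text \<open>
  Pullbacks give generalized elements: an arrow \<open>t \<rightarrow> b\<close> is an element of \<open>b\<close>, and it has a preimage
  under an epi after replacing \<open>t\<close> by an epi cover (\<open>epi_cover\<close>). Diagram chases below are of this kind.
\<close>

definition is_pullback ::
  "('o, 'm, 'z) precat_scheme \<Rightarrow> 'o \<Rightarrow> 'm \<Rightarrow> 'm \<Rightarrow> 'm \<Rightarrow> 'm \<Rightarrow> bool" where
  "is_pullback C e p q f g \<longleftrightarrow> f \<cdot>\<^bsub>C\<^esub> p = g \<cdot>\<^bsub>C\<^esub> q \<and>
    (\<forall>t x y. x \<in> Hom C t (Dom C f) \<longrightarrow> y \<in> Hom C t (Dom C g) \<longrightarrow> f \<cdot>\<^bsub>C\<^esub> x = g \<cdot>\<^bsub>C\<^esub> y \<longrightarrow>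
      (\<exists>u\<in>Hom C t e. p \<cdot>\<^bsub>C\<^esub> u = x \<and> q \<cdot>\<^bsub>C\<^esub> u = y)) \<and>
    (\<forall>t u v. u \<in> Hom C t e \<longrightarrow> v \<in> Hom C t e \<longrightarrow>
      p \<cdot>\<^bsub>C\<^esub> u = p \<cdot>\<^bsub>C\<^esub> v \<longrightarrow> q \<cdot>\<^bsub>C\<^esub> u = q \<cdot>\<^bsub>C\<^esub> v \<longrightarrow> u = v)"

context abelian_category begin

lemma pullback_lift:
  assumes "is_pullback C e p q f g" "f \<in> Hom C a c" "g \<in> Hom C b c"
    "x \<in> Hom C t a" "y \<in> Hom C t b" "f \<cdot> x = g \<cdot> y"
  obtains u where "u \<in> Hom C t e" "p \<cdot> u = x" "q \<cdot> u = y"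
  using assms HomD(2)[OF assms(2)] HomD(2)[OF assms(3)] unfolding is_pullback_def by blast

lemma pullback_ext:
  assumes "is_pullback C e p q f g" "u \<in> Hom C t e" "v \<in> Hom C t e" "p \<cdot> u = p \<cdot> v" "q \<cdot> u = q \<cdot> v"
  shows "u = v"
  using assms unfolding is_pullback_def by blast

text \<open>
  The pullback is the kernel of the difference \<open>a \<oplus> b \<rightarrow> c\<close>. If \<open>f\<close> is epi, so is this difference;
  it is then a cokernel of its kernel, and an arrow \<open>h\<close> out of \<open>b\<close> that kills the projection of the
  pullback induces an arrow \<open>v\<close> out of \<open>c\<close> with \<open>v \<cdot> f = 0\<close>, so \<open>v = 0\<close> and \<open>h = 0\<close>.
\<close>

lemma pullback_exists:
  assumes f: "f \<in> Hom C a c" and g: "g \<in> Hom C b c"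
  obtains e p q where "p \<in> Hom C e a" "q \<in> Hom C e b" "is_pullback C e p q f g"
    "is_epi C f \<Longrightarrow> is_epi C q"
proof -
  obtain s i j p q where B: "is_biproduct C a b s i j p q"
    using ex_biproduct HomD(4)[OF f] HomD(4)[OF g] by blast
  note b = biproductD[OF B]
  note [THEN hom_simps, simp] = f g b(1,2,3,4)
  have h: "f \<cdot> p \<in> Hom C s c" "g \<cdot> q \<in> Hom C s c" by (simp_all add: Hom_iff)
  define d where "d = Sub (f \<cdot> p) (g \<cdot> q)"
  have d: "d \<in> Hom C s c" unfolding d_def by (rule Sub_hom[OF h])
  note [THEN hom_simps, simp] = d
  have dx: "d \<cdot> x = Sub (f \<cdot> (p \<cdot> x)) (g \<cdot> (q \<cdot> x))" if x: "x \<in> Hom C t s" for t x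
    using Sub_Comp[OF x h] HomD[OF x] by (simp add: d_def)
  obtain k e where k: "k \<in> Hom C e s" "is_kernel C k d" using kernel_exists[OF d] by blast
  note [THEN hom_simps, simp] = k(1)
  have pq: "p \<cdot> k \<in> Hom C e a" "q \<cdot> k \<in> Hom C e b" by (simp_all add: Hom_iff)
  have fg: "f \<cdot> (p \<cdot> k) \<in> Hom C e c" "g \<cdot> (q \<cdot> k) \<in> Hom C e c" by (simp_all add: Hom_iff)
  have dk: "d \<cdot> k = Zero C e c" by (rule kernel_Zero[OF k(2) d k(1)])
  have mk: "is_mono C k" by (rule kernelD(3)[OF k(2) d])
  have 1: "f \<cdot> (p \<cdot> k) = g \<cdot> (q \<cdot> k)"
    using dx[OF k(1)] dk by (intro Sub_eq_Zero[OF fg]) simp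
  have 2: "\<exists>u\<in>Hom C t e. (p \<cdot> k) \<cdot> u = x \<and> (q \<cdot> k) \<cdot> u = y"
    if xy: "x \<in> Hom C t a" "y \<in> Hom C t b" "f \<cdot> x = g \<cdot> y" for t x y
  proof -
    obtain w where w: "w \<in> Hom C t s" "p \<cdot> w = x" "q \<cdot> w = y"
      using biproduct_pair[OF B xy(1,2)] by blast
    have "d \<cdot> w = Zero C t c"
      using Sub_self[OF Comp_in_Hom[OF xy(2) g]] by (simp add: dx[OF w(1)] w(2,3) xy(3))
    then obtain u where u: "u \<in> Hom C t e" "k \<cdot> u = w" using kernel_lift_hom[OF k(2) d k(1) w(1)] by blast
    note [THEN hom_simps, simp] = u(1)
    show ?thesis using u w(2,3) by (intro bexI[OF _ u(1)]) simp
  qed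
  have 3: "u = v" if uv: "u \<in> Hom C t e" "v \<in> Hom C t e" "(p \<cdot> k) \<cdot> u = (p \<cdot> k) \<cdot> v"
    "(q \<cdot> k) \<cdot> u = (q \<cdot> k) \<cdot> v" for t u v
  proof -
    note [THEN hom_simps, simp] = uv(1,2)
    have "k \<cdot> u = k \<cdot> v"
      by (rule biproduct_ext[OF B, of _ t]) (use uv(3,4) in \<open>simp_all add: Hom_iff\<close>)
    then show ?thesis by (rule mono_eqI[OF _ mk k(1) uv(1,2)])
  qed
  have 4: "is_epi C (q \<cdot> k)" if epi: "is_epi C f"
  proof (rule epiI[OF pq(2)])
    have "d \<cdot> i = f"
    proof -
      have "d \<cdot> i = Sub f (Zero C a c)" using dx[OF b(1)] by (simp add: b(5,8))
      also have "\<dots> = f" by (rule Sub_Zero[OF f])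
      finally show ?thesis .
    qed
    then have "is_epi C d" using epi_left[OF _ b(1) d] epi by simp
    then have c: "is_cokernel C d k" by (rule epi_cokernel_of_kernel[OF _ d k(2,1)])
    fix t h assume h: "h \<in> Hom C b t" "h \<cdot> (q \<cdot> k) = Zero C e t"
    note [THEN hom_simps, simp] = h(1)
    have hq: "h \<cdot> q \<in> Hom C s t" by (simp add: Hom_iff)
    obtain v where v: "v \<in> Hom C c t" "v \<cdot> d = h \<cdot> q"
      using cokernel_lift_hom[OF c k(1) d hq] h(2) by auto
    note [THEN hom_simps, simp] = v(1)
    have "v \<cdot> f = (h \<cdot> q) \<cdot> i" using Comp_reassoc[OF v(2), of i] by (simp add: \<open>d \<cdot> i = f\<close>)
    also have "\<dots> = Zero C a t" by (simp add: b(8))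
    finally have "v = Zero C c t" by (rule epi_ZeroI[OF _ epi f v(1)])
    then have hq0: "h \<cdot> q = Zero C s t" using v(2) by simp
    have "h = (h \<cdot> q) \<cdot> j" by (simp add: b(6))
    then show "h = Zero C b t" by (simp add: hq0 del: Comp_assoc_arr)
  qed
  have "is_pullback C e (p \<cdot> k) (q \<cdot> k) f g"
    unfolding is_pullback_def using 1 2 3 by simp
  then show thesis using that[OF pq] 4 by blast
qed

lemma epi_cover:
  assumes "is_epi C e" "e \<in> Hom C a b" "h \<in> Hom C t b"
  obtains s c u where "c \<in> Hom C s t" "is_epi C c" "u \<in> Hom C s a" "e \<cdot> u = h \<cdot> c"
  using pullback_exists[OF assms(2,3)] assms(1) unfolding is_pullback_def by metis

lemma epi_of_cover:
  assumes "e \<in> Hom C a b" "c \<in> Hom C s b" "is_epi C c" "u \<in> Hom C s a" "e \<cdot> u = c"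
  shows "is_epi C e"
  using epi_left[OF _ assms(4,1)] assms by simp

lemma cokernel_cover:
  assumes c: "is_cokernel C c f" "f \<in> Hom C a b" "c \<in> Hom C b d" and h: "h \<in> Hom C t b" "c \<cdot> h = Zero C t d"
  obtains s w u where "w \<in> Hom C s t" "is_epi C w" "u \<in> Hom C s a" "f \<cdot> u = h \<cdot> w"
proof -
  obtain k x where k: "k \<in> Hom C x b" "is_kernel C k c" using kernel_exists[OF c(3)] by blast
  obtain e where e: "e \<in> Hom C a x" "k \<cdot> e = f"
    using kernel_lift_hom[OF k(2) c(3) k(1) c(2) cokernel_Zero[OF c]] by blast
  have epi: "is_epi C e" by (rule image_lift_epi[OF c(2,1,3) k(2,1) e])
  obtain h' where h': "h' \<in> Hom C t x" "k \<cdot> h' = h" using kernel_lift_hom[OF k(2) c(3) k(1) h] by blast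
  obtain s w u where w: "w \<in> Hom C s t" "is_epi C w" "u \<in> Hom C s a" "e \<cdot> u = h' \<cdot> w"
    using epi_cover[OF epi e(1) h'(1)] by blast
  note [THEN hom_simps, simp] = c(2) k(1) e(1) h'(1) w(1,3)
  have "f \<cdot> u = h \<cdot> w" by (simp add: w(4) flip: e(2) h'(2))
  then show thesis using that w by blast
qed

text \<open>
  Here the pullback is arbitrary; surjectivity is inherited because the identity of the target can be
  lifted on a cover.
\<close>

lemma pullback_epi:
  assumes E: "is_pullback C e p q f g" and h: "f \<in> Hom C a c" "g \<in> Hom C b c" "q \<in> Hom C e b"
    and "is_epi C f"
  shows "is_epi C q"
proof -
  obtain s w u where u: "w \<in> Hom C s b" "is_epi C w" "u \<in> Hom C s a" "f \<cdot> u = g \<cdot> w"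
    using epi_cover[OF assms(5) h(1,2)] by blast
  then obtain x where "x \<in> Hom C s e" "q \<cdot> x = w" using pullback_lift[OF E h(1,2) u(3,1,4)] by blast
  then show ?thesis using epi_of_cover[OF h(3) u(1,2)] by blast
qed

lemma pullback_sym: "is_pullback C e p q f g \<Longrightarrow> is_pullback C e q p g f"
  unfolding is_pullback_def by metis

lemma pullback_ses:
  assumes S: "ses C k u b v a" and x: "x \<in> Hom C t a"
    and E: "p \<in> Hom C E b" "e \<in> Hom C E t" "is_pullback C E p e v x"
  obtains l where "ses C k l E e t" "p \<cdot> l = u"
proof -
  note S' = sesD[OF S]
  note epi = pullback_epi[OF E(3) S'(2) x E(2) S'(6)]
  note [THEN hom_simps, simp] = S'(1,2) x E(1,2)
  have vp: "v \<cdot> p = x \<cdot> e" using E(3) by (simp add: is_pullback_def)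
  obtain l where l: "l \<in> Hom C k E" "p \<cdot> l = u" "e \<cdot> l = Zero C k t"
    using pullback_lift[OF E(3) S'(2) x S'(1) Zero_hom[of k t]] S'(7) by auto
  note [THEN hom_simps, simp] = l(1)
  have "is_kernel C l e"
  proof (rule kernelI[OF E(2) l(1) l(3)])
    show "is_mono C l" using mono_right[OF _ l(1) E(1)] l(2) S'(5) by simp
    fix s h assume h: "h \<in> Hom C s E" "e \<cdot> h = Zero C s t"
    note [THEN hom_simps, simp] = h(1)
    have "v \<cdot> (p \<cdot> h) = Zero C s a" by (simp add: Comp_reassoc2[OF vp] h(2))
    moreover have "p \<cdot> h \<in> Hom C s b" by (simp add: Hom_iff)
    ultimately obtain w where w: "w \<in> Hom C s k" "u \<cdot> w = p \<cdot> h" using ses_lift[OF S] by blast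
    note [THEN hom_simps, simp] = w(1)
    have "l \<cdot> w = h"
      by (rule pullback_ext[OF E(3), of _ s])
        (simp_all add: Hom_iff w(2) h(2) Comp_reassoc[OF l(2)] Comp_reassoc[OF l(3)])
    then show "\<exists>w\<in>Hom C s k. l \<cdot> w = h" using w(1) by blast
  qed
  then show thesis using that[OF ses_of_kernel[OF _ l(1) E(2) epi] l(2)] by blast
qed

lemma ses_pullback:
  assumes S: "ses C k u b v a" and x: "x \<in> Hom C t a"
  obtains E p e l where "ses C k l E e t" "p \<in> Hom C E b" "v \<cdot> p = x \<cdot> e" "p \<cdot> l = u"
    "is_pullback C E p e v x"
proof -
  obtain E p e where E: "p \<in> Hom C E b" "e \<in> Hom C E t" "is_pullback C E p e v x"
    using pullback_exists[OF sesD(2)[OF S] x] by blast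
  show thesis using pullback_ses[OF S x E] that E(1,3) unfolding is_pullback_def by metis
qed

lemma split_ses_retraction:
  assumes S: "ses C k l b e q" and s: "s \<in> Hom C q b" "e \<cdot> s = Id C q"
  obtains r where "r \<in> Hom C b k" "r \<cdot> l = Id C k"
proof -
  note S' = sesD[OF S]
  note [THEN hom_simps, simp] = S'(1,2) s(1)
  have h: "Id C b \<in> Hom C b b" "s \<cdot> e \<in> Hom C b b" by (simp_all add: Hom_iff)
  note [THEN hom_simps, simp] = Sub_hom[OF h]
  have "e \<cdot> Sub (Id C b) (s \<cdot> e) = Zero C b q"
    using Comp_Sub[OF h S'(2)] Sub_self[OF S'(2)] by (simp add: Comp_reassoc[OF s(2)])
  then obtain r where r: "r \<in> Hom C b k" "l \<cdot> r = Sub (Id C b) (s \<cdot> e)"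
    using ses_lift[OF S Sub_hom[OF h]] by blast
  note [THEN hom_simps, simp] = r(1)
  have "l \<cdot> (r \<cdot> l) = Sub l (Zero C k b)"
    using Sub_Comp[OF S'(1) h] by (simp add: Comp_reassoc[OF r(2)] S'(7))
  also have "\<dots> = l" by (rule Sub_Zero[OF S'(1)])
  finally have "r \<cdot> l = Id C k" by (rule mono_IdI[OF _ S'(5,1)]) (simp add: Hom_iff)
  then show thesis using that r(1) by blast
qed

lemma ses_pushout:
  assumes S: "ses C a u b v k" and x: "x \<in> Hom C a t"
  obtains E p e l where "ses C t e E l k" "p \<in> Hom C b E" "p \<cdot> u = e \<cdot> x" "l \<cdot> p = v"
    "is_pullback (opposite C) E p e u x"
proof -
  have S': "ses (opposite C) k v b u a" and x': "x \<in> Hom (opposite C) t a" using S x by simp_all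
  show thesis
    by (rule abelian_category.ses_pullback[OF opposite_abelian S' x']) (use that in simp)
qed

lemma pushout_lift:
  assumes "is_pullback (opposite C) e p q f g" "f \<in> Hom C c a" "g \<in> Hom C c b"
    "x \<in> Hom C a t" "y \<in> Hom C b t" "x \<cdot> f = y \<cdot> g"
  obtains u where "u \<in> Hom C e t" "u \<cdot> p = x" "u \<cdot> q = y"
  using abelian_category.pullback_lift[OF opposite_abelian assms(1), of a c b x t y] assms by auto

text \<open>
  The nine lemma for three exact columns and two exact rows. Surjectivity of \<open>v\<close> is the chase: lift an
  element of \<open>kc\<close> to \<open>b'\<close>, observe that its image in \<open>b\<close> comes from \<open>a\<close>, and correct the lift by a
  preimage in \<open>a'\<close>.
\<close>

lemma ses_kernels:
  assumes S: "ses C a f b g c" and S': "ses C a' f' b' g' c'"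
    and A: "ses C ka ia a' \<alpha> a" and B: "ses C kb ib b' \<beta> b" and G: "ses C kc ic c' \<gamma> c"
    and e: "f \<cdot> \<alpha> = \<beta> \<cdot> f'" "g \<cdot> \<beta> = \<gamma> \<cdot> g'"
  obtains u v where "ses C ka u kb v kc" "f' \<cdot> ia = ib \<cdot> u" "g' \<cdot> ib = ic \<cdot> v"
proof -
  note s = sesD[OF S] and s' = sesD[OF S'] and sa = sesD[OF A] and sb = sesD[OF B] and sc = sesD[OF G]
  note [THEN hom_simps, simp] = s(1,2) s'(1,2) sa(1,2) sb(1,2) sc(1,2)
  have "f' \<cdot> ia \<in> Hom C ka b'" "g' \<cdot> ib \<in> Hom C kb c'" by (simp_all add: Hom_iff)
  moreover have "\<beta> \<cdot> (f' \<cdot> ia) = Zero C ka b" "\<gamma> \<cdot> (g' \<cdot> ib) = Zero C kb c"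
    by (simp_all add: sa(7) sb(7) flip: Comp_reassoc2[OF e(1)] Comp_reassoc2[OF e(2)])
  ultimately obtain u v where u: "u \<in> Hom C ka kb" "ib \<cdot> u = f' \<cdot> ia"
    and v: "v \<in> Hom C kb kc" "ic \<cdot> v = g' \<cdot> ib"
    using ses_lift[OF B] ses_lift[OF G] by metis
  note [THEN hom_simps, simp] = u(1) v(1)
  have "ic \<cdot> (v \<cdot> u) = Zero C ka c'"
    by (simp add: Comp_reassoc2[OF v(2)] u(2) Comp_reassoc[OF s'(7)])
  then have vu: "v \<cdot> u = Zero C ka kc" by (rule mono_ZeroI[OF _ sc(5,1)]) (simp add: Hom_iff)
  have "is_mono C (ib \<cdot> u)" unfolding u(2) by (rule mono_comp[OF sa(5) s'(5) sa(1) s'(1)])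
  then have mu: "is_mono C u" by (rule mono_right[OF _ u(1) sb(1)])
  have ker: "is_kernel C u v"
  proof (rule kernelI[OF v(1) u(1) vu mu])
    fix t h assume h: "h \<in> Hom C t kb" "v \<cdot> h = Zero C t kc"
    note [THEN hom_simps, simp] = h(1)
    have "g' \<cdot> (ib \<cdot> h) = Zero C t c'" by (simp add: h(2) flip: Comp_reassoc2[OF v(2)])
    moreover have "ib \<cdot> h \<in> Hom C t b'" by (simp add: Hom_iff)
    ultimately obtain w where w: "w \<in> Hom C t a'" "f' \<cdot> w = ib \<cdot> h" using ses_lift[OF S'] by blast
    note [THEN hom_simps, simp] = w(1)
    have "f \<cdot> (\<alpha> \<cdot> w) = Zero C t b" by (simp add: Comp_reassoc2[OF e(1)] w(2) Comp_reassoc[OF sb(7)])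
    then have "\<alpha> \<cdot> w = Zero C t a" by (rule mono_ZeroI[OF _ s(5,1)]) (simp add: Hom_iff)
    then obtain w' where w': "w' \<in> Hom C t ka" "ia \<cdot> w' = w" using ses_lift[OF A w(1)] by blast
    note [THEN hom_simps, simp] = w'(1)
    have "ib \<cdot> (u \<cdot> w') = ib \<cdot> h" by (simp add: Comp_reassoc2[OF u(2)] w'(2) w(2))
    then have "u \<cdot> w' = h" by (rule mono_eqI[OF _ sb(5,1)]) (simp_all add: Hom_iff)
    then show "\<exists>w\<in>Hom C t ka. u \<cdot> w = h" using w'(1) by blast
  qed
  have epi: "is_epi C v"
  proof -
    obtain t1 e1 x where x: "e1 \<in> Hom C t1 kc" "is_epi C e1" "x \<in> Hom C t1 b'" "g' \<cdot> x = ic \<cdot> e1"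
      using epi_cover[OF s'(6,2) sc(1)] by blast
    note [THEN hom_simps, simp] = x(1,3)
    have "g \<cdot> (\<beta> \<cdot> x) = Zero C t1 c"
      by (simp add: Comp_reassoc2[OF e(2)] x(4) Comp_reassoc[OF sc(7)])
    moreover have "\<beta> \<cdot> x \<in> Hom C t1 b" by (simp add: Hom_iff)
    ultimately obtain z where z: "z \<in> Hom C t1 a" "f \<cdot> z = \<beta> \<cdot> x" using ses_lift[OF S] by blast
    obtain t2 e2 z' where z': "e2 \<in> Hom C t2 t1" "is_epi C e2" "z' \<in> Hom C t2 a'" "\<alpha> \<cdot> z' = z \<cdot> e2"
      using epi_cover[OF sa(6,2) z(1)] by blast
    note [THEN hom_simps, simp] = z(1) z'(1,3)
    have h: "x \<cdot> e2 \<in> Hom C t2 b'" "f' \<cdot> z' \<in> Hom C t2 b'" by (simp_all add: Hom_iff)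
    note [THEN hom_simps, simp] = Sub_hom[OF h]
    have "\<beta> \<cdot> Sub (x \<cdot> e2) (f' \<cdot> z') = Sub (\<beta> \<cdot> (x \<cdot> e2)) (\<beta> \<cdot> (f' \<cdot> z'))"
      by (rule Comp_Sub[OF h sb(2)])
    also have "\<beta> \<cdot> (f' \<cdot> z') = \<beta> \<cdot> (x \<cdot> e2)"
      by (simp add: z'(4) Comp_reassoc2[OF z(2)] flip: Comp_reassoc2[OF e(1)])
    finally have "\<beta> \<cdot> Sub (x \<cdot> e2) (f' \<cdot> z') = Zero C t2 b"
      using Sub_self[OF Comp_in_Hom[OF h(1) sb(2)]] by simp
    then obtain y where y: "y \<in> Hom C t2 kb" "ib \<cdot> y = Sub (x \<cdot> e2) (f' \<cdot> z')"
      using ses_lift[OF B Sub_hom[OF h]] by blast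
    note [THEN hom_simps, simp] = y(1)
    have "ic \<cdot> (v \<cdot> y) = g' \<cdot> Sub (x \<cdot> e2) (f' \<cdot> z')" by (simp add: Comp_reassoc2[OF v(2)] y(2))
    also have "\<dots> = Sub (g' \<cdot> (x \<cdot> e2)) (g' \<cdot> (f' \<cdot> z'))" by (rule Comp_Sub[OF h s'(2)])
    also have "\<dots> = Sub (ic \<cdot> (e1 \<cdot> e2)) (Zero C t2 c')"
      by (simp add: Comp_reassoc2[OF x(4)] Comp_reassoc[OF s'(7)])
    also have "\<dots> = ic \<cdot> (e1 \<cdot> e2)" by (rule Sub_Zero) (simp add: Hom_iff)
    finally have "v \<cdot> y = e1 \<cdot> e2" by (rule mono_eqI[OF _ sc(5,1)]) (simp_all add: Hom_iff)
    moreover have "is_epi C (e1 \<cdot> e2)" by (rule epi_comp[OF z'(2) x(2) z'(1) x(1)])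
    moreover have "e1 \<cdot> e2 \<in> Hom C t2 kc" by (simp add: Hom_iff)
    ultimately show ?thesis using epi_of_cover[OF v(1) _ _ y(1)] by simp
  qed
  show thesis using that[OF ses_of_kernel[OF ker u(1) v(1) epi]] u v by simp
qed

lemma five_middle:
  assumes f: "ses C a f b g c" and f': "ses C a' f' b' g' c'"
    and v: "\<alpha> \<in> Hom C a a'" "\<beta> \<in> Hom C b b'" "\<gamma> \<in> Hom C c c'"
    and e: "f' \<cdot> \<alpha> = \<beta> \<cdot> f" "g' \<cdot> \<beta> = \<gamma> \<cdot> g"
    and i: "is_iso C \<alpha>" "is_iso C \<gamma>"
  shows "is_iso C \<beta>"
  using four_mono[OF f sesD(1,2,5)[OF f'] v e iso_mono[OF i(1) v(1)] iso_mono[OF i(2) v(3)]]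
    four_epi[OF f' sesD(1,2,6)[OF f] v e iso_epi[OF i(1) v(1)] iso_epi[OF i(2) v(3)]]
    mono_epi_iso[OF v(2)] by blast

end

section \<open>Additive functors and adjunctions\<close>

lemma functor_comp_simps [simp]:
  "on_obj (G \<circ>\<^sub>F F) a = on_obj G (on_obj F a)" "on_arr (G \<circ>\<^sub>F F) f = on_arr G (on_arr F f)"
  "on_obj functor_id a = a" "on_arr functor_id f = f"
  by (simp_all add: functor_comp_def functor_id_def)

context additive_functor begin

lemma on_arr_arr [simp]:
  assumes "f \<in> Arr C"
  shows "on_arr F f \<in> Arr C" "Dom C (on_arr F f) = on_obj F (Dom C f)"
    "Cod C (on_arr F f) = on_obj F (Cod C f)"
  using HomD(1-3)[OF on_arr_in_Hom[of f "Dom C f" "Cod C f"]] assms by (simp_all add: Hom_iff)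

declare on_obj_in_Obj [simp] on_arr_Id [simp]

lemma on_arr_Comp_arr [simp]:
  "\<lbrakk>f \<in> Arr C; g \<in> Arr C; Dom C g = Cod C f\<rbrakk> \<Longrightarrow> on_arr F (g \<cdot> f) = on_arr F g \<cdot> on_arr F f"
  using on_arr_Comp[of f "Dom C f" "Cod C f" g "Cod C g"] by (simp add: Hom_iff)

lemma on_arr_Zero [simp]:
  assumes "a \<in> Obj C" "b \<in> Obj C"
  shows "on_arr F (Zero C a b) = Zero C (on_obj F a) (on_obj F b)"
proof -
  note z = Zero_hom[OF assms]
  let ?z = "on_arr F (Zero C a b)"
  have h: "?z \<in> Hom C (on_obj F a) (on_obj F b)" by (rule on_arr_in_Hom[OF z])
  have "Add C ?z ?z = Add C (Zero C (on_obj F a) (on_obj F b)) ?z"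
    using on_arr_Add[OF z z] Add_Zero(1)[OF z] Add_Zero(2)[OF h] by simp
  then show ?thesis
    by (intro Add_left_cancel[OF h _ h]) (use assms in \<open>simp_all add: Zero_hom\<close>)
qed

lemma opposite_functor: "additive_functor (opposite C) F"
  unfolding additive_functor_def additive_functor_axioms_def
  using opposite_preadditive on_arr_in_Hom on_arr_Comp on_arr_Add by simp

lemma functor_iso: "is_iso C f \<Longrightarrow> is_iso C (on_arr F f)"
proof -
  assume f: "is_iso C f"
  define a b where "a = Dom C f" and "b = Cod C f"
  have fh: "f \<in> Hom C a b" using f by (simp add: is_iso_def a_def b_def Hom_iff)
  obtain g where g: "g \<in> Hom C b a" "g \<cdot> f = Id C a" "f \<cdot> g = Id C b" using iso_obtain[OF f fh] by blast
  note [THEN hom_simps, simp] = fh g(1)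
  show ?thesis
    by (rule isoI[OF on_arr_in_Hom[OF fh] on_arr_in_Hom[OF g(1)]])
      (simp_all add: g(2,3) flip: on_arr_Comp_arr)
qed

lemma functor_retract:
  assumes "i \<in> Hom C x y" "p \<in> Hom C y x" "p \<cdot> i = Id C x"
  shows "on_arr F p \<cdot> on_arr F i = Id C (on_obj F x)"
  using on_arr_Comp[OF assms(1,2)] assms(3) HomD(4)[OF assms(1)] by simp

end

context adjunction begin

lemma unit_hom: "a \<in> Obj C \<Longrightarrow> \<eta> a \<in> Hom C a (on_obj G (on_obj F a))"
  using unit_natural by (simp add: natural_transformation_def)

lemma counit_hom: "a \<in> Obj C \<Longrightarrow> \<epsilon> a \<in> Hom C (on_obj F (on_obj G a)) a"
  using counit_natural by (simp add: natural_transformation_def)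

lemma unit_arr [simp]:
  assumes "a \<in> Obj C"
  shows "\<eta> a \<in> Arr C" "Dom C (\<eta> a) = a" "Cod C (\<eta> a) = on_obj G (on_obj F a)"
  using HomD(1-3)[OF unit_hom[OF assms]] by simp_all

lemma counit_arr [simp]:
  assumes "a \<in> Obj C"
  shows "\<epsilon> a \<in> Arr C" "Dom C (\<epsilon> a) = on_obj F (on_obj G a)" "Cod C (\<epsilon> a) = a"
  using HomD(1-3)[OF counit_hom[OF assms]] by simp_all

lemma unit_nat: "f \<in> Hom C a b \<Longrightarrow> on_arr G (on_arr F f) \<cdot> \<eta> a = \<eta> b \<cdot> f"
  using unit_natural by (simp add: natural_transformation_def)

lemma counit_nat: "f \<in> Hom C a b \<Longrightarrow> f \<cdot> \<epsilon> a = \<epsilon> b \<cdot> on_arr F (on_arr G f)"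
  using counit_natural by (simp add: natural_transformation_def)

lemma opposite_adjunction: "adjunction (opposite C) G F \<epsilon> \<eta>"
  unfolding adjunction_def adjunction_axioms_def natural_transformation_def
  using opposite_functor right.opposite_functor unit_hom counit_hom unit_nat counit_nat
    triangle_left triangle_right
  by auto

lemma transpose:
  assumes a: "a \<in> Obj C" and h: "h \<in> Hom C (on_obj F a) b"
  shows "\<epsilon> b \<cdot> on_arr F (on_arr G h \<cdot> \<eta> a) = h"
proof -
  note [THEN hom_simps, simp] = h
  note [simp] = a
  have "\<epsilon> b \<cdot> on_arr F (on_arr G h \<cdot> \<eta> a) = \<epsilon> b \<cdot> (on_arr F (on_arr G h) \<cdot> on_arr F (\<eta> a))"
    by simp
  also have "\<dots> = h \<cdot> (\<epsilon> (on_obj F a) \<cdot> on_arr F (\<eta> a))"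
    by (simp add: Comp_reassoc2[OF counit_nat[OF h, symmetric]])
  also have "\<dots> = h" by (simp add: triangle_left)
  finally show ?thesis .
qed

lemma transpose_Zero:
  assumes "a \<in> Obj C" "h \<in> Hom C (on_obj F a) b" "on_arr G h \<cdot> \<eta> a = Zero C a (on_obj G b)"
  shows "h = Zero C (on_obj F a) b"
  using transpose[OF assms(1,2)] assms HomD(5)[OF assms(2)] by simp

lemma left_preserves_epi:
  assumes e: "is_epi C e" "e \<in> Hom C a b"
  shows "is_epi C (on_arr F e)"
proof (rule epiI[OF on_arr_in_Hom[OF e(2)]])
  fix t v assume v: "v \<in> Hom C (on_obj F b) t" "v \<cdot> on_arr F e = Zero C (on_obj F a) t"
  note [THEN hom_simps, simp] = e(2) v(1)
  have "(on_arr G v \<cdot> \<eta> b) \<cdot> e = on_arr G (v \<cdot> on_arr F e) \<cdot> \<eta> a"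
    by (simp add: unit_nat[OF e(2)])
  also have "\<dots> = Zero C a (on_obj G t)" by (simp add: v(2) del: right.on_arr_Comp_arr)
  finally have "on_arr G v \<cdot> \<eta> b = Zero C b (on_obj G t)"
    by (rule epi_ZeroI[OF _ e]) (simp add: Hom_iff)
  then show "v = Zero C (on_obj F b) t" by (intro transpose_Zero[OF _ v(1)]) simp_all
qed

lemma left_preserves_cokernel:
  assumes c: "is_cokernel C c f" "f \<in> Hom C a b" "c \<in> Hom C b d"
  shows "is_cokernel C (on_arr F c) (on_arr F f)"
proof -
  note [THEN hom_simps, simp] = c(2,3)
  show ?thesis
  proof (rule cokernelI[OF on_arr_in_Hom[OF c(2)] on_arr_in_Hom[OF c(3)]])
    show "on_arr F c \<cdot> on_arr F f = Zero C (on_obj F a) (on_obj F d)"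
      by (simp add: cokernel_Zero[OF c] flip: on_arr_Comp_arr)
    show "is_epi C (on_arr F c)" by (rule left_preserves_epi[OF cokernelD(3)[OF c(1,2)] c(3)])
    fix t h assume h: "h \<in> Hom C (on_obj F b) t" "h \<cdot> on_arr F f = Zero C (on_obj F a) t"
    note [THEN hom_simps, simp] = h(1)
    have "(on_arr G h \<cdot> \<eta> b) \<cdot> f = on_arr G (h \<cdot> on_arr F f) \<cdot> \<eta> a"
      by (simp add: unit_nat[OF c(2)])
    also have "\<dots> = Zero C a (on_obj G t)" by (simp add: h(2) del: right.on_arr_Comp_arr)
    finally have z: "(on_arr G h \<cdot> \<eta> b) \<cdot> f = Zero C a (on_obj G t)" .
    have "on_arr G h \<cdot> \<eta> b \<in> Hom C b (on_obj G t)" by (simp add: Hom_iff)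
    then obtain w where w: "w \<in> Hom C d (on_obj G t)" "w \<cdot> c = on_arr G h \<cdot> \<eta> b"
      using cokernel_lift_hom[OF c _ z] by blast
    note [THEN hom_simps, simp] = w(1)
    have "(\<epsilon> t \<cdot> on_arr F w) \<cdot> on_arr F c = \<epsilon> t \<cdot> on_arr F (w \<cdot> c)" by simp
    also have "\<dots> = h" unfolding w(2) by (rule transpose[OF _ h(1)]) simp
    finally show "\<exists>u\<in>Hom C (on_obj F d) t. u \<cdot> on_arr F c = h"
      by (intro bexI[of _ "\<epsilon> t \<cdot> on_arr F w"]) (simp_all add: Hom_iff)
  qed
qed

lemma right_preserves_kernel:
  assumes "is_kernel C c f" "f \<in> Hom C b a" "c \<in> Hom C d b"
  shows "is_kernel C (on_arr G c) (on_arr G f)"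
  using adjunction.left_preserves_cokernel[OF opposite_adjunction, of c f a b d] assms by simp

lemma right_preserves_mono:
  assumes "is_mono C e" "e \<in> Hom C b a"
  shows "is_mono C (on_arr G e)"
  using adjunction.left_preserves_epi[OF opposite_adjunction, of e a b] assms by simp

end

lemma (in abelian_category) left_adjoint_ses:
  assumes F: "adjunction C F G \<eta> \<epsilon>" and S: "ses C k u b v a" and m: "is_mono C (on_arr F u)"
  shows "ses C (on_obj F k) (on_arr F u) (on_obj F b) (on_arr F v) (on_obj F a)"
proof -
  interpret F: adjunction C F G \<eta> \<epsilon> by fact
  note S' = sesD[OF S]
  show ?thesis
    by (rule ses_of_cokernel[OF F.left_preserves_cokernel[OF S'(4,1,2)]
          F.on_arr_in_Hom[OF S'(1)] F.on_arr_in_Hom[OF S'(2)] m])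
qed

lemma (in abelian_category) right_adjoint_ses:
  assumes F: "adjunction C F G \<eta> \<epsilon>" and S: "ses C k u b v a" and m: "is_epi C (on_arr G v)"
  shows "ses C (on_obj G k) (on_arr G u) (on_obj G b) (on_arr G v) (on_obj G a)"
proof -
  interpret F: adjunction C F G \<eta> \<epsilon> by fact
  show ?thesis
    using abelian_category.left_adjoint_ses[OF opposite_abelian F.opposite_adjunction, of a v b u k]
      S m by simp
qed

section \<open>A self-dual form of the Nakayama setting\<close>

text \<open>
  A syzygy is a kernel of the counit \<open>P (I a) \<rightarrow> a\<close>; the adjunction enters only through its
  counit, which makes the dual notion available with the unit over the opposite category.
\<close>

definition syzygy_arr :: "('o, 'm, 'z) precat_scheme \<Rightarrow> ('o \<Rightarrow> 'm) \<Rightarrow> 'o \<Rightarrow> 'm" where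
  "syzygy_arr C \<epsilon> a = (SOME k. is_kernel C k (\<epsilon> a))"

definition syzygy :: "('o, 'm, 'z) precat_scheme \<Rightarrow> ('o \<Rightarrow> 'm) \<Rightarrow> 'o \<Rightarrow> 'o" where
  "syzygy C \<epsilon> a = Dom C (syzygy_arr C \<epsilon> a)"

text \<open>
  For the right exact functor \<open>F = \<nu>\<close> flatness says that the first left derived functor vanishes at \<open>a\<close>;
  the quantification over all sequences makes the notion independent of resolutions.
\<close>

definition flat :: "('o, 'm, 'z) precat_scheme \<Rightarrow> ('o, 'm) endofunctor \<Rightarrow> 'o \<Rightarrow> bool" where
  "flat C F a \<longleftrightarrow> a \<in> Obj C \<and> (\<forall>k u b v. ses C k u b v a \<longrightarrow> is_mono C (on_arr F u))"

text \<open>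
  Dimension shifting turned into a definition: the \<open>(n + 1)\<close>-st left derived functor vanishes at
  \<open>a\<close>.
\<close>

definition syzygy_flat ::
  "('o, 'm, 'z) precat_scheme \<Rightarrow> ('o, 'm) endofunctor \<Rightarrow> ('o \<Rightarrow> 'm) \<Rightarrow> nat \<Rightarrow> 'o \<Rightarrow> bool" where
  "syzygy_flat C F \<epsilon> n a \<longleftrightarrow> flat C F ((syzygy C \<epsilon> ^^ n) a)"

text \<open>
  All properties of a Nakayama functor that are used, in a form that is stable under
  exchanging \<open>(P, \<nu>)\<close> with \<open>(I, \<nu>')\<close> and \<open>C\<close> with its opposite. In particular \<open>I\<close> is only required to be
  objectwise isomorphic to \<open>\<nu> \<circ> P\<close>: after dualizing, \<open>P\<close> takes the place of \<open>I\<close>, and it is isomorphic to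
  \<open>\<nu>' \<circ> I\<close> but need not be equal to it.
\<close>

locale nakayama_duality = abelian_category C +
  gen: adjunction C P I \<eta> \<epsilon> + nak: adjunction C \<nu> \<nu>' \<sigma> \<tau>
  for C :: "('o, 'm, 'z) precat_scheme" (structure)
    and P I :: "('o, 'm) endofunctor" and \<eta> \<epsilon> :: "'o \<Rightarrow> 'm"
    and \<nu> \<nu>' :: "('o, 'm) endofunctor" and \<sigma> \<tau> :: "'o \<Rightarrow> 'm" +
  assumes counit_epi: "a \<in> Obj C \<Longrightarrow> is_epi C (\<epsilon> a)"
    and unit_mono: "a \<in> Obj C \<Longrightarrow> is_mono C (\<eta> a)"
    and unit_iso: "a \<in> Obj C \<Longrightarrow> is_iso C (\<sigma> (on_obj P a))"
    and counit_iso: "a \<in> Obj C \<Longrightarrow> is_iso C (\<tau> (on_obj I a))"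
    and P_mono: "is_mono C f \<Longrightarrow> is_mono C (on_arr P f)"
    and I_epi: "is_epi C f \<Longrightarrow> is_epi C (on_arr I f)"
    and nu_P_mono: "is_mono C f \<Longrightarrow> is_mono C (on_arr \<nu> (on_arr P f))"
    and nu'_I_epi: "is_epi C f \<Longrightarrow> is_epi C (on_arr \<nu>' (on_arr I f))"
    and nu_P_iso_I: "a \<in> Obj C \<Longrightarrow> \<exists>f \<in> Hom C (on_obj \<nu> (on_obj P a)) (on_obj I a). is_iso C f"
    and nu'_I_iso_P: "a \<in> Obj C \<Longrightarrow> \<exists>f \<in> Hom C (on_obj \<nu>' (on_obj I a)) (on_obj P a). is_iso C f"
begin

lemma iso_sym:
  assumes "\<exists>f \<in> Hom C a b. is_iso C f"
  shows "\<exists>f \<in> Hom C b a. is_iso C f"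
  using assms by (metis iso_obtain isoI)

lemma dual: "nakayama_duality (opposite C) I P \<epsilon> \<eta> \<nu>' \<nu> \<tau> \<sigma>"
  unfolding nakayama_duality_def nakayama_duality_axioms_def
  using opposite_abelian gen.opposite_adjunction nak.opposite_adjunction
    counit_epi unit_mono unit_iso counit_iso P_mono I_epi nu_P_mono nu'_I_epi
    iso_sym[OF nu_P_iso_I] iso_sym[OF nu'_I_iso_P]
  by simp

lemma P_ses:
  assumes "ses C k u b v a"
  shows "ses C (on_obj P k) (on_arr P u) (on_obj P b) (on_arr P v) (on_obj P a)"
  by (rule left_adjoint_ses[OF gen.adjunction_axioms assms P_mono[OF sesD(5)[OF assms]]])

lemma I_ses:
  assumes "ses C k u b v a"
  shows "ses C (on_obj I k) (on_arr I u) (on_obj I b) (on_arr I v) (on_obj I a)"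
  by (rule right_adjoint_ses[OF gen.adjunction_axioms assms I_epi[OF sesD(6)[OF assms]]])

abbreviation "\<Omega> \<equiv> syzygy C \<epsilon>"
abbreviation "\<omega> \<equiv> syzygy_arr C \<epsilon>"
abbreviation "Tor_zero \<equiv> syzygy_flat C \<nu> \<epsilon>"

lemma syzygy_ses:
  assumes "a \<in> Obj C"
  shows "ses C (\<Omega> a) (\<omega> a) (on_obj P (on_obj I a)) (\<epsilon> a) a"
proof -
  note e = gen.counit_hom[OF assms]
  have k: "is_kernel C (\<omega> a) (\<epsilon> a)"
    unfolding syzygy_arr_def using ex_kernel[OF HomD(1)[OF e]] by (rule someI_ex)
  show ?thesis
    by (rule ses_of_kernel[OF k _ e counit_epi[OF assms]])
      (simp add: syzygy_def kernelD(1)[OF k e])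
qed

lemma syzygy_obj [simp]: "a \<in> Obj C \<Longrightarrow> \<Omega> a \<in> Obj C"
  using HomD(4)[OF sesD(1)[OF syzygy_ses]] .

lemma syzygy_funpow_obj [simp]: "a \<in> Obj C \<Longrightarrow> (\<Omega> ^^ n) a \<in> Obj C"
  by (induction n) simp_all

lemma syzygy_functor:
  assumes S: "ses C a f b g c"
  obtains u v where "ses C (\<Omega> a) u (\<Omega> b) v (\<Omega> c)"
    "on_arr P (on_arr I f) \<cdot> \<omega> a = \<omega> b \<cdot> u" "on_arr P (on_arr I g) \<cdot> \<omega> b = \<omega> c \<cdot> v"
proof -
  note s = sesD[OF S]
  note o = HomD(4,5)[OF s(1)] HomD(5)[OF s(2)]
  show thesis
    by (rule ses_kernels[OF S P_ses[OF I_ses[OF S]] syzygy_ses[OF o(1)] syzygy_ses[OF o(2)]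
          syzygy_ses[OF o(3)] gen.counit_nat[OF s(1)] gen.counit_nat[OF s(2)]]) (rule that)
qed

lemma syzygy_ses_funpow:
  assumes "ses C a f b g c"
  shows "\<exists>u v. ses C ((\<Omega> ^^ n) a) u ((\<Omega> ^^ n) b) v ((\<Omega> ^^ n) c)"
proof (induction n)
  case 0
  then show ?case using assms by auto
next
  case (Suc n)
  then obtain u v where S: "ses C ((\<Omega> ^^ n) a) u ((\<Omega> ^^ n) b) v ((\<Omega> ^^ n) c)" by blast
  obtain u' v' where "ses C (\<Omega> ((\<Omega> ^^ n) a)) u' (\<Omega> ((\<Omega> ^^ n) b)) v' (\<Omega> ((\<Omega> ^^ n) c))"
    using syzygy_functor[OF S] by blast
  then show ?case by auto
qed

section \<open>Flat objects\<close>

lemma flatD: "flat C \<nu> a \<Longrightarrow> ses C k u b v a \<Longrightarrow> is_mono C (on_arr \<nu> u)"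
  by (auto simp: flat_def)

lemma nu_ses_flat:
  assumes "ses C k u b v a" "flat C \<nu> a"
  shows "ses C (on_obj \<nu> k) (on_arr \<nu> u) (on_obj \<nu> b) (on_arr \<nu> v) (on_obj \<nu> a)"
  by (rule left_adjoint_ses[OF nak.adjunction_axioms assms(1) flatD[OF assms(2,1)]])

text \<open>
  The kernels \<open>k\<close> and \<open>k0\<close> of the two epis are also the kernels of the opposite sides of the pullback
  square. An element of \<open>\<nu> k\<close> that dies in \<open>\<nu> b\<close> comes, inside \<open>\<nu> E\<close>, from an element of \<open>\<nu> k0\<close> by right
  exactness; this element dies in \<open>\<nu> q\<close>, hence is zero.
\<close>

lemma pullback_chase:
  assumes S: "ses C k u b v a" and S0: "ses C k0 u0 q x a"
    and E: "p \<in> Hom C E b" "e \<in> Hom C E q" "is_pullback C E p e v x"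
    and l: "\<And>l. ses C k l E e q \<Longrightarrow> is_mono C (on_arr \<nu> l)" and u0: "is_mono C (on_arr \<nu> u0)"
  shows "is_mono C (on_arr \<nu> u)"
proof -
  note s = sesD[OF S] and s0 = sesD[OF S0]
  obtain l where L: "ses C k l E e q" "p \<cdot> l = u" using pullback_ses[OF S s0(2) E] by blast
  obtain l0 where L0: "ses C k0 l0 E p b" "e \<cdot> l0 = u0"
    using pullback_ses[OF S0 s(2) E(2,1) pullback_sym[OF E(3)]] by blast
  note ml = l[OF L(1)]
  note l1 = sesD[OF L(1)] and l0 = sesD[OF L0(1)]
  note [THEN hom_simps, simp] = E(1,2) l1(1) l0(1) s(1) s0(1)
  show ?thesis
  proof (rule monoI[OF nak.on_arr_in_Hom[OF s(1)]])
    fix t z assume z: "z \<in> Hom C t (on_obj \<nu> k)" "on_arr \<nu> u \<cdot> z = Zero C t (on_obj \<nu> b)"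
    note [THEN hom_simps, simp] = z(1)
    have "on_arr \<nu> p \<cdot> (on_arr \<nu> l \<cdot> z) = Zero C t (on_obj \<nu> b)"
      using z(2) by (simp flip: L(2))
    moreover have "on_arr \<nu> l \<cdot> z \<in> Hom C t (on_obj \<nu> E)" by (simp add: Hom_iff)
    ultimately obtain s w y where w: "w \<in> Hom C s t" "is_epi C w" "y \<in> Hom C s (on_obj \<nu> k0)"
      "on_arr \<nu> l0 \<cdot> y = (on_arr \<nu> l \<cdot> z) \<cdot> w"
      using cokernel_cover[OF nak.left_preserves_cokernel[OF l0(4,1) E(1)]
          nak.on_arr_in_Hom[OF l0(1)] nak.on_arr_in_Hom[OF E(1)]] by blast
    note [THEN hom_simps, simp] = w(1,3)
    have "on_arr \<nu> u0 \<cdot> y = on_arr \<nu> e \<cdot> (on_arr \<nu> l0 \<cdot> y)" by (simp flip: L0(2))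
    also have "\<dots> = on_arr \<nu> (e \<cdot> l) \<cdot> (z \<cdot> w)" by (simp add: w(4))
    also have "\<dots> = Zero C s (on_obj \<nu> q)"
      using HomD(4,5)[OF l1(2)] by (simp add: l1(7) del: nak.on_arr_Comp_arr)
    finally have "y = Zero C s (on_obj \<nu> k0)"
      by (rule mono_ZeroI[OF _ u0 nak.on_arr_in_Hom[OF s0(1)] w(3)])
    then have "on_arr \<nu> l \<cdot> (z \<cdot> w) = Zero C s (on_obj \<nu> E)" using w(4) by simp
    then have "z \<cdot> w = Zero C s (on_obj \<nu> k)"
      by (rule mono_ZeroI[OF _ ml nak.on_arr_in_Hom[OF l1(1)]]) (simp add: Hom_iff)
    then show "z = Zero C t (on_obj \<nu> k)" by (rule epi_ZeroI[OF _ w(2,1) z(1)])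
  qed
qed

text \<open>
  One presentation with flat middle term decides: any other sequence ending in \<open>a\<close> is compared with it
  on the pullback of the two epis.
\<close>

lemma flat_by_presentation:
  assumes S0: "ses C k0 u0 q x a" and q: "flat C \<nu> q" and u0: "is_mono C (on_arr \<nu> u0)"
  shows "flat C \<nu> a"
  unfolding flat_def
proof (intro conjI allI impI)
  show "a \<in> Obj C" using HomD(5)[OF sesD(2)[OF S0]] .
  fix k u b v assume S: "ses C k u b v a"
  obtain E p e where E: "p \<in> Hom C E b" "e \<in> Hom C E q" "is_pullback C E p e v x"
    using pullback_exists[OF sesD(2)[OF S] sesD(2)[OF S0]] by blast
  show "is_mono C (on_arr \<nu> u)" by (rule pullback_chase[OF S S0 E flatD[OF q] u0])
qed

lemma split_nu_mono:
  assumes "ses C k l E e q" "s \<in> Hom C q E" "e \<cdot> s = Id C q"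
  shows "is_mono C (on_arr \<nu> l)"
proof -
  obtain r where r: "r \<in> Hom C E k" "r \<cdot> l = Id C k" using split_ses_retraction[OF assms] by blast
  note l = sesD(1)[OF assms(1)]
  show ?thesis
    by (rule retraction_mono[OF nak.on_arr_in_Hom[OF l] nak.on_arr_in_Hom[OF r(1)]
          nak.functor_retract[OF l r]])
qed

text \<open>
  The objects \<open>P y\<close> need not be projective, but every epi \<open>v\<close> onto \<open>P y\<close> splits after pulling back along
  \<open>P e0\<close> for some epi \<open>e0\<close> onto \<open>y\<close>: the transpose \<open>y \<rightarrow> I (P y)\<close> lifts through the epi \<open>I v\<close> on a cover
  \<open>e0\<close>. The kernel of \<open>P e0\<close> is harmless because \<open>\<nu> \<circ> P\<close> preserves monos.
\<close>

lemma flat_P: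
  assumes y: "y \<in> Obj C"
  shows "flat C \<nu> (on_obj P y)"
  unfolding flat_def
proof (intro conjI allI impI)
  show "on_obj P y \<in> Obj C" using y by simp
  fix k u b v assume S: "ses C k u b v (on_obj P y)"
  note s = sesD[OF S]
  obtain E0 g e0 l0 where E0: "ses C (on_obj I k) l0 E0 e0 y" "g \<in> Hom C E0 (on_obj I b)"
    "on_arr I v \<cdot> g = \<eta> y \<cdot> e0"
    by (rule ses_pullback[OF I_ses[OF S] gen.unit_hom[OF y]]) blast
  note e0 = sesD[OF E0(1)]
  note [THEN hom_simps, simp] = s(1,2) e0(1,2) E0(2)
  note [simp] = y
  define h where "h = \<epsilon> b \<cdot> on_arr P g"
  have h: "h \<in> Hom C (on_obj P E0) b" unfolding h_def by (simp add: Hom_iff)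
  have "v \<cdot> h = \<epsilon> (on_obj P y) \<cdot> on_arr P (on_arr I v \<cdot> g)"
    by (simp add: h_def Comp_reassoc2[OF gen.counit_nat[OF s(2)]])
  also have "\<dots> = on_arr P e0"
    unfolding E0(3) by (simp add: Comp_reassoc[OF gen.triangle_left[OF y]])
  finally have vh: "v \<cdot> h = on_arr P e0" .
  obtain E p e where E: "p \<in> Hom C E b" "e \<in> Hom C E (on_obj P E0)" "is_pullback C E p e v (on_arr P e0)"
    using pullback_exists[OF s(2) gen.on_arr_in_Hom[OF e0(2)]] by blast
  have "v \<cdot> h = on_arr P e0 \<cdot> Id C (on_obj P E0)" by (simp add: vh)
  then obtain z where z: "z \<in> Hom C (on_obj P E0) E" "p \<cdot> z = h" "e \<cdot> z = Id C (on_obj P E0)"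
    using pullback_lift[OF E(3) s(2) gen.on_arr_in_Hom[OF e0(2)] h Id_in_Hom[of "on_obj P E0"]] by auto
  show "is_mono C (on_arr \<nu> u)"
    by (rule pullback_chase[OF S P_ses[OF E0(1)] E])
      (use split_nu_mono z nu_P_mono[OF e0(5)] in blast)+
qed

lemma flat_retract:
  assumes i: "i \<in> Hom C x y" "p \<in> Hom C y x" "p \<cdot> i = Id C x" and y: "flat C \<nu> y"
  shows "flat C \<nu> x"
  unfolding flat_def
proof (intro conjI allI impI)
  show "x \<in> Obj C" using HomD(4)[OF i(1)] .
  fix k u b v assume S: "ses C k u b v x"
  note s = sesD[OF S]
  obtain E q e l where E: "ses C k l E e y" "q \<in> Hom C E b" "v \<cdot> q = p \<cdot> e" "q \<cdot> l = u"
    "is_pullback C E q e v p"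
    by (rule ses_pullback[OF S i(2)]) blast
  note l = sesD[OF E(1)]
  note [THEN hom_simps, simp] = s(1,2) l(1,2) E(2) i(1,2)
  have "v \<cdot> Id C b = p \<cdot> (i \<cdot> v)" by (simp add: Comp_reassoc[OF i(3)])
  moreover have "i \<cdot> v \<in> Hom C b y" by (simp add: Hom_iff)
  moreover have "Id C b \<in> Hom C b b" by (simp add: Id_in_Hom)
  ultimately obtain w where w: "w \<in> Hom C b E" "q \<cdot> w = Id C b" "e \<cdot> w = i \<cdot> v"
    using pullback_lift[OF E(5) s(2) i(2)] by blast
  note [THEN hom_simps, simp] = w(1)
  have "w \<cdot> u = l"
    by (rule pullback_ext[OF E(5), of _ k])
      (simp_all add: Hom_iff Comp_reassoc[OF w(2)] Comp_reassoc2[OF w(3)] E(4) s(7) l(7))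
  then have "on_arr \<nu> w \<cdot> on_arr \<nu> u = on_arr \<nu> l" by (simp flip: nak.on_arr_Comp_arr)
  then show "is_mono C (on_arr \<nu> u)"
    using mono_right[OF _ nak.on_arr_in_Hom[OF s(1)] nak.on_arr_in_Hom[OF w(1)]] flatD[OF y E(1)] by simp
qed

end

context abelian_category begin

section \<open>Exact sequences, homology and resolutions\<close>

lemma kernel_postcomp_mono:
  assumes "is_kernel C k f" "f \<in> Hom C a b" "k \<in> Hom C d a" "m \<in> Hom C b c" "is_mono C m"
  shows "is_kernel C k (m \<cdot> f)"
  using abelian_category.cokernel_precomp_epi[OF opposite_abelian, of k f b a d m c] assms by simp

lemma kernel_of_postcomp_mono:
  assumes "is_kernel C k (m \<cdot> f)" "f \<in> Hom C a b" "k \<in> Hom C d a" "m \<in> Hom C b c" "is_mono C m"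
  shows "is_kernel C k f"
  using abelian_category.cokernel_of_precomp_epi[OF opposite_abelian, of k f m b a d c] assms by simp

lemma exact_splice:
  assumes S: "ses C k u q v a" and e: "e \<in> Hom C x k" "is_epi C e" and m: "m \<in> Hom C a y" "is_mono C m"
  shows "exact_pair C (u \<cdot> e) (m \<cdot> v)"
proof -
  note s = sesD[OF S]
  note [THEN hom_simps, simp] = s(1,2) e(1) m(1)
  have h: "u \<cdot> e \<in> Hom C x q" "m \<cdot> v \<in> Hom C q y" by (simp_all add: Hom_iff)
  show ?thesis
    unfolding exact_pair_iff_cover[OF h]
    using kernel_postcomp_mono[OF s(3,2,1) m] s(1) e by blast
qed

lemma exact_pair_Zero:
  assumes f: "f \<in> Hom C a b" "g \<in> Hom C b c" "exact_pair C f g"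
  shows "g \<cdot> f = Zero C a c"
proof -
  obtain x k e where k: "k \<in> Hom C x b" "e \<in> Hom C a x" "is_kernel C k g" "k \<cdot> e = f"
    using f(3) unfolding exact_pair_iff_cover[OF f(1,2)] by blast
  note [THEN hom_simps, simp] = f(2) k(1,2)
  show ?thesis using kernel_Zero[OF k(3) f(2) k(1)] by (simp add: Comp_reassoc flip: k(4))
qed

lemma exact_pair_chase:
  assumes f: "f \<in> Hom C a b" "g \<in> Hom C b c" "exact_pair C f g"
    and h: "h \<in> Hom C t b" "g \<cdot> h = Zero C t c"
  obtains s w y where "w \<in> Hom C s t" "is_epi C w" "y \<in> Hom C s a" "f \<cdot> y = h \<cdot> w"
proof -
  obtain x k e where k: "k \<in> Hom C x b" "e \<in> Hom C a x" "is_kernel C k g" "is_epi C e" "k \<cdot> e = f"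
    using f(3) unfolding exact_pair_iff_cover[OF f(1,2)] by blast
  obtain h' where h': "h' \<in> Hom C t x" "k \<cdot> h' = h" using kernel_lift_hom[OF k(3) f(2) k(1) h] by blast
  obtain s w y where w: "w \<in> Hom C s t" "is_epi C w" "y \<in> Hom C s a" "e \<cdot> y = h' \<cdot> w"
    using epi_cover[OF k(4,2) h'(1)] by blast
  note [THEN hom_simps, simp] = k(1,2) h'(1) w(1,3)
  have "f \<cdot> y = h \<cdot> w" by (simp add: w(4) flip: k(5) h'(2))
  then show thesis using that w by blast
qed

lemma exact_pair_mono:
  assumes "f \<in> Hom C a b" "g \<in> Hom C b c" "m \<in> Hom C c d" "is_mono C m"
  shows "exact_pair C f (m \<cdot> g) \<longleftrightarrow> exact_pair C f g"
proof -
  note [THEN hom_simps, simp] = assms(2,3)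
  have h: "m \<cdot> g \<in> Hom C b d" by (simp add: Hom_iff)
  show ?thesis
    unfolding exact_pair_iff_cover[OF assms(1,2)] exact_pair_iff_cover[OF assms(1) h]
    using kernel_postcomp_mono[OF _ assms(2) _ assms(3,4)] kernel_of_postcomp_mono[OF _ assms(2) _ assms(3,4)]
    by blast
qed

lemma cokernel_exact_pair:
  assumes c: "is_cokernel C c f" "f \<in> Hom C a b" "c \<in> Hom C b d"
  shows "exact_pair C f c"
proof -
  obtain k x where k: "k \<in> Hom C x b" "is_kernel C k c" using kernel_exists[OF c(3)] by blast
  obtain e where e: "e \<in> Hom C a x" "k \<cdot> e = f"
    using kernel_lift_hom[OF k(2) c(3) k(1) c(2) cokernel_Zero[OF c]] by blast
  show ?thesis
    unfolding exact_pair_iff_cover[OF c(2,3)]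
    using k e image_lift_epi[OF c(2,1,3) k(2,1) e] by blast
qed

lemma exact_pair_cokernel:
  assumes "exact_pair C f c" "f \<in> Hom C a b" "c \<in> Hom C b d" "is_epi C c"
  shows "is_cokernel C c f"
proof -
  obtain x k e where k: "k \<in> Hom C x b" "e \<in> Hom C a x" "is_kernel C k c" "is_epi C e" "k \<cdot> e = f"
    using assms(1) unfolding exact_pair_iff_cover[OF assms(2,3)] by blast
  show ?thesis
    using cokernel_precomp_epi[OF epi_cokernel_of_kernel[OF assms(4,3) k(3,1)] k(1) assms(3) k(2,4)] k(5)
    by simp
qed

lemma zero_object_arrow:
  assumes "is_zero_object C z" "a \<in> Obj C"
  shows "f \<in> Hom C z a \<Longrightarrow> f = Zero C z a" "f \<in> Hom C a z \<Longrightarrow> f = Zero C a z"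
  using assms Zero_hom[of z a] Zero_hom[of a z] unfolding is_zero_object_def by blast+

lemma zero_objectI:
  assumes z: "z \<in> Obj C" "Id C z = Zero C z z"
  shows "is_zero_object C z"
proof -
  have "f = Zero C z a" if "f \<in> Hom C z a" for f a
    using Comp_Id[OF that] HomD[OF that] z(2) by simp
  moreover have "f = Zero C a z" if "f \<in> Hom C a z" for f a
    using Id_Comp[OF that] HomD[OF that] z(2) by simp
  ultimately show ?thesis unfolding is_zero_object_def using z(1) Zero_hom by blast
qed

lemma exact_end_iff_epi:
  assumes z: "is_zero_object C z" and e: "e \<in> Hom C x a"
  shows "exact_pair C e (Zero C a z) \<longleftrightarrow> is_epi C e"
proof -
  have zo: "z \<in> Obj C" using z by (simp add: is_zero_object_def)
  note [THEN hom_simps, simp] = e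
  note [simp] = zo
  note Z = Zero_hom[OF HomD(5)[OF e] zo]
  show ?thesis
  proof
    assume "exact_pair C e (Zero C a z)"
    moreover have "Zero C a z \<cdot> Id C a = Zero C a z" "Id C a \<in> Hom C a a" by (simp_all add: Id_in_Hom)
    ultimately obtain s w y where w: "w \<in> Hom C s a" "is_epi C w" "y \<in> Hom C s x" "e \<cdot> y = Id C a \<cdot> w"
      using exact_pair_chase[OF e Z] by blast
    then show "is_epi C e" using epi_of_cover[OF e w(1-3)] HomD[OF w(1)] by simp
  next
    assume epi: "is_epi C e"
    have "is_kernel C (Id C a) (Zero C a z)"
    proof (rule kernelI[OF Z Id_in_Hom])
      show "is_mono C (Id C a)" by (simp add: Id_mono)
      fix t h assume h: "h \<in> Hom C t a"
      show "\<exists>u\<in>Hom C t a. Id C a \<cdot> u = h" using h Id_Comp by blast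
    qed simp_all
    then show "exact_pair C e (Zero C a z)"
      unfolding exact_pair_iff_cover[OF e Z] using e epi Id_Comp[OF e] Id_in_Hom[OF HomD(5)[OF e]] by blast
  qed
qed

lemma exact_start_iff_mono:
  assumes "is_zero_object C z" "e \<in> Hom C a x"
  shows "exact_pair C (Zero C z a) e \<longleftrightarrow> is_mono C e"
  using abelian_category.exact_end_iff_epi[OF opposite_abelian, of z e x a] assms by simp

lemma exact_pair_lift_epi:
  assumes f: "f \<in> Hom C a b" "g \<in> Hom C b c" "exact_pair C f g" and k: "is_kernel C k g" "k \<in> Hom C x b"
  obtains e where "e \<in> Hom C a x" "is_epi C e" "k \<cdot> e = f"
proof -
  obtain u where u: "u \<in> Hom C a x" "k \<cdot> u = f"
    using kernel_lift_hom[OF k(1) f(2) k(2) f(1) exact_pair_Zero[OF f]] by blast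
  obtain s w y where w: "w \<in> Hom C s x" "is_epi C w" "y \<in> Hom C s a" "f \<cdot> y = k \<cdot> w"
    using exact_pair_chase[OF f k(2) kernel_Zero[OF k(1) f(2) k(2)]] by blast
  note [THEN hom_simps, simp] = f(1) k(2) u(1) w(1,3)
  have "k \<cdot> (u \<cdot> y) = k \<cdot> w" using w(4) by (simp add: Comp_reassoc[OF u(2)])
  then have "u \<cdot> y = w" by (rule mono_eqI[OF _ kernelD(3)[OF k(1) f(2)] k(2)]) (simp_all add: Hom_iff)
  then have "is_epi C u" using epi_of_cover[OF u(1) w(1-3)] by blast
  then show thesis using that u by blast
qed

text \<open>
  The derived functors are defined by a choice of resolution and homology object; this turns their
  vanishing into a property of the chosen resolution.
\<close>

lemma homology_zero_iff_exact:
  assumes f: "f \<in> Hom C a b" "g \<in> Hom C b c" and H: "is_homology C f g h"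
  shows "is_zero_object C h \<longleftrightarrow> exact_pair C f g"
proof -
  obtain k u q where k: "is_kernel C k g" "u \<in> Hom C (Dom C f) (Dom C k)" "k \<cdot> u = f"
    "is_cokernel C q u" "h = Cod C q"
    using H unfolding is_homology_def by blast
  obtain x where x: "x = Dom C k" by blast
  have h: "k \<in> Hom C x b" "u \<in> Hom C a x"
    using kernelD(1)[OF k(1) f(2)] k(2) HomD(2)[OF f(1)] by (simp_all add: x)
  have q: "q \<in> Hom C x h" using cokernelD(1)[OF k(4) h(2)] k(5) by simp
  note [THEN hom_simps, simp] = f(1,2) h(1,2) q
  show ?thesis
  proof
    assume z: "is_zero_object C h"
    have q0: "q = Zero C x h" by (rule zero_object_arrow(2)[OF z _ q]) simp
    have "is_epi C u"
    proof (rule epiI[OF h(2)])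
      fix t v assume v: "v \<in> Hom C x t" "v \<cdot> u = Zero C a t"
      obtain v' where v': "v' \<in> Hom C h t" "v' \<cdot> q = v" using cokernel_lift_hom[OF k(4) h(2) q v] by blast
      then show "v = Zero C x t" using HomD[OF v'(1)] by (simp add: q0)
    qed
    then show "exact_pair C f g"
      unfolding exact_pair_iff_cover[OF f] using h k(1,3) by blast
  next
    assume ex: "exact_pair C f g"
    obtain e where e: "e \<in> Hom C a x" "is_epi C e" "k \<cdot> e = f"
      by (rule exact_pair_lift_epi[OF f ex k(1) h(1)])
    have "u = e"
      by (rule mono_eqI[OF _ kernelD(3)[OF k(1) f(2)] h]) (simp_all add: k(3) e)
    then have "is_epi C u" using e(2) by simp
    then have "q = Zero C x h" by (rule epi_ZeroI[OF cokernel_Zero[OF k(4) h(2) q] _ h(2) q])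
    then have "Id C h \<cdot> q = Zero C h h \<cdot> q" by simp
    then have "Id C h = Zero C h h"
      by (rule epi_eqI[OF _ cokernelD(3)[OF k(4) h(2)] q Id_in_Hom Zero_hom]) simp_all
    then show "is_zero_object C h" by (intro zero_objectI) simp_all
  qed
qed

lemma homology_exists:
  assumes f: "f \<in> Hom C a b" "g \<in> Hom C b c" "g \<cdot> f = Zero C a c"
  shows "\<exists>h. is_homology C f g h"
proof -
  obtain k x where k: "k \<in> Hom C x b" "is_kernel C k g" using kernel_exists[OF f(2)] by blast
  obtain u where u: "u \<in> Hom C a x" "k \<cdot> u = f" using kernel_lift_hom[OF k(2) f(2) k(1) f(1,3)] by blast
  obtain q y where q: "q \<in> Hom C x y" "is_cokernel C q u" using cokernel_exists[OF u(1)] by blast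
  then show ?thesis
    unfolding is_homology_def using k u q HomD(2)[OF k(1)] HomD(2)[OF f(1)] by auto
qed

lemma direct_summand_refl:
  assumes "x \<in> Obj C"
  shows "direct_summand C x x"
proof -
  obtain z where z: "is_zero_object C z" using ex_zero_object by blast
  have zo: "z \<in> Obj C" using z by (simp add: is_zero_object_def)
  have "Id C z = Zero C z z" by (rule zero_object_arrow(1)[OF z zo Id_in_Hom[OF zo]])
  then have "is_biproduct C x z x (Id C x) (Zero C z x) (Id C x) (Zero C x z)"
    using assms zo Add_Zero(1)[OF Id_in_Hom[OF assms]]
    by (simp add: is_biproduct_def Id_in_Hom Zero_hom)
  then show ?thesis unfolding direct_summand_def by blast
qed

lemma image_summands_value:
  "\<lbrakk>a \<in> Obj C; on_obj F a \<in> Obj C\<rbrakk> \<Longrightarrow> on_obj F a \<in> image_summands C F"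
  unfolding image_summands_def using direct_summand_refl by blast

lemma direct_summand_retract:
  assumes "direct_summand C x s"
  obtains i p where "i \<in> Hom C x s" "p \<in> Hom C s x" "p \<cdot> i = Id C x"
proof -
  obtain b i j p q where B: "is_biproduct C x b s i j p q"
    using assms unfolding direct_summand_def by blast
  show thesis by (rule that[OF biproductD(1,3,5)[OF B]])
qed

lemma resolution_step:
  assumes R: "is_resolution C S a X d e"
  obtains k K e' where "ses C K k (X 0) e a" "is_resolution C S K (\<lambda>n. X (Suc n)) (\<lambda>n. d (Suc n)) e'"
    "k \<cdot> e' = d 0"
proof -
  have r: "\<And>n. X n \<in> S" "\<And>n. d n \<in> Hom C (X (Suc n)) (X n)" "e \<in> Hom C (X 0) a"
    "\<And>n. exact_pair C (d (Suc n)) (d n)" "exact_pair C (d 0) e"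
    "\<exists>z. is_zero_object C z \<and> exact_pair C e (Zero C a z)"
    using R unfolding is_resolution_def by blast+
  obtain z where z: "is_zero_object C z" "exact_pair C e (Zero C a z)" using r(6) by blast
  have epi: "is_epi C e" using z exact_end_iff_epi[OF z(1) r(3)] by blast
  obtain K k e' where k: "k \<in> Hom C K (X 0)" "e' \<in> Hom C (X (Suc 0)) K" "is_kernel C k e" "is_epi C e'"
    "k \<cdot> e' = d 0"
    using r(5) unfolding exact_pair_iff_cover[OF r(2)[of 0] r(3)] by blast
  have "exact_pair C (d (Suc 0)) e'"
    using r(4)[of 0] exact_pair_mono[OF r(2)[of "Suc 0"] k(2,1) kernelD(3)[OF k(3) r(3)]] by (simp add: k(5))
  then have "is_resolution C S K (\<lambda>n. X (Suc n)) (\<lambda>n. d (Suc n)) e'"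
    unfolding is_resolution_def using r k(2,4) z(1) exact_end_iff_epi[OF z(1) k(2)] by blast
  then show thesis using that ses_of_kernel[OF k(3,1) r(3) epi] k(5) by blast
qed

end

context nakayama_duality begin

section \<open>Vanishing of derived functors\<close>

text \<open>
  Chase on the sequence of syzygies mapped to the exact sequence of the \<open>\<nu> (P (I _))\<close>.
\<close>

lemma flat_extension:
  assumes S: "ses C a f b g c" and a: "flat C \<nu> a" and c: "flat C \<nu> c"
  shows "flat C \<nu> b"
proof -
  note s = sesD[OF S]
  note o = HomD(4,5)[OF s(1)] HomD(5)[OF s(2)]
  note A = syzygy_ses[OF o(1)] and B = syzygy_ses[OF o(2)] and G = syzygy_ses[OF o(3)]
  note [THEN hom_simps, simp] = s(1,2) sesD(1)[OF A] sesD(1)[OF B] sesD(1)[OF G]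
  note [simp] = o
  obtain u v where u: "ses C (\<Omega> a) u (\<Omega> b) v (\<Omega> c)"
    and e: "on_arr P (on_arr I f) \<cdot> \<omega> a = \<omega> b \<cdot> u" "on_arr P (on_arr I g) \<cdot> \<omega> b = \<omega> c \<cdot> v"
    using syzygy_functor[OF S] by blast
  note uu = sesD[OF u]
  note [THEN hom_simps, simp] = uu(1,2)
  have ne: "on_arr \<nu> (on_arr P (on_arr I f)) \<cdot> on_arr \<nu> (\<omega> a) = on_arr \<nu> (\<omega> b) \<cdot> on_arr \<nu> u"
    "on_arr \<nu> (on_arr P (on_arr I g)) \<cdot> on_arr \<nu> (\<omega> b) = on_arr \<nu> (\<omega> c) \<cdot> on_arr \<nu> v"
    using arg_cong[OF e(1), of "on_arr \<nu>"] arg_cong[OF e(2), of "on_arr \<nu>"] by simp_all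
  have mf: "is_mono C (on_arr \<nu> (on_arr P (on_arr I f)))"
    by (rule nu_P_mono[OF gen.right_preserves_mono[OF s(5,1)]])
  note hom = nak.on_arr_in_Hom
  have "is_mono C (on_arr \<nu> (\<omega> b) \<cdot> on_arr \<nu> u)"
    unfolding ne(1)[symmetric]
    by (rule mono_comp[OF flatD[OF a A] mf]) (simp_all add: Hom_iff)
  then have "is_mono C (on_arr \<nu> u)"
    by (rule mono_right[OF _ hom[OF uu(1)] hom[OF sesD(1)[OF B]]])
  then have N: "ses C (on_obj \<nu> (\<Omega> a)) (on_arr \<nu> u) (on_obj \<nu> (\<Omega> b)) (on_arr \<nu> v) (on_obj \<nu> (\<Omega> c))"
    by (rule left_adjoint_ses[OF nak.adjunction_axioms u])
  have m: "is_mono C (on_arr \<nu> (\<omega> b))"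
    by (rule four_mono[OF N _ _ mf hom[OF sesD(1)[OF A]] hom[OF sesD(1)[OF B]] hom[OF sesD(1)[OF G]]
          ne flatD[OF a A] flatD[OF c G]])
      (simp_all add: Hom_iff)
  show ?thesis by (rule flat_by_presentation[OF B flat_P m]) simp
qed

text \<open>
  Exactness of \<open>L\<^sub>2 \<nu> (c) \<rightarrow> L\<^sub>1 \<nu> (a) \<rightarrow> L\<^sub>1 \<nu> (b)\<close>: the composite
  \<open>\<nu> (\<Omega> a) \<rightarrow> \<nu> (\<Omega> b) \<rightarrow> \<nu> (P (I b))\<close> of monos factors through \<open>\<nu> (P (I a))\<close>.
\<close>

lemma flat_left:
  assumes S: "ses C a f b g c" and b: "flat C \<nu> b" and c: "flat C \<nu> (\<Omega> c)"
  shows "flat C \<nu> a"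
proof -
  note s = sesD[OF S]
  note o = HomD(4,5)[OF s(1)] HomD(5)[OF s(2)]
  note A = syzygy_ses[OF o(1)] and B = syzygy_ses[OF o(2)]
  note [THEN hom_simps, simp] = s(1,2) sesD(1)[OF A] sesD(1)[OF B]
  note [simp] = o
  obtain u v where u: "ses C (\<Omega> a) u (\<Omega> b) v (\<Omega> c)"
    and e: "on_arr P (on_arr I f) \<cdot> \<omega> a = \<omega> b \<cdot> u"
    using syzygy_functor[OF S] by blast
  note uu = sesD[OF u]
  note [THEN hom_simps, simp] = uu(1,2)
  have ne: "on_arr \<nu> (on_arr P (on_arr I f)) \<cdot> on_arr \<nu> (\<omega> a) = on_arr \<nu> (\<omega> b) \<cdot> on_arr \<nu> u"
    using arg_cong[OF e(1), of "on_arr \<nu>"] by simp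
  have "is_mono C (on_arr \<nu> (on_arr P (on_arr I f)) \<cdot> on_arr \<nu> (\<omega> a))"
    unfolding ne by (rule mono_comp[OF flatD[OF c u] flatD[OF b B]]) (simp_all add: Hom_iff)
  then have m: "is_mono C (on_arr \<nu> (\<omega> a))"
    by (rule mono_right) (simp_all add: Hom_iff)
  show ?thesis by (rule flat_by_presentation[OF A flat_P m]) simp
qed

text \<open>
  Exactness of \<open>L\<^sub>2 \<nu> (b) \<rightarrow> L\<^sub>2 \<nu> (c) \<rightarrow> L\<^sub>1 \<nu> (a)\<close>. The object \<open>E\<close>, the preimage of \<open>\<Omega> c\<close> in \<open>P (I b)\<close>, is the
  kernel of \<open>P (I b) \<rightarrow> b \<rightarrow> c\<close>. It is an extension of \<open>a\<close> by \<open>\<Omega> b\<close>, hence flat, and it presents \<open>\<Omega> c\<close> with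
  kernel \<open>P (I a)\<close>.
\<close>

lemma flat_right:
  assumes S: "ses C a f b g c" and a: "flat C \<nu> a" and b: "flat C \<nu> (\<Omega> b)"
  shows "flat C \<nu> (\<Omega> c)"
proof -
  note s = sesD[OF S]
  note o = HomD(4,5)[OF s(1)] HomD(5)[OF s(2)]
  note B = sesD[OF syzygy_ses[OF o(2)]] and G = sesD[OF syzygy_ses[OF o(3)]]
  note [THEN hom_simps, simp] = s(1,2) B(1) G(1)
  note [simp] = o
  obtain u v where u: "ses C (\<Omega> a) u (\<Omega> b) v (\<Omega> c)"
    and e: "on_arr P (on_arr I g) \<cdot> \<omega> b = \<omega> c \<cdot> v"
    using syzygy_functor[OF S] by blast
  note uu = sesD[OF u]
  note T = P_ses[OF I_ses[OF S]]
  note t = sesD[OF T]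
  obtain E p y x where E: "ses C (on_obj P (on_obj I a)) x E y (\<Omega> c)" "p \<in> Hom C E (on_obj P (on_obj I b))"
    "on_arr P (on_arr I g) \<cdot> p = \<omega> c \<cdot> y" "p \<cdot> x = on_arr P (on_arr I f)"
    "is_pullback C E p y (on_arr P (on_arr I g)) (\<omega> c)"
    by (rule ses_pullback[OF T G(1)]) blast
  note ee = sesD[OF E(1)]
  note [THEN hom_simps, simp] = uu(1,2) ee(1,2) E(2)
  have ge: "g \<cdot> \<epsilon> b = \<epsilon> c \<cdot> on_arr P (on_arr I g)" by (rule gen.counit_nat[OF s(2)])
  have "g \<cdot> (\<epsilon> b \<cdot> p) = Zero C E c"
    by (simp add: Comp_reassoc2[OF ge] E(3) Comp_reassoc[OF G(7)])
  moreover have "\<epsilon> b \<cdot> p \<in> Hom C E b" by (simp add: Hom_iff)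
  ultimately obtain r where r: "r \<in> Hom C E a" "f \<cdot> r = \<epsilon> b \<cdot> p" using ses_lift[OF S] by blast
  obtain l where l: "l \<in> Hom C (\<Omega> b) E" "p \<cdot> l = \<omega> b" "y \<cdot> l = v"
    using pullback_lift[OF E(5) t(2) G(1) B(1) uu(2) e] by blast
  note [THEN hom_simps, simp] = r(1) l(1)
  have "f \<cdot> (r \<cdot> l) = Zero C (\<Omega> b) b" by (simp add: Comp_reassoc2[OF r(2)] l(2) B(7))
  then have rl: "r \<cdot> l = Zero C (\<Omega> b) a" by (rule mono_ZeroI[OF _ s(5,1)]) (simp add: Hom_iff)
  have ml: "is_mono C l" using mono_right[OF _ l(1) E(2)] l(2) B(5) by simp
  have ker: "is_kernel C l r"
  proof (rule kernelI[OF r(1) l(1) rl ml])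
    fix t h assume h: "h \<in> Hom C t E" "r \<cdot> h = Zero C t a"
    note [THEN hom_simps, simp] = h(1)
    have "\<epsilon> b \<cdot> (p \<cdot> h) = Zero C t b" by (simp add: h(2) Comp_reassoc2[OF r(2)[symmetric]])
    moreover have "p \<cdot> h \<in> Hom C t (on_obj P (on_obj I b))" by (simp add: Hom_iff)
    ultimately obtain w where w: "w \<in> Hom C t (\<Omega> b)" "\<omega> b \<cdot> w = p \<cdot> h"
      using ses_lift[OF syzygy_ses[OF o(2)]] by blast
    note [THEN hom_simps, simp] = w(1)
    have "\<omega> c \<cdot> (y \<cdot> (l \<cdot> w)) = \<omega> c \<cdot> (y \<cdot> h)"
      by (simp add: Comp_reassoc2[OF E(3)[symmetric]] Comp_reassoc[OF l(2)] w(2))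
    then have yw: "y \<cdot> (l \<cdot> w) = y \<cdot> h"
      by (rule mono_eqI[OF _ G(5,1)]) (simp_all add: Hom_iff)
    have "l \<cdot> w = h"
      by (rule pullback_ext[OF E(5) _ _ _ yw, of t]) (simp_all add: Hom_iff Comp_reassoc[OF l(2)] w(2))
    then show "\<exists>w\<in>Hom C t (\<Omega> b). l \<cdot> w = h" using w(1) by blast
  qed
  have "is_epi C r"
  proof -
    obtain t w z where w: "w \<in> Hom C t a" "is_epi C w" "z \<in> Hom C t (on_obj P (on_obj I b))" "\<epsilon> b \<cdot> z = f \<cdot> w"
      using epi_cover[OF B(6,2) s(1)] by blast
    note [THEN hom_simps, simp] = w(1,3)
    have "\<epsilon> c \<cdot> (on_arr P (on_arr I g) \<cdot> z) = Zero C t c"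
      by (simp add: Comp_reassoc2[OF ge[symmetric]] w(4) Comp_reassoc[OF s(7)])
    moreover have "on_arr P (on_arr I g) \<cdot> z \<in> Hom C t (on_obj P (on_obj I c))" by (simp add: Hom_iff)
    ultimately obtain z' where z': "z' \<in> Hom C t (\<Omega> c)" "\<omega> c \<cdot> z' = on_arr P (on_arr I g) \<cdot> z"
      using ses_lift[OF syzygy_ses[OF o(3)]] by blast
    obtain q where q: "q \<in> Hom C t E" "p \<cdot> q = z" "y \<cdot> q = z'"
      using pullback_lift[OF E(5) t(2) G(1) w(3) z'(1) z'(2)[symmetric]] by blast
    note [THEN hom_simps, simp] = q(1)
    have "f \<cdot> (r \<cdot> q) = f \<cdot> w" by (simp add: Comp_reassoc2[OF r(2)] q(2) w(4))
    then have "r \<cdot> q = w" by (rule mono_eqI[OF _ s(5,1)]) (simp_all add: Hom_iff)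
    then show ?thesis using epi_of_cover[OF r(1) w(1,2) q(1)] by blast
  qed
  then have "ses C (\<Omega> b) l E r a" by (rule ses_of_kernel[OF ker l(1) r(1)])
  then have fE: "flat C \<nu> E" by (rule flat_extension[OF _ b a])
  have "is_mono C (on_arr \<nu> p \<cdot> on_arr \<nu> x)"
    using nu_P_mono[OF gen.right_preserves_mono[OF s(5,1)]]
    by (simp add: E(4) flip: nak.on_arr_Comp_arr)
  then have "is_mono C (on_arr \<nu> x)"
    by (rule mono_right[OF _ nak.on_arr_in_Hom[OF ee(1)] nak.on_arr_in_Hom[OF E(2)]])
  then show ?thesis by (rule flat_by_presentation[OF E(1) fE])
qed

lemma Tor_zero_syzygy: "Tor_zero (Suc n) a = Tor_zero n (\<Omega> a)"
  by (simp add: syzygy_flat_def funpow_swap1)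

lemma Tor_extension:
  assumes "ses C a f b g c" "Tor_zero n a" "Tor_zero n c"
  shows "Tor_zero n b"
proof -
  obtain u v where S: "ses C ((\<Omega> ^^ n) a) u ((\<Omega> ^^ n) b) v ((\<Omega> ^^ n) c)"
    using syzygy_ses_funpow[OF assms(1)] by blast
  show ?thesis using flat_extension[OF S] assms(2,3) by (simp add: syzygy_flat_def)
qed

lemma Tor_left:
  assumes "ses C a f b g c" "Tor_zero n b" "Tor_zero (Suc n) c"
  shows "Tor_zero n a"
proof -
  obtain u v where S: "ses C ((\<Omega> ^^ n) a) u ((\<Omega> ^^ n) b) v ((\<Omega> ^^ n) c)"
    using syzygy_ses_funpow[OF assms(1)] by blast
  show ?thesis using flat_left[OF S] assms(2,3) by (simp add: syzygy_flat_def)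
qed

lemma Tor_right:
  assumes "ses C a f b g c" "Tor_zero n a" "Tor_zero (Suc n) b"
  shows "Tor_zero (Suc n) c"
proof -
  obtain u v where S: "ses C ((\<Omega> ^^ n) a) u ((\<Omega> ^^ n) b) v ((\<Omega> ^^ n) c)"
    using syzygy_ses_funpow[OF assms(1)] by blast
  show ?thesis using flat_right[OF S] assms(2,3) by (simp add: syzygy_flat_def)
qed

lemma syzygy_retract:
  assumes i: "i \<in> Hom C x y" "p \<in> Hom C y x" "p \<cdot> i = Id C x"
  obtains i' p' where "i' \<in> Hom C (\<Omega> x) (\<Omega> y)" "p' \<in> Hom C (\<Omega> y) (\<Omega> x)" "p' \<cdot> i' = Id C (\<Omega> x)"
proof -
  note o = HomD(4,5)[OF i(1)]
  note X = syzygy_ses[OF o(1)] and Y = syzygy_ses[OF o(2)]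
  note x = sesD[OF X] and y = sesD[OF Y]
  note [THEN hom_simps, simp] = i(1,2) x(1) y(1)
  note [simp] = o
  have z: "\<epsilon> y \<cdot> (on_arr P (on_arr I i) \<cdot> \<omega> x) = Zero C (\<Omega> x) y"
    "\<epsilon> x \<cdot> (on_arr P (on_arr I p) \<cdot> \<omega> y) = Zero C (\<Omega> y) x"
    by (simp_all add: Comp_reassoc2[OF gen.counit_nat[OF i(1), symmetric]]
        Comp_reassoc2[OF gen.counit_nat[OF i(2), symmetric]] x(7) y(7))
  obtain i' where i': "i' \<in> Hom C (\<Omega> x) (\<Omega> y)" "\<omega> y \<cdot> i' = on_arr P (on_arr I i) \<cdot> \<omega> x"
    using ses_lift[OF Y _ z(1)] by (auto simp: Hom_iff)
  obtain p' where p': "p' \<in> Hom C (\<Omega> y) (\<Omega> x)" "\<omega> x \<cdot> p' = on_arr P (on_arr I p) \<cdot> \<omega> y"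
    using ses_lift[OF X _ z(2)] by (auto simp: Hom_iff)
  note [THEN hom_simps, simp] = i'(1) p'(1)
  have pi: "on_arr P (on_arr I p) \<cdot> on_arr P (on_arr I i) = Id C (on_obj P (on_obj I x))"
    by (simp add: i(3) flip: gen.on_arr_Comp_arr gen.right.on_arr_Comp_arr)
  have "\<omega> x \<cdot> (p' \<cdot> i') = \<omega> x"
    by (simp add: Comp_reassoc2[OF p'(2)] i'(2) Comp_reassoc[OF pi])
  then have "p' \<cdot> i' = Id C (\<Omega> x)" by (rule mono_IdI[OF _ x(5,1)]) (simp add: Hom_iff)
  then show thesis using that i'(1) p'(1) by blast
qed

lemma Tor_retract:
  assumes "i \<in> Hom C x y" "p \<in> Hom C y x" "p \<cdot> i = Id C x" "Tor_zero n y"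
  shows "Tor_zero n x"
  using assms
proof (induction n arbitrary: x y i p)
  case 0
  then show ?case using flat_retract by (simp add: syzygy_flat_def)
next
  case (Suc n)
  show ?case
    by (rule syzygy_retract[OF Suc.prems(1-3)]) (use Suc.IH Suc.prems(4) in \<open>simp add: Tor_zero_syzygy\<close>)
qed

text \<open>
  The syzygy of \<open>P y\<close> is a direct summand of an object of the same form, because the counit at \<open>P y\<close>
  is split by \<open>P\<close> applied to the unit.
\<close>

lemma Tor_P: "y \<in> Obj C \<Longrightarrow> Tor_zero n (on_obj P y)"
proof (induction n arbitrary: y)
  case 0
  then show ?case by (simp add: syzygy_flat_def flat_P)
next
  case (Suc n)
  note [simp] = Suc.prems
  have S: "ses C (\<Omega> (on_obj P y)) (\<omega> (on_obj P y)) (on_obj P (on_obj I (on_obj P y)))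
      (\<epsilon> (on_obj P y)) (on_obj P y)"
    by (rule syzygy_ses) simp
  obtain r where "r \<in> Hom C (on_obj P (on_obj I (on_obj P y))) (\<Omega> (on_obj P y))"
    "r \<cdot> \<omega> (on_obj P y) = Id C (\<Omega> (on_obj P y))"
    using split_ses_retraction[OF S gen.on_arr_in_Hom[OF gen.unit_hom[of y]]] gen.triangle_left by auto
  then have "Tor_zero n (\<Omega> (on_obj P y))"
    using Tor_retract[OF sesD(1)[OF S]] Suc.IH[of "on_obj I (on_obj P y)"] by simp
  then show ?case by (simp add: Tor_zero_syzygy)
qed

abbreviation "Proj \<equiv> image_summands C P"

lemma Proj_retract:
  assumes "q \<in> Proj"
  obtains y i p where "y \<in> Obj C" "i \<in> Hom C q (on_obj P y)" "p \<in> Hom C (on_obj P y) q"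
    "p \<cdot> i = Id C q"
proof -
  obtain y where y: "y \<in> Obj C" "direct_summand C q (on_obj P y)"
    using assms by (auto simp: image_summands_def)
  show thesis by (rule direct_summand_retract[OF y(2)]) (rule that[OF y(1)])
qed

lemma Tor_Proj:
  assumes "q \<in> Proj"
  shows "Tor_zero n q"
proof -
  obtain y i p where "y \<in> Obj C" "i \<in> Hom C q (on_obj P y)" "p \<in> Hom C (on_obj P y) q"
    "p \<cdot> i = Id C q"
    by (rule Proj_retract[OF assms])
  then show ?thesis by (intro Tor_retract[OF _ _ _ Tor_P])
qed

lemma Tor_shift:
  assumes "ses C k u q v a" "\<And>n. Tor_zero n q"
  shows "Tor_zero (Suc n) a \<longleftrightarrow> Tor_zero n k"
  using Tor_left[OF assms(1)] Tor_right[OF assms(1)] assms(2) by blast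

lemma Tor_zero_0: "Tor_zero 0 a = flat C \<nu> a"
  by (simp add: syzygy_flat_def)

lemma exact_nu_iff_mono:
  assumes d: "d \<in> Hom C x q" and e: "e \<in> Hom C q b" "is_epi C e" and de: "exact_pair C d e"
    and k: "k \<in> Hom C b y"
  shows "exact_pair C (on_arr \<nu> d) (on_arr \<nu> (k \<cdot> e)) \<longleftrightarrow> is_mono C (on_arr \<nu> k)"
proof -
  note [THEN hom_simps, simp] = d e(1) k
  note h = nak.on_arr_in_Hom
  have ex: "exact_pair C (on_arr \<nu> d) (on_arr \<nu> e)"
    by (rule cokernel_exact_pair[OF nak.left_preserves_cokernel[OF
          exact_pair_cokernel[OF de d e] d e(1)] h[OF d] h[OF e(1)]])
  have "exact_pair C (on_arr \<nu> d) (on_arr \<nu> k \<cdot> on_arr \<nu> e) \<longleftrightarrow> is_mono C (on_arr \<nu> k)"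
  proof
    assume "is_mono C (on_arr \<nu> k)"
    then show "exact_pair C (on_arr \<nu> d) (on_arr \<nu> k \<cdot> on_arr \<nu> e)"
      using ex exact_pair_mono[OF h[OF d] h[OF e(1)] h[OF k]] by blast
  next
    assume ex2: "exact_pair C (on_arr \<nu> d) (on_arr \<nu> k \<cdot> on_arr \<nu> e)"
    show "is_mono C (on_arr \<nu> k)"
    proof (rule monoI[OF h[OF k]])
      fix t z assume z: "z \<in> Hom C t (on_obj \<nu> b)" "on_arr \<nu> k \<cdot> z = Zero C t (on_obj \<nu> y)"
      obtain t1 w1 y1 where 1: "w1 \<in> Hom C t1 t" "is_epi C w1" "y1 \<in> Hom C t1 (on_obj \<nu> q)"
        "on_arr \<nu> e \<cdot> y1 = z \<cdot> w1"
        using epi_cover[OF nak.left_preserves_epi[OF e(2,1)] h[OF e(1)] z(1)] by blast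
      note [THEN hom_simps, simp] = z(1) 1(1,3)
      have c: "on_arr \<nu> k \<cdot> on_arr \<nu> e \<in> Hom C (on_obj \<nu> q) (on_obj \<nu> y)"
        by (simp add: Hom_iff)
      have "(on_arr \<nu> k \<cdot> on_arr \<nu> e) \<cdot> y1 = Zero C t1 (on_obj \<nu> y)"
        by (simp add: 1(4) Comp_reassoc[OF z(2)])
      then obtain t2 w2 y2 where 2: "w2 \<in> Hom C t2 t1" "is_epi C w2"
        "y2 \<in> Hom C t2 (on_obj \<nu> x)" "on_arr \<nu> d \<cdot> y2 = y1 \<cdot> w2"
        using exact_pair_chase[OF h[OF d] c ex2 1(3)] by blast
      note [THEN hom_simps, simp] = 2(1,3)
      have "z \<cdot> (w1 \<cdot> w2) = on_arr \<nu> e \<cdot> (on_arr \<nu> d \<cdot> y2)"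
        by (simp add: 2(4) Comp_reassoc2[OF 1(4)])
      also have "\<dots> = Zero C t2 (on_obj \<nu> b)"
        by (simp add: Comp_reassoc[OF exact_pair_Zero[OF h[OF d] h[OF e(1)] ex]])
      finally have "z \<cdot> (w1 \<cdot> w2) = Zero C t2 (on_obj \<nu> b)" .
      then show "z = Zero C t (on_obj \<nu> b)"
        by (rule epi_ZeroI[OF _ epi_comp[OF 2(2) 1(2) 2(1) 1(1)] Comp_in_Hom[OF 2(1) 1(1)] z(1)])
    qed
  qed
  then show ?thesis by simp
qed

text \<open>
  Every resolution computes the derived functors. Removing its last term shifts the claim to the
  kernel of the augmentation, which reduces it to the first derived functor.
\<close>

lemma exact_nu_resolution:
  assumes "is_resolution C Proj a X d e"
  shows "exact_pair C (on_arr \<nu> (d (Suc i))) (on_arr \<nu> (d i)) \<longleftrightarrow> Tor_zero i a"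
  using assms
proof (induction i arbitrary: a X d e)
  case (0 a X d e)
  obtain K k e' where K: "ses C K k (X 0) e a"
    and R: "is_resolution C Proj K (\<lambda>n. X (Suc n)) (\<lambda>n. d (Suc n)) e'" and k: "k \<cdot> e' = d 0"
    using resolution_step[OF 0] by blast
  obtain K' k' where K': "ses C K' k' (X (Suc 0)) e' K" using resolution_step[OF R] by blast
  have d1: "d (Suc 0) \<in> Hom C (X (Suc (Suc 0))) (X (Suc 0))" and e': "exact_pair C (d (Suc 0)) e'"
    using R unfolding is_resolution_def by blast+
  have X0: "X 0 \<in> Proj" using 0 unfolding is_resolution_def by blast
  note s = sesD[OF K] and s' = sesD[OF K']
  have "exact_pair C (on_arr \<nu> (d (Suc 0))) (on_arr \<nu> (d 0)) \<longleftrightarrow> is_mono C (on_arr \<nu> k)"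
    using exact_nu_iff_mono[OF d1 s'(2,6) e' s(1)] by (simp add: k)
  also have "\<dots> \<longleftrightarrow> flat C \<nu> a"
    using flat_by_presentation[OF K] flatD[OF _ K] Tor_Proj[OF X0, of 0] by (auto simp: Tor_zero_0)
  finally show ?case by (simp add: Tor_zero_0)
next
  case (Suc i a X d e)
  obtain K k e' where K: "ses C K k (X 0) e a"
    and R: "is_resolution C Proj K (\<lambda>n. X (Suc n)) (\<lambda>n. d (Suc n)) e'"
    using resolution_step[OF Suc.prems] by blast
  have X0: "X 0 \<in> Proj" using Suc.prems unfolding is_resolution_def by blast
  show ?case using Suc.IH[OF R] Tor_shift[OF K Tor_Proj[OF X0]] by simp
qed

lemma resolution_exists:
  assumes a: "a \<in> Obj C"
  shows "\<exists>X d e. is_resolution C Proj a X d e"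
proof -
  let ?O = "\<lambda>n. (\<Omega> ^^ n) a"
  let ?X = "\<lambda>n. on_obj P (on_obj I (?O n))"
  let ?d = "\<lambda>n. \<omega> (?O n) \<cdot> \<epsilon> (?O (Suc n))"
  have S: "ses C (?O (Suc n)) (\<omega> (?O n)) (?X n) (\<epsilon> (?O n)) (?O n)" for n
    using syzygy_ses[of "?O n"] a by simp
  note s = sesD[OF S]
  obtain z where z: "is_zero_object C z" using ex_zero_object by blast
  have 1: "?X n \<in> Proj" for n using a by (intro image_summands_value) simp_all
  have 2: "?d n \<in> Hom C (?X (Suc n)) (?X n)" for n by (rule Comp_in_Hom[OF s(2) s(1)])
  have 3: "\<epsilon> a \<in> Hom C (?X 0) a" using s(2)[of 0] by simp
  have 4: "exact_pair C (?d (Suc n)) (?d n)" for n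
    by (rule exact_splice[OF S s(2) s(6) s(1) s(5)])
  have 5: "exact_pair C (?d 0) (\<epsilon> a)"
    using exact_splice[OF S s(2) s(6) Id_in_Hom Id_mono, of 0] a HomD[OF 3] by simp
  have 6: "exact_pair C (\<epsilon> a) (Zero C a z)"
    using exact_end_iff_epi[OF z 3] counit_epi[OF a] by simp
  have "is_resolution C Proj a ?X ?d (\<epsilon> a)"
    unfolding is_resolution_def using 1 2 3 4 5 6 z by blast
  then show ?thesis by blast
qed

lemma left_derived_zero_iff:
  assumes a: "a \<in> Obj C"
  shows "is_zero_object C (left_derived C Proj \<nu> (Suc i) a) \<longleftrightarrow> Tor_zero i a"
proof -
  let ?Q = "\<lambda>h. \<exists>X d e z. is_resolution C Proj a X d e \<and> is_zero_object C z \<and>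
      is_homology C (on_arr \<nu> (d (Suc i))) (on_arr \<nu> (d i)) h"
  have d: "d n \<in> Hom C (X (Suc n)) (X n)" "exact_pair C (d (Suc n)) (d n)"
    if "is_resolution C Proj a X d e" for X d e n
    using that unfolding is_resolution_def by blast+
  have "\<exists>h. ?Q h"
  proof -
    obtain X d e where R: "is_resolution C Proj a X d e" using resolution_exists[OF a] by blast
    note h = d[OF R]
    note [THEN hom_simps, simp] = h(1)[of i] h(1)[of "Suc i"]
    have "on_arr \<nu> (d i) \<cdot> on_arr \<nu> (d (Suc i)) = Zero C (on_obj \<nu> (X (Suc (Suc i)))) (on_obj \<nu> (X i))"
      using exact_pair_Zero[OF h(1) h(1) h(2), of i] by (simp flip: nak.on_arr_Comp_arr)
    then obtain hh where "is_homology C (on_arr \<nu> (d (Suc i))) (on_arr \<nu> (d i)) hh"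
      using homology_exists[OF nak.on_arr_in_Hom[OF h(1)] nak.on_arr_in_Hom[OF h(1)]] by blast
    then show ?thesis using R ex_zero_object by blast
  qed
  then have "?Q (left_derived C Proj \<nu> (Suc i) a)"
    unfolding left_derived_def by (simp only: nat.case) (rule someI_ex)
  then obtain X d e where R: "is_resolution C Proj a X d e"
    and H: "is_homology C (on_arr \<nu> (d (Suc i))) (on_arr \<nu> (d i)) (left_derived C Proj \<nu> (Suc i) a)"
    by blast
  show ?thesis
    using homology_zero_iff_exact[OF nak.on_arr_in_Hom[OF d(1)[OF R]] nak.on_arr_in_Hom[OF d(1)[OF R]] H]
      exact_nu_resolution[OF R] by simp
qed

end

context abelian_category begin

lemma ses_iso_replace:
  assumes S: "ses C a f b g c" and \<alpha>: "\<alpha> \<in> Hom C a' a" "is_iso C \<alpha>"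
    and \<beta>: "\<beta> \<in> Hom C b b'" "\<beta>' \<in> Hom C b' b" "\<beta>' \<cdot> \<beta> = Id C b" "\<beta> \<cdot> \<beta>' = Id C b'"
  shows "ses C a' (\<beta> \<cdot> (f \<cdot> \<alpha>)) b' (g \<cdot> \<beta>') c"
proof -
  note s = sesD[OF S]
  obtain \<alpha>' where \<alpha>': "\<alpha>' \<in> Hom C a a'" "\<alpha>' \<cdot> \<alpha> = Id C a'" "\<alpha> \<cdot> \<alpha>' = Id C a"
    using iso_obtain[OF \<alpha>(2,1)] by blast
  note [THEN hom_simps, simp] = s(1,2) \<alpha>(1) \<beta>(1,2) \<alpha>'(1)
  note [simp] = Comp_reassoc[OF \<beta>(3)] Comp_reassoc[OF \<beta>(4)]
    Comp_reassoc[OF \<alpha>'(3)]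
  have h: "\<beta> \<cdot> (f \<cdot> \<alpha>) \<in> Hom C a' b'" "g \<cdot> \<beta>' \<in> Hom C b' c" by (simp_all add: Hom_iff)
  have fa: "f \<cdot> \<alpha> \<in> Hom C a' b" by (simp add: Hom_iff)
  have m: "is_mono C (\<beta> \<cdot> (f \<cdot> \<alpha>))"
    by (rule mono_comp[OF mono_comp[OF iso_mono[OF \<alpha>(2,1)] s(5) \<alpha>(1) s(1)] retraction_mono[OF \<beta>(1-3)] fa \<beta>(1)])
  have e: "is_epi C (g \<cdot> \<beta>')" by (rule epi_comp[OF section_epi[OF \<beta>(2,1,3)] s(6) \<beta>(2) s(2)])
  have "is_kernel C (\<beta> \<cdot> (f \<cdot> \<alpha>)) (g \<cdot> \<beta>')"
  proof (rule kernelI[OF h(2,1) _ m])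
    show "(g \<cdot> \<beta>') \<cdot> (\<beta> \<cdot> (f \<cdot> \<alpha>)) = Zero C a' c" by (simp add: Comp_reassoc[OF s(7)])
    fix t x assume x: "x \<in> Hom C t b'" "(g \<cdot> \<beta>') \<cdot> x = Zero C t c"
    note [THEN hom_simps, simp] = x(1)
    have "g \<cdot> (\<beta>' \<cdot> x) = Zero C t c" "\<beta>' \<cdot> x \<in> Hom C t b" using x(2) by (simp_all add: Hom_iff)
    then obtain u where u: "u \<in> Hom C t a" "f \<cdot> u = \<beta>' \<cdot> x" using ses_lift[OF S] by blast
    note [THEN hom_simps, simp] = u(1)
    have "(\<beta> \<cdot> (f \<cdot> \<alpha>)) \<cdot> (\<alpha>' \<cdot> u) = x" by (simp add: u(2))
    moreover have "\<alpha>' \<cdot> u \<in> Hom C t a'" by (simp add: Hom_iff)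
    ultimately show "\<exists>u\<in>Hom C t a'. (\<beta> \<cdot> (f \<cdot> \<alpha>)) \<cdot> u = x" by blast
  qed
  then show ?thesis by (rule ses_of_kernel[OF _ h e])
qed

end

context adjunction begin

text \<open>
  The inverse at \<open>x\<close> is the inverse at \<open>y\<close> conjugated with the retraction.
\<close>

lemma unit_iso_retract:
  assumes i: "i \<in> Hom C x y" "p \<in> Hom C y x" "p \<cdot> i = Id C x" and y: "is_iso C (\<eta> y)"
  shows "is_iso C (\<eta> x)"
proof -
  note [THEN hom_simps, simp] = i(1,2)
  obtain h where h: "h \<in> Hom C (on_obj G (on_obj F y)) y" "h \<cdot> \<eta> y = Id C y"
    "\<eta> y \<cdot> h = Id C (on_obj G (on_obj F y))"
    using iso_obtain[OF y unit_hom] by auto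
  note [THEN hom_simps, simp] = h(1)
  show ?thesis
  proof (rule isoI[of _ x "on_obj G (on_obj F x)" "p \<cdot> (h \<cdot> on_arr G (on_arr F i))"])
    have "(p \<cdot> (h \<cdot> on_arr G (on_arr F i))) \<cdot> \<eta> x = p \<cdot> ((h \<cdot> \<eta> y) \<cdot> i)"
      by (simp add: unit_nat[OF i(1)])
    then show "(p \<cdot> (h \<cdot> on_arr G (on_arr F i))) \<cdot> \<eta> x = Id C x"
      unfolding h(2) by (simp add: i(3))
    have "\<eta> x \<cdot> (p \<cdot> (h \<cdot> on_arr G (on_arr F i))) = on_arr G (on_arr F p) \<cdot> ((\<eta> y \<cdot> h) \<cdot> on_arr G (on_arr F i))"
      by (simp add: Comp_reassoc2[OF unit_nat[OF i(2), symmetric]])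
    also have "\<dots> = Id C (on_obj G (on_obj F x))"
      unfolding h(3) by (simp add: i(3) flip: on_arr_Comp_arr right.on_arr_Comp_arr)
    finally show "\<eta> x \<cdot> (p \<cdot> (h \<cdot> on_arr G (on_arr F i))) = Id C (on_obj G (on_obj F x))" .
  qed (simp_all add: unit_hom Hom_iff)
qed

end

context nakayama_duality begin

abbreviation "Cotor_zero \<equiv> syzygy_flat (opposite C) \<nu>' \<eta>"
abbreviation cosyzygy ("\<mho>") where "\<mho> \<equiv> syzygy (opposite C) \<eta>"
abbreviation "cosyzygy_arr \<equiv> syzygy_arr (opposite C) \<eta>"

lemma cosyzygy_ses:
  "a \<in> Obj C \<Longrightarrow> ses C a (\<eta> a) (on_obj I (on_obj P a)) (cosyzygy_arr a) (\<mho> a)"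
  using nakayama_duality.syzygy_ses[OF dual, of a] by simp

lemma Cotor_extension: "\<lbrakk>ses C a f b g c; Cotor_zero n a; Cotor_zero n c\<rbrakk> \<Longrightarrow> Cotor_zero n b"
  using nakayama_duality.Tor_extension[OF dual, of c g b f a n] by simp

lemma Cotor_left: "\<lbrakk>ses C a f b g c; Cotor_zero n b; Cotor_zero (Suc n) a\<rbrakk> \<Longrightarrow> Cotor_zero n c"
  using nakayama_duality.Tor_left[OF dual, of c g b f a n] by simp

lemma Cotor_shift:
  "\<lbrakk>ses C a f b g c; \<And>n. Cotor_zero n b\<rbrakk> \<Longrightarrow> Cotor_zero (Suc n) a \<longleftrightarrow> Cotor_zero n c"
  using nakayama_duality.Tor_shift[OF dual, of c g b f a n] by simp

lemma Cotor_retract: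
  "\<lbrakk>i \<in> Hom C x y; p \<in> Hom C y x; p \<cdot> i = Id C x; Cotor_zero n y\<rbrakk> \<Longrightarrow> Cotor_zero n x"
  using nakayama_duality.Tor_retract[OF dual, of p x y i n] by simp

lemma Cotor_I: "y \<in> Obj C \<Longrightarrow> Cotor_zero n (on_obj I y)"
  using nakayama_duality.Tor_P[OF dual, of y n] by simp

lemma nu'_ses_coflat:
  "\<lbrakk>ses C k u b v a; Cotor_zero 0 k\<rbrakk> \<Longrightarrow>
    ses C (on_obj \<nu>' k) (on_arr \<nu>' u) (on_obj \<nu>' b) (on_arr \<nu>' v) (on_obj \<nu>' a)"
  using nakayama_duality.nu_ses_flat[OF dual, of a v b u k] by (simp add: syzygy_flat_def)

lemma coflat_by_copresentation:
  "\<lbrakk>ses C a f b g c; Cotor_zero 0 b; is_epi C (on_arr \<nu>' g)\<rbrakk> \<Longrightarrow> Cotor_zero 0 a"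
  using nakayama_duality.flat_by_presentation[OF dual, of c g b f a] by (simp add: syzygy_flat_def)

lemma Cotor_nu_P:
  assumes "y \<in> Obj C"
  shows "Cotor_zero n (on_obj \<nu> (on_obj P y))"
proof -
  obtain f where f: "f \<in> Hom C (on_obj \<nu> (on_obj P y)) (on_obj I y)" "is_iso C f"
    using nu_P_iso_I[OF assms] by blast
  obtain g where g: "g \<in> Hom C (on_obj I y) (on_obj \<nu> (on_obj P y))" "g \<cdot> f = Id C (on_obj \<nu> (on_obj P y))"
    using iso_obtain[OF f(2,1)] by blast
  show ?thesis by (rule Cotor_retract[OF f(1) g Cotor_I[OF assms]])
qed

section \<open>Gorenstein objects\<close>

text \<open>
  The intrinsic description of the Gorenstein projective objects, without complete resolutions.
\<close>

definition gorenstein :: "'o \<Rightarrow> bool" where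
  "gorenstein a \<longleftrightarrow> a \<in> Obj C \<and> (\<forall>n. Tor_zero n a) \<and> is_iso C (\<sigma> a) \<and> (\<forall>n. Cotor_zero n (on_obj \<nu> a))"

lemma gorensteinD:
  assumes "gorenstein a"
  shows "a \<in> Obj C" "Tor_zero n a" "is_iso C (\<sigma> a)" "Cotor_zero n (on_obj \<nu> a)" "flat C \<nu> a"
  using assms Tor_zero_0 unfolding gorenstein_def by blast+

lemma gorenstein_retract:
  assumes i: "i \<in> Hom C x y" "p \<in> Hom C y x" "p \<cdot> i = Id C x" and y: "gorenstein y"
  shows "gorenstein x"
  unfolding gorenstein_def
  using HomD(4)[OF i(1)] Tor_retract[OF i gorensteinD(2)[OF y]]
    nak.unit_iso_retract[OF i gorensteinD(3)[OF y]]
    Cotor_retract[OF nak.on_arr_in_Hom[OF i(1)] nak.on_arr_in_Hom[OF i(2)] nak.functor_retract[OF i]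
      gorensteinD(4)[OF y]]
  by blast

lemma gorenstein_P: "y \<in> Obj C \<Longrightarrow> gorenstein (on_obj P y)"
  unfolding gorenstein_def using Tor_P unit_iso Cotor_nu_P by simp

lemma gorenstein_Proj:
  assumes "q \<in> Proj"
  shows "gorenstein q"
proof -
  obtain y i p where "y \<in> Obj C" "i \<in> Hom C q (on_obj P y)" "p \<in> Hom C (on_obj P y) q"
    "p \<cdot> i = Id C q"
    by (rule Proj_retract[OF assms])
  then show ?thesis by (intro gorenstein_retract[OF _ _ _ gorenstein_P])
qed

lemma P_in_Proj: "y \<in> Obj C \<Longrightarrow> on_obj P y \<in> Proj"
  by (rule image_summands_value) simp_all

lemma double_nu_hom: "f \<in> Hom C a b \<Longrightarrow>
    on_arr \<nu>' (on_arr \<nu> f) \<in> Hom C (on_obj \<nu>' (on_obj \<nu> a)) (on_obj \<nu>' (on_obj \<nu> b))"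
  by (intro nak.right.on_arr_in_Hom nak.on_arr_in_Hom)

text \<open>
  Since \<open>c\<close> is flat and \<open>\<nu> a\<close> is acyclic for \<open>\<nu>'\<close>, the sequence stays exact under \<open>\<nu>\<close> and then under
  \<open>\<nu>'\<close>, so all three conditions pass to the quotient.
\<close>

lemma gorenstein_quotient:
  assumes S: "ses C a f b g c" and a: "gorenstein a" and b: "gorenstein b" and c: "flat C \<nu> c"
  shows "gorenstein c"
proof -
  note s = sesD[OF S]
  have o: "c \<in> Obj C" using HomD(5)[OF s(2)] .
  have 1: "Tor_zero n c" for n
    by (cases n) (use c Tor_right[OF S gorensteinD(2)[OF a] gorensteinD(2)[OF b]] in \<open>simp_all add: Tor_zero_0\<close>)
  note N = nu_ses_flat[OF S c]
  have 2: "Cotor_zero n (on_obj \<nu> c)" for n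
    by (rule Cotor_left[OF N gorensteinD(4)[OF b] gorensteinD(4)[OF a]])
  note M = nu'_ses_coflat[OF N gorensteinD(4)[OF a]]
  have 3: "is_iso C (\<sigma> c)"
    by (rule five_cokernel[OF s(1,2,4) sesD(1,2,4)[OF M] nak.unit_hom nak.unit_hom nak.unit_hom
          nak.unit_nat[OF s(1)] nak.unit_nat[OF s(2)] gorensteinD(3)[OF b]
          iso_epi[OF gorensteinD(3)[OF a] nak.unit_hom]])
      (use gorensteinD(1)[OF a] gorensteinD(1)[OF b] o in simp_all)
  show ?thesis unfolding gorenstein_def using 1 2 3 o by blast
qed

lemma gorenstein_extension:
  assumes S: "ses C a f b g c" and a: "gorenstein a" and c: "gorenstein c"
  shows "gorenstein b"
proof -
  note s = sesD[OF S]
  have o: "b \<in> Obj C" using HomD(5)[OF s(1)] .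
  have 1: "Tor_zero n b" for n by (rule Tor_extension[OF S gorensteinD(2)[OF a] gorensteinD(2)[OF c]])
  note N = nu_ses_flat[OF S gorensteinD(5)[OF c]]
  have 2: "Cotor_zero n (on_obj \<nu> b)" for n
    by (rule Cotor_extension[OF N gorensteinD(4)[OF a] gorensteinD(4)[OF c]])
  note M = nu'_ses_coflat[OF N gorensteinD(4)[OF a]]
  have 3: "is_iso C (\<sigma> b)"
    by (rule five_middle[OF S M nak.unit_hom nak.unit_hom nak.unit_hom
          nak.unit_nat[OF s(1)] nak.unit_nat[OF s(2)] gorensteinD(3)[OF a] gorensteinD(3)[OF c]])
      (use gorensteinD(1)[OF a] gorensteinD(1)[OF c] o in simp_all)
  show ?thesis unfolding gorenstein_def using 1 2 3 o by blast
qed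

text \<open>
  Embed \<open>\<nu> a\<close> into \<open>I y\<close> with \<open>y = P (\<nu> a)\<close> and apply \<open>\<nu>'\<close>: the sequence stays exact as \<open>\<nu> a\<close> is acyclic, its
  first term is \<open>a\<close>, and its second term is \<open>P y\<close>. The quotient is flat because the embedding of \<open>\<nu> a\<close>
  is recovered after applying \<open>\<nu>\<close> and the counit.
\<close>

lemma gorenstein_embedding:
  assumes a: "gorenstein a"
  obtains y f g c where "y \<in> Obj C" "ses C a f (on_obj P y) g c" "gorenstein c"
proof -
  note ao [simp] = gorensteinD(1)[OF a]
  define y where "y = on_obj P (on_obj \<nu> a)"
  have y [simp]: "y \<in> Obj C" by (simp add: y_def)
  obtain \<theta> where \<theta>: "\<theta> \<in> Hom C (on_obj \<nu>' (on_obj I y)) (on_obj P y)" "is_iso C \<theta>"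
    using nu'_I_iso_P[OF y] by blast
  obtain \<theta>' where \<theta>': "\<theta>' \<in> Hom C (on_obj P y) (on_obj \<nu>' (on_obj I y))"
    "\<theta>' \<cdot> \<theta> = Id C (on_obj \<nu>' (on_obj I y))" "\<theta> \<cdot> \<theta>' = Id C (on_obj P y)"
    using iso_obtain[OF \<theta>(2,1)] by blast
  have J: "ses C (on_obj \<nu> a) (\<eta> (on_obj \<nu> a)) (on_obj I y) (cosyzygy_arr (on_obj \<nu> a)) (\<mho> (on_obj \<nu> a))"
    unfolding y_def by (rule cosyzygy_ses) simp
  note J' = nu'_ses_coflat[OF J gorensteinD(4)[OF a]]
  define f where "f = \<theta> \<cdot> (on_arr \<nu>' (\<eta> (on_obj \<nu> a)) \<cdot> \<sigma> a)"
  define g where "g = on_arr \<nu>' (cosyzygy_arr (on_obj \<nu> a)) \<cdot> \<theta>'"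
  have S: "ses C a f (on_obj P y) g (on_obj \<nu>' (\<mho> (on_obj \<nu> a)))"
    unfolding f_def g_def
    by (rule ses_iso_replace[OF J' nak.unit_hom gorensteinD(3)[OF a] \<theta>(1) \<theta>']) simp
  note j = sesD[OF J]
  note [THEN hom_simps, simp] = j(1) \<theta>(1)
  have sh: "\<sigma> a \<in> Hom C a (on_obj \<nu>' (on_obj \<nu> a))" by (simp add: nak.unit_hom)
  let ?h = "on_arr \<nu>' (\<eta> (on_obj \<nu> a)) \<cdot> \<sigma> a"
  have hh: "?h \<in> Hom C a (on_obj \<nu>' (on_obj I y))" by (simp add: Hom_iff)
  have "\<tau> (on_obj I y) \<cdot> on_arr \<nu> ?h = \<eta> (on_obj \<nu> a) \<cdot> (\<tau> (on_obj \<nu> a) \<cdot> on_arr \<nu> (\<sigma> a))"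
    by (simp add: Comp_reassoc2[OF nak.counit_nat[OF j(1), symmetric]])
  also have "\<dots> = \<eta> (on_obj \<nu> a)" by (simp add: nak.triangle_left)
  finally have "is_mono C (\<tau> (on_obj I y) \<cdot> on_arr \<nu> ?h)" using j(5) by simp
  then have m1: "is_mono C (on_arr \<nu> ?h)"
    by (rule mono_right[OF _ nak.on_arr_in_Hom[OF hh] nak.counit_hom]) simp
  have "is_mono C (on_arr \<nu> \<theta> \<cdot> on_arr \<nu> ?h)"
    by (rule mono_comp[OF m1 iso_mono[OF nak.functor_iso[OF \<theta>(2)]]]) (simp_all add: Hom_iff)
  then have "is_mono C (on_arr \<nu> f)" by (simp add: f_def)
  then have fl: "flat C \<nu> (on_obj \<nu>' (\<mho> (on_obj \<nu> a)))"
    by (rule flat_by_presentation[OF S flat_P[OF y]])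
  have "gorenstein (on_obj \<nu>' (\<mho> (on_obj \<nu> a)))"
    by (rule gorenstein_quotient[OF S a gorenstein_P[OF y] fl])
  then show thesis using that[OF y S] by blast
qed

text \<open>
  In a complete resolution every kernel \<open>Z i\<close> has a neighbour on either side, so each acyclicity
  statement for all \<open>i\<close> at stage \<open>n\<close> shifts to all \<open>i\<close> at stage \<open>n + 1\<close>. The unit at \<open>Z i\<close> is
  mono because it is one on \<open>X i\<close>; the kernel version of the five lemma then makes it an isomorphism.
\<close>

lemma gorenstein_if_complete:
  assumes X: "\<And>i::int. X i \<in> Proj" and S: "\<And>i. ses C (Z i) (m i) (X i) (e i) (Z (i - 1))"
    and mono: "\<And>i. is_mono C (on_arr \<nu> (m i))"
  shows "gorenstein (Z i)"
proof -
  note s = sesD[OF S]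
  have o [simp]: "Z i \<in> Obj C" "X i \<in> Obj C" for i using HomD(4,5)[OF s(1)] by blast+
  note GX = gorenstein_Proj[OF X]
  have fl: "flat C \<nu> (Z i)" for i
    using flat_by_presentation[OF S gorensteinD(5)[OF GX] mono, of "i + 1"] by simp
  have 1: "Tor_zero n (Z i)" for n i
  proof (induction n arbitrary: i)
    case (Suc n)
    then show ?case using Tor_shift[OF S gorensteinD(2)[OF GX], of n "i + 1"] by simp
  qed (simp add: Tor_zero_0 fl)
  note N = nu_ses_flat[OF S fl]
  have sm: "is_mono C (\<sigma> (Z i))" for i
  proof -
    have "is_mono C (on_arr \<nu>' (on_arr \<nu> (m i)) \<cdot> \<sigma> (Z i))"
      unfolding nak.unit_nat[OF s(1)]
      by (rule mono_comp[OF s(5) iso_mono[OF gorensteinD(3)[OF GX] nak.unit_hom] s(1) nak.unit_hom]) simp_all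
    then show ?thesis by (rule mono_right[OF _ nak.unit_hom double_nu_hom[OF s(1)]]) simp
  qed
  have 2: "is_iso C (\<sigma> (Z i))" for i
    by (rule five_kernel[OF s(1,2,3) double_nu_hom[OF s(1)] double_nu_hom[OF s(2)]
          nak.right_preserves_kernel[OF sesD(3,2,1)[OF N]] nak.unit_hom nak.unit_hom nak.unit_hom
          nak.unit_nat[OF s(1)] nak.unit_nat[OF s(2)] gorensteinD(3)[OF GX] sm]) simp_all
  have c0: "Cotor_zero 0 (on_obj \<nu> (Z i))" for i
  proof (rule coflat_by_copresentation[OF N gorensteinD(4)[OF GX]])
    have "is_epi C (on_arr \<nu>' (on_arr \<nu> (e i)) \<cdot> \<sigma> (X i))"
      unfolding nak.unit_nat[OF s(2)]
      by (rule epi_comp[OF s(6) iso_epi[OF 2 nak.unit_hom] s(2) nak.unit_hom]) simp_all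
    then show "is_epi C (on_arr \<nu>' (on_arr \<nu> (e i)))"
      by (rule epi_left[OF _ nak.unit_hom double_nu_hom[OF s(2)]]) simp
  qed
  have 3: "Cotor_zero n (on_obj \<nu> (Z i))" for n i
  proof (induction n arbitrary: i)
    case (Suc n)
    then show ?case using Cotor_shift[OF N gorensteinD(4)[OF GX]] by simp
  qed (rule c0)
  show ?thesis unfolding gorenstein_def using 1 2 3 o by blast
qed

lemma gorenstein_projectives_subset:
  assumes "a \<in> gorenstein_projectives C P \<nu>"
  shows "gorenstein a"
proof -
  obtain X :: "int \<Rightarrow> 'o" and s k where X: "\<And>i. X i \<in> Proj" and s: "\<And>i. s i \<in> Hom C (X i) (X (i - 1))"
    and ex: "\<And>i. exact_pair C (s (i + 1)) (s i)"
    and nex: "\<And>i. exact_pair C (on_arr \<nu> (s (i + 1))) (on_arr \<nu> (s i))"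
    and k: "k \<in> Hom C a (X 0)" "is_kernel C k (s 0)"
    using assms unfolding gorenstein_projectives_def acyclic_kernels_def by blast
  have s': "s (i + 1) \<in> Hom C (X (i + 1)) (X i)" for i using s[of "i + 1"] by simp
  have "\<exists>z m e. m \<in> Hom C z (X i) \<and> is_kernel C m (s i) \<and> e \<in> Hom C (X (i + 1)) z \<and> is_epi C e \<and>
    m \<cdot> e = s (i + 1) \<and> (i = 0 \<longrightarrow> z = a)" for i
  proof -
    obtain m' z' where m': "m' \<in> Hom C z' (X i)" "is_kernel C m' (s i)"
      using kernel_exists[OF s[of i]] by blast
    have "\<exists>z m. m \<in> Hom C z (X i) \<and> is_kernel C m (s i) \<and> (i = 0 \<longrightarrow> z = a)"
      using m' k by (cases "i = 0") blast+
    then obtain z m where m: "m \<in> Hom C z (X i)" "is_kernel C m (s i)" "i = 0 \<longrightarrow> z = a"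
      by blast
    obtain e where "e \<in> Hom C (X (i + 1)) z" "is_epi C e" "m \<cdot> e = s (i + 1)"
      using exact_pair_lift_epi[OF s' s ex m(2,1)] by blast
    then show ?thesis using m by blast
  qed
  then obtain Z m e where Z: "\<And>i. m i \<in> Hom C (Z i) (X i)" "\<And>i. is_kernel C (m i) (s i)"
    "\<And>i. e i \<in> Hom C (X (i + 1)) (Z i)" "\<And>i. is_epi C (e i)" "\<And>i. m i \<cdot> e i = s (i + 1)" "Z 0 = a"
    by metis
  have e': "e (i - 1) \<in> Hom C (X i) (Z (i - 1))" "m (i - 1) \<cdot> e (i - 1) = s i" for i
    using Z(3,5)[of "i - 1"] by simp_all
  have mm: "is_mono C (m i)" for i by (rule kernelD(3)[OF Z(2) s])
  have ker: "is_kernel C (m i) (e (i - 1))" for i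
    by (rule kernel_of_postcomp_mono[OF _ e'(1) Z(1) Z(1) mm]) (simp add: e'(2) Z(2))
  have S: "ses C (Z i) (m i) (X i) (e (i - 1)) (Z (i - 1))" for i
    by (rule ses_of_kernel[OF ker Z(1) e'(1) Z(4)])
  have "is_mono C (on_arr \<nu> (m (i - 1)))" for i
  proof -
    have "exact_pair C (s (i + 1)) (e (i - 1))"
      using exact_pair_mono[OF s' e'(1) Z(1) mm] ex by (simp add: e'(2))
    then show ?thesis
      using exact_nu_iff_mono[OF s' e'(1) Z(4) _ Z(1)] nex by (simp add: e'(2))
  qed
  from this[of "_ + 1"] have mono: "is_mono C (on_arr \<nu> (m i))" for i by simp
  have "gorenstein (Z 0)"
    by (rule gorenstein_if_complete[of X Z m "\<lambda>i. e (i - 1)"]) (rule X S mono)+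
  then show ?thesis by (simp add: Z(6))
qed

text \<open>
  A complete resolution is spliced from the syzygies of \<open>a\<close>, which are flat as \<open>a\<close> is acyclic, and from
  iterated embeddings of Gorenstein objects.
\<close>

lemma gorenstein_projectives_superset:
  assumes a: "gorenstein a"
  shows "a \<in> gorenstein_projectives C P \<nu>"
proof -
  have "\<exists>x f g c. ses C b f x g c \<and> x \<in> Proj \<and> gorenstein c" if "gorenstein b" for b
    using gorenstein_embedding[OF that] P_in_Proj by metis
  then obtain nx nf ng nc where n: "\<And>b. gorenstein b \<Longrightarrow> ses C b (nf b) (nx b) (ng b) (nc b)"
    "\<And>b. gorenstein b \<Longrightarrow> nx b \<in> Proj" "\<And>b. gorenstein b \<Longrightarrow> gorenstein (nc b)"
    by metis
  note ao [simp] = gorensteinD(1)[OF a]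
  have g: "gorenstein ((nc ^^ j) a)" for j by (induction j) (simp_all add: a n(3))
  \<comment> \<open>Nonnegative degrees use the syzygies of \<open>a\<close>, negative ones the iterated cokernels \<open>nc\<close>.\<close>
  define Z where "Z = (\<lambda>i::int. if i \<ge> 0 then (\<Omega> ^^ nat i) a else (nc ^^ nat (- i)) a)"
  define X where "X = (\<lambda>i::int. if i \<ge> 1 then on_obj P (on_obj I ((\<Omega> ^^ nat (i - 1)) a)) else nx ((nc ^^ nat (- i)) a))"
  define m where "m = (\<lambda>i::int. if i \<ge> 1 then \<omega> ((\<Omega> ^^ nat (i - 1)) a) else nf ((nc ^^ nat (- i)) a))"
  define e where "e = (\<lambda>i::int. if i \<ge> 1 then \<epsilon> ((\<Omega> ^^ nat (i - 1)) a) else ng ((nc ^^ nat (- i)) a))"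
  have fl: "flat C \<nu> (Z i)" for i
    using gorensteinD(2)[OF a, of "nat i"] gorensteinD(5)[OF g] by (simp add: Z_def syzygy_flat_def)
  have XP: "X i \<in> Proj" for i
    using n(2)[OF g] by (simp add: X_def P_in_Proj)
  have S: "ses C (Z i) (m i) (X i) (e i) (Z (i - 1))" for i
  proof (cases "i \<ge> 1")
    case True
    define j where "j = nat (i - 1)"
    have "nat i = Suc j" using True by (simp add: j_def)
    then show ?thesis
      using True syzygy_ses[of "(\<Omega> ^^ j) a"] by (simp add: Z_def X_def m_def e_def j_def)
  next
    case False
    define j where "j = nat (- i)"
    have j: "nat (1 - i) = Suc j" "Z i = (nc ^^ j) a"
      using False by (auto simp: j_def Z_def)
    then show ?thesis
      using False n(1)[OF g[of j]] by (simp add: Z_def X_def m_def e_def j_def)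
  qed
  note s = sesD[OF S]
  define d where "d = (\<lambda>i. m (i - 1) \<cdot> e i)"
  have dh: "d i \<in> Hom C (X i) (X (i - 1))" for i unfolding d_def by (rule Comp_in_Hom[OF s(2) s(1)])
  have e1: "e (i + 1) \<in> Hom C (X (i + 1)) (Z i)" for i using s(2)[of "i + 1"] by simp
  have ex: "exact_pair C (d (i + 1)) (d i)" for i
    using exact_splice[OF S e1 s(6) s(1) s(5)] by (simp add: d_def)
  have nex: "exact_pair C (on_arr \<nu> (d (i + 1))) (on_arr \<nu> (d i))" for i
  proof -
    note N = sesD[OF nu_ses_flat[OF S fl]]
    have ne: "on_arr \<nu> (e (i + 1)) \<in> Hom C (on_obj \<nu> (X (i + 1))) (on_obj \<nu> (Z i))"
      by (rule nak.on_arr_in_Hom[OF e1])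
    have "exact_pair C (on_arr \<nu> (m i) \<cdot> on_arr \<nu> (e (i + 1))) (on_arr \<nu> (m (i - 1)) \<cdot> on_arr \<nu> (e i))"
      by (rule exact_splice[OF nu_ses_flat[OF S fl] ne N(6) N(1) N(5)])
    then show ?thesis
      using HomD[OF s(1)[of i]] HomD[OF e1[of i]] HomD[OF s(1)[of "i - 1"]] HomD[OF s(2)[of i]]
      by (simp add: d_def)
  qed
  have k: "m 0 \<in> Hom C a (X 0)" "is_kernel C (m 0) (d 0)"
    using s(1)[of 0] kernel_postcomp_mono[OF s(3,2,1) s(1,5), of 0] by (simp_all add: Z_def d_def)
  show ?thesis
    unfolding gorenstein_projectives_def acyclic_kernels_def
    using ao XP dh ex nex k by blast
qed

lemma gorenstein_projectives_iff: "a \<in> gorenstein_projectives C P \<nu> \<longleftrightarrow> gorenstein a"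
  using gorenstein_projectives_subset gorenstein_projectives_superset by blast

end

context abelian_category begin

lemma is_coresolution_opposite:
  "is_coresolution C S a X d e = is_resolution (opposite C) S a X d e"
  unfolding is_coresolution_def is_resolution_def by simp

lemma has_coresolution_opposite:
  "has_coresolution_of_length C S a n = has_resolution_of_length (opposite C) S a n"
  unfolding has_coresolution_of_length_def has_resolution_of_length_def
  by (simp, intro iff_exI, blast)

section \<open>Resolutions of finite length\<close>

lemma resolution_length_0:
  "has_resolution_of_length C S a 0 \<longleftrightarrow> (\<exists>x f. x \<in> S \<and> f \<in> Hom C x a \<and> is_iso C f)"
proof
  assume "has_resolution_of_length C S a 0"
  then have "\<exists>(X :: nat \<Rightarrow> 'a) (d :: nat \<Rightarrow> 'b) z. is_zero_object C z \<and> X 0 \<in> S \<and> d 0 \<in> Hom C (X 0) a \<and>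
    exact_pair C (Zero C z (X 0)) (d 0) \<and> exact_pair C (d 0) (Zero C a z)"
    unfolding has_resolution_of_length_def by simp
  then obtain X :: "nat \<Rightarrow> 'a" and d :: "nat \<Rightarrow> 'b" and z where X: "is_zero_object C z" "X 0 \<in> S"
    "d 0 \<in> Hom C (X 0) a" "exact_pair C (Zero C z (X 0)) (d 0)" "exact_pair C (d 0) (Zero C a z)"
    by blast
  then have "is_iso C (d 0)"
    using mono_epi_iso[OF X(3)] exact_start_iff_mono[OF X(1,3)] exact_end_iff_epi[OF X(1,3)] by blast
  then show "\<exists>x f. x \<in> S \<and> f \<in> Hom C x a \<and> is_iso C f" using X(2,3) by blast
next
  assume "\<exists>x f. x \<in> S \<and> f \<in> Hom C x a \<and> is_iso C f"
  then obtain x f where f: "x \<in> S" "f \<in> Hom C x a" "is_iso C f" by blast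
  obtain z where z: "is_zero_object C z" using ex_zero_object by blast
  have "exact_pair C (Zero C z x) f" "exact_pair C f (Zero C a z)"
    using exact_start_iff_mono[OF z f(2)] exact_end_iff_epi[OF z f(2)] iso_mono[OF f(3,2)]
      iso_epi[OF f(3,2)] by blast+
  then show "has_resolution_of_length C S a 0"
    unfolding has_resolution_of_length_def
    by (intro exI[of _ "\<lambda>_. x"] exI[of _ "\<lambda>_. f"] exI[of _ z]) (simp add: z f)
qed

lemma resolution_length_SucD:
  assumes "has_resolution_of_length C S a (Suc n)"
  obtains K k x e where "ses C K k x e a" "x \<in> S" "has_resolution_of_length C S K n"
proof -
  obtain X d z where z: "is_zero_object C z" and X: "\<And>i. i \<le> Suc n \<Longrightarrow> X i \<in> S"
    and d0: "d 0 \<in> Hom C (X 0) a" and d: "\<And>i. i < Suc n \<Longrightarrow> d (Suc i) \<in> Hom C (X (Suc i)) (X i)"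
    and start: "exact_pair C (Zero C z (X (Suc n))) (d (Suc n))"
    and ex: "\<And>i. i < Suc n \<Longrightarrow> exact_pair C (d (Suc i)) (d i)"
    and last: "exact_pair C (d 0) (Zero C a z)"
    using assms unfolding has_resolution_of_length_def by blast
  have epi: "is_epi C (d 0)" using last exact_end_iff_epi[OF z d0] by blast
  obtain K k where k: "k \<in> Hom C K (X 0)" "is_kernel C k (d 0)" using kernel_exists[OF d0] by blast
  have mk: "is_mono C k" by (rule kernelD(3)[OF k(2) d0])
  obtain e where e: "e \<in> Hom C (X (Suc 0)) K" "is_epi C e" "k \<cdot> e = d (Suc 0)"
    using exact_pair_lift_epi[OF d[of 0] d0 ex[of 0] k(2,1)] by auto
  define d' where "d' = (\<lambda>i. if i = 0 then e else d (Suc i))"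
  have pair: "exact_pair C f (d' 0)" if "exact_pair C f (d (Suc 0))" "f \<in> Hom C t (X (Suc 0))" for f t
    using that exact_pair_mono[OF that(2) e(1) k(1) mk] by (simp add: d'_def e(3))
  have 1: "exact_pair C (Zero C z (X (Suc n))) (d' n)"
  proof (cases n)
    case 0
    have "Zero C z (X (Suc n)) \<in> Hom C z (X (Suc 0))"
      using z HomD(4)[OF e(1)] 0 by (auto simp: is_zero_object_def intro: Zero_hom)
    then show ?thesis using pair start 0 by simp
  qed (use start in \<open>simp add: d'_def\<close>)
  have 2: "exact_pair C (d' (Suc i)) (d' i)" if "i < n" for i
  proof (cases i)
    case 0
    then have "d (Suc (Suc 0)) \<in> Hom C (X (Suc (Suc 0))) (X (Suc 0))"
      "exact_pair C (d (Suc (Suc 0))) (d (Suc 0))"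
      using d[of "Suc 0"] ex[of "Suc 0"] that by simp_all
    then have "exact_pair C (d (Suc (Suc 0))) (d' 0)" by (intro pair)
    then show ?thesis using 0 by (simp add: d'_def)
  qed (use ex[of "Suc i"] that in \<open>simp add: d'_def\<close>)
  have 3: "exact_pair C (d' 0) (Zero C K z)"
    using exact_end_iff_epi[OF z e(1)] e(2) by (simp add: d'_def)
  have "has_resolution_of_length C S K n"
    unfolding has_resolution_of_length_def
    by (intro exI[of _ "\<lambda>i. X (Suc i)"] exI[of _ d'] exI[of _ z])
      (use 1 2 3 z X d e(1) in \<open>simp add: d'_def\<close>)
  then show thesis using that[OF ses_of_kernel[OF k(2,1) d0 epi] X[of 0]] by simp
qed

lemma resolution_length_SucI:
  assumes S: "ses C K k x e a" "x \<in> S" and R: "has_resolution_of_length C S K n"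
  shows "has_resolution_of_length C S a (Suc n)"
proof -
  obtain X d z where z: "is_zero_object C z" and X: "\<And>i. i \<le> n \<Longrightarrow> X i \<in> S"
    and d0: "d 0 \<in> Hom C (X 0) K" and d: "\<And>i. i < n \<Longrightarrow> d (Suc i) \<in> Hom C (X (Suc i)) (X i)"
    and start: "exact_pair C (Zero C z (X n)) (d n)"
    and ex: "\<And>i. i < n \<Longrightarrow> exact_pair C (d (Suc i)) (d i)"
    and last: "exact_pair C (d 0) (Zero C K z)"
    using R unfolding has_resolution_of_length_def by blast
  note s = sesD[OF S(1)]
  have epi: "is_epi C (d 0)" using last exact_end_iff_epi[OF z d0] by blast
  define X' where "X' = (\<lambda>i. case i of 0 \<Rightarrow> x | Suc j \<Rightarrow> X j)"
  define d' where "d' = (\<lambda>i. case i of 0 \<Rightarrow> e | Suc j \<Rightarrow> (if j = 0 then k \<cdot> d 0 else d j))"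
  have kd: "k \<cdot> d 0 \<in> Hom C (X 0) x" by (rule Comp_in_Hom[OF d0 s(1)])
  have pair: "exact_pair C f (k \<cdot> d 0)" if "exact_pair C f (d 0)" "f \<in> Hom C t (X 0)" for f t
    using that exact_pair_mono[OF that(2) d0 s(1,5)] by blast
  have 0: "exact_pair C (k \<cdot> d 0) e"
    unfolding exact_pair_iff_cover[OF kd s(2)] using s(1,3) d0 epi by blast
  have 1: "exact_pair C (Zero C z (X n)) (d' (Suc n))"
  proof (cases n)
    case 0
    have "Zero C z (X n) \<in> Hom C z (X 0)"
      using z HomD(4)[OF d0] 0 by (auto simp: is_zero_object_def intro: Zero_hom)
    then show ?thesis using pair start 0 by (simp add: d'_def)
  qed (use start in \<open>simp add: d'_def\<close>)
  have 2: "exact_pair C (d' (Suc i)) (d' i)" if "i < Suc n" for i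
  proof (cases i)
    case [simp]: (Suc j)
    show ?thesis
    proof (cases j)
      case 0
      then show ?thesis using pair[OF _ d[of 0]] ex[of 0] that by (simp add: d'_def)
    qed (use ex[of j] that in \<open>simp add: d'_def\<close>)
  qed (simp add: d'_def 0)
  have 3: "exact_pair C (d' 0) (Zero C a z)"
    using exact_end_iff_epi[OF z s(2)] s(6) by (simp add: d'_def)
  have 4: "d' (Suc i) \<in> Hom C (X' (Suc i)) (X' i)" if "i < Suc n" for i
    using that kd d by (cases i) (simp_all add: d'_def X'_def)
  have 5: "X' i \<in> S" if "i \<le> Suc n" for i
    using that X S(2) by (cases i) (simp_all add: X'_def)
  have 6: "d' 0 \<in> Hom C (X' 0) a" "X' (Suc n) = X n" using s(2) by (simp_all add: d'_def X'_def)
  show ?thesis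
    unfolding has_resolution_of_length_def
    by (intro exI[of _ X'] exI[of _ d'] exI[of _ z]) (use 1 2 3 4 5 6 z in simp)
qed

lemma global_dim_le_iff:
  "global_resolution_dim C S \<le> enat n \<longleftrightarrow>
    (\<forall>a\<in>Obj C. \<exists>m\<le>n. has_resolution_of_length C S a m)"
proof -
  have "resolution_dim C S a \<le> enat n \<longleftrightarrow> (\<exists>m\<le>n. has_resolution_of_length C S a m)" for a
  proof
    assume le: "resolution_dim C S a \<le> enat n"
    let ?A = "{enat m |m. has_resolution_of_length C S a m}"
    have "Inf ?A \<noteq> \<infinity>" using le unfolding resolution_dim_def
      by (metis enat_ord_simps(5) enat.distinct(1) infinity_ileE)
    then have "?A \<noteq> {}" by (auto simp: top_enat_def[symmetric])
    then have "Inf ?A \<in> ?A" unfolding Inf_enat_def by (auto intro: LeastI)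
    then obtain m where m: "Inf ?A = enat m" "has_resolution_of_length C S a m" by blast
    have "m \<le> n" using le unfolding resolution_dim_def m(1) by simp
    then show "\<exists>m\<le>n. has_resolution_of_length C S a m" using m(2) by blast
  next
    assume "\<exists>m\<le>n. has_resolution_of_length C S a m"
    then obtain m where "m \<le> n" "has_resolution_of_length C S a m" by blast
    then show "resolution_dim C S a \<le> enat n"
      unfolding resolution_dim_def by (intro Inf_lower2[of "enat m"]) auto
  qed
  then show ?thesis unfolding global_resolution_dim_def by (simp add: SUP_le_iff)
qed

lemma coresolution_dim_opposite:
  "global_coresolution_dim C S = global_resolution_dim (opposite C) S"
  unfolding global_coresolution_dim_def global_resolution_dim_def coresolution_dim_def
    resolution_dim_def has_coresolution_opposite by simp

end

context nakayama_duality begin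

text \<open>
  Relative projectivity: \<open>P\<close>-projective objects lift along the counits, even if they are not
  projective. This is why the argument below uses the canonical syzygies.
\<close>

lemma lift_through_counit:
  assumes i: "i \<in> Hom C q (on_obj P y)" "p \<in> Hom C (on_obj P y) q" "p \<cdot> i = Id C q"
    and y: "y \<in> Obj C" and \<phi>: "\<phi> \<in> Hom C q M"
  obtains f where "f \<in> Hom C q (on_obj P (on_obj I M))" "\<epsilon> M \<cdot> f = \<phi>"
proof -
  note [THEN hom_simps, simp] = i(1,2) \<phi>
  note [simp] = y
  have pp: "\<phi> \<cdot> p \<in> Hom C (on_obj P y) M" by (simp add: Hom_iff)
  let ?h = "on_arr P (on_arr I (\<phi> \<cdot> p) \<cdot> \<eta> y)"
  have e: "\<epsilon> M \<cdot> ?h = \<phi> \<cdot> p" by (rule gen.transpose[OF y pp])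
  have h: "?h \<in> Hom C (on_obj P y) (on_obj P (on_obj I M))" by (simp add: Hom_iff)
  note [simp] = HomD(1-3)[OF h]
  have "\<epsilon> M \<cdot> (?h \<cdot> i) = (\<phi> \<cdot> p) \<cdot> i" by (rule Comp_reassoc[OF e]) (simp_all del: gen.on_arr_Comp_arr gen.right.on_arr_Comp_arr)
  also have "\<dots> = \<phi>" by (simp add: i(3))
  finally show thesis using that Comp_in_Hom[OF i(1) h] by blast
qed

lemma extend_over_unit:
  assumes "i \<in> Hom C q (on_obj I y)" "p \<in> Hom C (on_obj I y) q" "p \<cdot> i = Id C q"
    and "y \<in> Obj C" and "\<phi> \<in> Hom C b q"
  obtains f where "f \<in> Hom C (on_obj I (on_obj P b)) q" "f \<cdot> \<eta> b = \<phi>"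
  using nakayama_duality.lift_through_counit[OF dual, of p q y i \<phi> b] assms by auto

section \<open>Resolutions by Gorenstein objects\<close>

lemma left_vanishes_iff:
  "left_derived_vanishes_above C P \<nu> m \<longleftrightarrow> (\<forall>i\<ge>m. \<forall>a\<in>Obj C. Tor_zero i a)"
proof -
  have "(\<forall>i>m. Q i) \<longleftrightarrow> (\<forall>i\<ge>m. Q (Suc i))" for Q :: "nat \<Rightarrow> bool"
    by (metis Suc_le_D Suc_le_eq Suc_le_mono)
  then show ?thesis
    unfolding left_derived_vanishes_above_def using left_derived_zero_iff by simp
qed

lemma right_derived_zero_iff:
  assumes a: "a \<in> Obj C"
  shows "is_zero_object C (right_derived C (image_summands C I) \<nu>' (Suc i) a) \<longleftrightarrow> Cotor_zero i a"
proof -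
  let ?Inj = "image_summands C I"
  let ?Q = "\<lambda>h. \<exists>X d e z. is_coresolution C ?Inj a X d e \<and> is_zero_object C z \<and>
      is_homology C (on_arr \<nu>' (d i)) (on_arr \<nu>' (d (Suc i))) h"
  have d: "d n \<in> Hom C (X n) (X (Suc n))" "exact_pair C (d n) (d (Suc n))"
    if "is_coresolution C ?Inj a X d e" for X d e n
    using that unfolding is_coresolution_def by blast+
  have "\<exists>h. ?Q h"
  proof -
    obtain X d e where R: "is_coresolution C ?Inj a X d e"
      using nakayama_duality.resolution_exists[OF dual, of a] a by (auto simp: is_coresolution_opposite)
    note h = d[OF R]
    note [THEN hom_simps, simp] = h(1)[of i] h(1)[of "Suc i"]
    have "on_arr \<nu>' (d (Suc i)) \<cdot> on_arr \<nu>' (d i) = Zero C (on_obj \<nu>' (X i)) (on_obj \<nu>' (X (Suc (Suc i))))"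
      using exact_pair_Zero[OF h(1) h(1) h(2), of i] by (simp flip: nak.right.on_arr_Comp_arr)
    then obtain hh where "is_homology C (on_arr \<nu>' (d i)) (on_arr \<nu>' (d (Suc i))) hh"
      using homology_exists[OF nak.right.on_arr_in_Hom[OF h(1)] nak.right.on_arr_in_Hom[OF h(1)]] by blast
    then show ?thesis using R ex_zero_object by blast
  qed
  then have "?Q (right_derived C ?Inj \<nu>' (Suc i) a)"
    unfolding right_derived_def by (simp only: nat.case) (rule someI_ex)
  then obtain X d e where R: "is_coresolution C ?Inj a X d e"
    and H: "is_homology C (on_arr \<nu>' (d i)) (on_arr \<nu>' (d (Suc i))) (right_derived C ?Inj \<nu>' (Suc i) a)"
    by blast
  have R': "is_resolution (opposite C) (image_summands (opposite C) I) a X d e"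
    using R by (simp add: is_coresolution_opposite)
  show ?thesis
    using homology_zero_iff_exact[OF nak.right.on_arr_in_Hom[OF d(1)[OF R]] nak.right.on_arr_in_Hom[OF d(1)[OF R]] H]
      nakayama_duality.exact_nu_resolution[OF dual R', of i] by simp
qed

lemma right_vanishes_iff:
  "right_derived_vanishes_above C I \<nu>' m \<longleftrightarrow> (\<forall>i\<ge>m. \<forall>a\<in>Obj C. Cotor_zero i a)"
proof -
  have "(\<forall>i>m. Q i) \<longleftrightarrow> (\<forall>i\<ge>m. Q (Suc i))" for Q :: "nat \<Rightarrow> bool"
    by (metis Suc_le_D Suc_le_eq Suc_le_mono)
  then show ?thesis
    unfolding right_derived_vanishes_above_def using right_derived_zero_iff by simp
qed

abbreviation "GP \<equiv> gorenstein_projectives C P \<nu>"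

lemma GP_resolution_Tor:
  assumes "has_resolution_of_length C GP a n" "n \<le> i"
  shows "Tor_zero i a"
  using assms
proof (induction n arbitrary: a i)
  case 0
  then obtain x f where f: "gorenstein x" "f \<in> Hom C x a" "is_iso C f"
    unfolding resolution_length_0 gorenstein_projectives_iff by blast
  obtain g where "g \<in> Hom C a x" "f \<cdot> g = Id C a" using iso_obtain[OF f(3,2)] by blast
  then show ?case using Tor_retract[OF _ f(2) _ gorensteinD(2)[OF f(1)]] by blast
next
  case (Suc n)
  obtain K k x e where K: "ses C K k x e a" "x \<in> GP" "has_resolution_of_length C GP K n"
    by (rule resolution_length_SucD[OF Suc.prems(1)])
  obtain j where "i = Suc j" "n \<le> j" using Suc.prems(2) by (cases i) auto
  then show ?case
    using Tor_shift[OF K(1)] gorensteinD(2) K(2) Suc.IH[OF K(3)] unfolding gorenstein_projectives_iff by simp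
qed

text \<open>
  Acyclicity passes to the kernels of the resolution; starting at the far end, each of them is a
  Gorenstein object.
\<close>

lemma acyclic_GP_resolution_gorenstein:
  assumes "has_resolution_of_length C GP a n" "\<And>i. Tor_zero i a"
  shows "gorenstein a"
  using assms
proof (induction n arbitrary: a)
  case 0
  then obtain x f where f: "gorenstein x" "f \<in> Hom C x a" "is_iso C f"
    unfolding resolution_length_0 gorenstein_projectives_iff by blast
  obtain g where "g \<in> Hom C a x" "f \<cdot> g = Id C a" using iso_obtain[OF f(3,2)] by blast
  then show ?case using gorenstein_retract[OF _ f(2) _ f(1)] by blast
next
  case (Suc n)
  obtain K k x e where K: "ses C K k x e a" "x \<in> GP" "has_resolution_of_length C GP K n"
    by (rule resolution_length_SucD[OF Suc.prems(1)])
  have x: "gorenstein x" using K(2) gorenstein_projectives_iff by blast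
  have "Tor_zero i K" for i using Tor_shift[OF K(1) gorensteinD(2)[OF x]] Suc.prems(2)[of "Suc i"] by simp
  then have "gorenstein K" by (rule Suc.IH[OF K(3)])
  then show ?case using gorenstein_quotient[OF K(1) _ x] Suc.prems(2)[of 0] by (simp add: Tor_zero_0)
qed

lemma GP_resolution_of_syzygy:
  assumes "a \<in> Obj C" "gorenstein ((\<Omega> ^^ n) a)"
  shows "has_resolution_of_length C GP a n"
  using assms
proof (induction n arbitrary: a)
  case 0
  have "Id C a \<in> Hom C a a" "is_iso C (Id C a)"
    using 0(1) isoI[OF Id_in_Hom Id_in_Hom] by (simp_all add: Id_in_Hom)
  then show ?case using 0 unfolding resolution_length_0 gorenstein_projectives_iff by auto
next
  case (Suc n)
  have "has_resolution_of_length C GP (\<Omega> a) n"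
    using Suc.IH[of "\<Omega> a"] Suc.prems by (simp add: funpow_swap1)
  moreover have "on_obj P (on_obj I a) \<in> GP"
    using gorenstein_P Suc.prems(1) by (simp add: gorenstein_projectives_iff)
  ultimately show ?case by (rule resolution_length_SucI[OF syzygy_ses[OF Suc.prems(1)], rotated])
qed

text \<open>
  Under \<open>\<nu>\<close> the canonical resolution stays exact with middle terms acyclic for \<open>\<nu>'\<close>, so
  \<open>R\<^sup>i \<nu>' (\<nu> (\<Omega>\<^sup>j a))\<close> is isomorphic to \<open>R\<^sup>i\<^sup>+\<^sup>1 \<nu>' (\<nu> (\<Omega>\<^sup>j\<^sup>+\<^sup>1 a))\<close> for \<open>i > 0\<close> and vanishes by going far enough
  to the left. Hence \<open>\<nu>'\<close> preserves exactness once more, the units at all syzygies are epi, and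
  the five lemma makes them isomorphisms.
\<close>

lemma acyclic_gorenstein:
  assumes a: "a \<in> Obj C" and T: "\<And>n. Tor_zero n a"
    and R: "\<And>i b. \<lbrakk>r \<le> i; b \<in> Obj C\<rbrakk> \<Longrightarrow> Cotor_zero i b"
  shows "gorenstein a"
proof -
  define Y where "Y = (\<lambda>j. (\<Omega> ^^ j) a)"
  have Yo [simp]: "Y j \<in> Obj C" for j using a by (simp add: Y_def)
  have S: "ses C (Y (Suc j)) (\<omega> (Y j)) (on_obj P (on_obj I (Y j))) (\<epsilon> (Y j)) (Y j)" for j
    using syzygy_ses[of "Y j"] by (simp add: Y_def a)
  note s = sesD[OF S]
  have fl: "flat C \<nu> (Y j)" for j using T[of j] by (simp add: Y_def syzygy_flat_def)
  note N = nu_ses_flat[OF S fl]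
  have "Cotor_zero n (on_obj \<nu> (Y j))" if "r \<le> n + k" for n j k
    using that
  proof (induction k arbitrary: n j)
    case 0
    then show ?case using R by simp
  next
    case (Suc k)
    have "Cotor_zero (Suc n) (on_obj \<nu> (Y (Suc j)))" using Suc by simp
    then show ?case by (rule Cotor_left[OF N Cotor_nu_P, rotated]) simp
  qed
  then have C: "Cotor_zero n (on_obj \<nu> (Y j))" for n j using le_add2 by blast
  note M = nu'_ses_coflat[OF N C]
  have uo: "is_iso C (\<sigma> (on_obj P (on_obj I (Y j))))" for j by (rule unit_iso) simp
  have epi: "is_epi C (\<sigma> (Y j))" for j
  proof -
    have "is_epi C (\<sigma> (Y j) \<cdot> \<epsilon> (Y j))"
      unfolding nak.unit_nat[OF s(2), symmetric]
      by (rule epi_comp[OF iso_epi[OF uo nak.unit_hom] sesD(6)[OF M] nak.unit_hom sesD(2)[OF M]]) simp_all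
    then show ?thesis by (rule epi_left[OF _ s(2) nak.unit_hom]) simp
  qed
  have "is_iso C (\<sigma> (Y 0))"
    by (rule five_cokernel[OF s(1,2,4) sesD(1,2,4)[OF M] nak.unit_hom nak.unit_hom nak.unit_hom
          nak.unit_nat[OF s(1)] nak.unit_nat[OF s(2)] uo epi]) simp_all
  then show ?thesis unfolding gorenstein_def using a T C[of _ 0] by (simp add: Y_def)
qed

end

context nakayama_duality begin

section \<open>Extending arrows along the canonical coresolution\<close>

lemma nu'_I_retract:
  assumes "y \<in> Obj C"
  obtains i p where "i \<in> Hom C (on_obj \<nu>' (on_obj I y)) (on_obj P y)"
    "p \<in> Hom C (on_obj P y) (on_obj \<nu>' (on_obj I y))" "p \<cdot> i = Id C (on_obj \<nu>' (on_obj I y))"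
  using nu'_I_iso_P[OF assms] iso_obtain by metis

lemma nu_P_retract:
  assumes "y \<in> Obj C"
  obtains i p where "i \<in> Hom C (on_obj \<nu> (on_obj P y)) (on_obj I y)"
    "p \<in> Hom C (on_obj I y) (on_obj \<nu> (on_obj P y))" "p \<cdot> i = Id C (on_obj \<nu> (on_obj P y))"
  using nu_P_iso_I[OF assms] iso_obtain by metis

lemma cosyzygy_obj [simp]: "a \<in> Obj C \<Longrightarrow> \<mho> a \<in> Obj C"
  using HomD(5)[OF sesD(2)[OF cosyzygy_ses]] .

text \<open>
  The notation for the main extension argument: \<open>J b = I (P b)\<close> is the canonical injective containing \<open>b\<close>, and
  \<open>\<delta> b\<close> is the differential from \<open>J b\<close> to \<open>J\<close> of the cosyzygy of \<open>b\<close>. Iterating from \<open>a\<close> gives the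
  canonical coresolution of \<open>a\<close>.
\<close>

abbreviation J :: "'o \<Rightarrow> 'o" where "J b \<equiv> on_obj I (on_obj P b)"

definition \<delta> :: "'o \<Rightarrow> 'm" where "\<delta> b = \<eta> (\<mho> b) \<cdot> cosyzygy_arr b"

lemma J_ses: "b \<in> Obj C \<Longrightarrow> ses C b (\<eta> b) (J b) (cosyzygy_arr b) (\<mho> b)"
  by (rule cosyzygy_ses)

lemma \<delta>_hom: "b \<in> Obj C \<Longrightarrow> \<delta> b \<in> Hom C (J b) (J (\<mho> b))"
  unfolding \<delta>_def by (rule Comp_in_Hom[OF sesD(2)[OF J_ses] sesD(1)[OF J_ses]]) simp_all

lemma \<delta>_comp_\<delta>:
  assumes b: "b \<in> Obj C"
  shows "\<delta> (\<mho> b) \<cdot> \<delta> b = Zero C (J b) (J (\<mho> (\<mho> b)))"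
proof -
  note s = sesD[OF J_ses[OF b]] and s' = sesD[OF J_ses[of "\<mho> b"]] and s'' = sesD[OF J_ses[of "\<mho> (\<mho> b)"]]
  note [THEN hom_simps, simp] = s(2) s'(1,2) s''(1)
  note [simp] = b
  show ?thesis unfolding \<delta>_def using s'(7) by (simp add: Comp_reassoc)
qed

text \<open>
  Write \<open>Q b = \<nu>' (J b)\<close>. The arrow \<open>\<nu> \<phi>\<close> vanishes on \<open>J b\<close>, hence factors over the second cosyzygy; into the
  injective \<open>\<nu> (P y)\<close> it extends to the next term of the coresolution, and \<open>\<nu>'\<close> brings this extension back
  because the unit is an isomorphism at \<open>P y\<close>.
\<close>

lemma gorenstein_extend:
  assumes M: "gorenstein M" and b: "b \<in> Obj C"
    and \<phi>: "\<phi> \<in> Hom C (on_obj \<nu>' (J (\<mho> b))) M"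
    and z: "\<phi> \<cdot> on_arr \<nu>' (\<delta> b) = Zero C (on_obj \<nu>' (J b)) M"
  obtains L c w N t where "ses C M c L w N" "gorenstein N" "t \<in> Hom C (on_obj \<nu>' (J (\<mho> (\<mho> b)))) L"
    "c \<cdot> \<phi> = t \<cdot> on_arr \<nu>' (\<delta> (\<mho> b))"
proof -
  obtain y c w N where y: "y \<in> Obj C" and S: "ses C M c (on_obj P y) w N" and N: "gorenstein N"
    by (rule gorenstein_embedding[OF M])
  define d where "d = \<mho> b"
  have d [simp]: "d \<in> Obj C" using b by (simp add: d_def)
  note \<phi>' = \<phi>[folded d_def]
  note Sd = sesD[OF J_ses[OF d]] and Sdd = sesD[OF J_ses[of "\<mho> d"]]
    and Sb = sesD[OF J_ses[OF b, folded d_def]]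
  note c = sesD(1)[OF S]
  obtain i where i: "i \<in> Hom C (J d) (on_obj \<nu> (on_obj \<nu>' (J d)))"
    "i \<cdot> \<tau> (J d) = Id C (on_obj \<nu> (on_obj \<nu>' (J d)))" "\<tau> (J d) \<cdot> i = Id C (J d)"
    using iso_obtain[OF counit_iso[of "on_obj P d"] nak.counit_hom] by auto
  obtain s where s: "s \<in> Hom C (on_obj \<nu>' (on_obj \<nu> (on_obj P y))) (on_obj P y)"
    "s \<cdot> \<sigma> (on_obj P y) = Id C (on_obj P y)"
    using iso_obtain[OF unit_iso[OF y] nak.unit_hom] y by auto
  note [THEN hom_simps, simp] = \<phi>' c i(1) s(1) Sd(1,2) Sb(1,2) Sdd(1)
  note [simp] = b y HomD(1-3)[OF \<delta>_hom[OF b, folded d_def]] HomD(1-3)[OF \<delta>_hom[OF d]]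
  have dd: "\<delta> b \<in> Hom C (J b) (J d)" by (rule \<delta>_hom[OF b, folded d_def])
  define \<psi> where "\<psi> = on_arr \<nu> (c \<cdot> \<phi>) \<cdot> i"
  have \<psi>: "\<psi> \<in> Hom C (J d) (on_obj \<nu> (on_obj P y))" unfolding \<psi>_def by (simp add: Hom_iff)
  note [THEN hom_simps, simp] = \<psi>
  have tau: "\<tau> (J d) \<cdot> on_arr \<nu> (on_arr \<nu>' (\<delta> b)) = \<delta> b \<cdot> \<tau> (J b)"
    using nak.counit_nat[OF dd] by simp
  have "(\<psi> \<cdot> \<delta> b) \<cdot> \<tau> (J b) = on_arr \<nu> (c \<cdot> \<phi>) \<cdot> (i \<cdot> (\<delta> b \<cdot> \<tau> (J b)))"
    by (simp add: \<psi>_def)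
  also have "\<dots> = on_arr \<nu> (c \<cdot> \<phi>) \<cdot> on_arr \<nu> (on_arr \<nu>' (\<delta> b))"
    by (simp add: tau[symmetric] Comp_reassoc[OF i(2)])
  also have "\<dots> = on_arr \<nu> (c \<cdot> (\<phi> \<cdot> on_arr \<nu>' (\<delta> b)))" by simp
  also have "\<dots> = Zero C (on_obj \<nu> (on_obj \<nu>' (J b))) (on_obj \<nu> (on_obj P y))"
    unfolding z by simp
  finally have "(\<psi> \<cdot> \<delta> b) \<cdot> \<tau> (J b) = Zero C (on_obj \<nu> (on_obj \<nu>' (J b))) (on_obj \<nu> (on_obj P y))" .
  then have "\<psi> \<cdot> \<delta> b = Zero C (J b) (on_obj \<nu> (on_obj P y))"
    by (rule epi_ZeroI[OF _ iso_epi[OF counit_iso[of "on_obj P b"] nak.counit_hom] nak.counit_hom])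
      (simp_all add: Hom_iff)
  then have "(\<psi> \<cdot> \<eta> d) \<cdot> cosyzygy_arr b = Zero C (J b) (on_obj \<nu> (on_obj P y))"
    by (simp add: \<delta>_def flip: d_def)
  then have "\<psi> \<cdot> \<eta> d = Zero C d (on_obj \<nu> (on_obj P y))"
    by (rule epi_ZeroI[OF _ Sb(6,2)]) (simp add: Hom_iff)
  then obtain g where g: "g \<in> Hom C (\<mho> d) (on_obj \<nu> (on_obj P y))" "g \<cdot> cosyzygy_arr d = \<psi>"
    using ses_colift[OF J_ses[OF d] \<psi>] by blast
  obtain i' p' where ip: "i' \<in> Hom C (on_obj \<nu> (on_obj P y)) (on_obj I y)"
    "p' \<in> Hom C (on_obj I y) (on_obj \<nu> (on_obj P y))" "p' \<cdot> i' = Id C (on_obj \<nu> (on_obj P y))"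
    by (rule nu_P_retract[OF y])
  obtain h where h: "h \<in> Hom C (J (\<mho> d)) (on_obj \<nu> (on_obj P y))" "h \<cdot> \<eta> (\<mho> d) = g"
    using extend_over_unit[OF ip y g(1)] by auto
  note [THEN hom_simps, simp] = g(1) h(1)
  define t where "t = s \<cdot> on_arr \<nu>' h"
  have t: "t \<in> Hom C (on_obj \<nu>' (J (\<mho> d))) (on_obj P y)" unfolding t_def by (simp add: Hom_iff)
  have "h \<cdot> \<delta> d = \<psi>" unfolding \<delta>_def by (simp add: Comp_reassoc[OF h(2)] g(2))
  then have "t \<cdot> on_arr \<nu>' (\<delta> d) = s \<cdot> on_arr \<nu>' \<psi>"
    by (simp add: t_def flip: nak.right.on_arr_Comp_arr)
  also have "\<dots> = s \<cdot> (on_arr \<nu>' (on_arr \<nu> (c \<cdot> \<phi>)) \<cdot> on_arr \<nu>' i)"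
    by (simp add: \<psi>_def)
  \<comment> \<open>Both arrows are inverse to \<open>\<nu>'\<close> applied to the counit, by the triangle identity.\<close>
  also have "on_arr \<nu>' i = \<sigma> (on_obj \<nu>' (J d))"
  proof -
    have e: "on_arr \<nu>' i \<cdot> on_arr \<nu>' (\<tau> (J d)) = Id C (on_obj \<nu>' (on_obj \<nu> (on_obj \<nu>' (J d))))"
      by (simp add: i(2) flip: nak.right.on_arr_Comp_arr)
    have "on_arr \<nu>' i = on_arr \<nu>' i \<cdot> (on_arr \<nu>' (\<tau> (J d)) \<cdot> \<sigma> (on_obj \<nu>' (J d)))"
      by (simp add: nak.triangle_right)
    also have "\<dots> = \<sigma> (on_obj \<nu>' (J d))" by (simp add: Comp_reassoc[OF e])
    finally show ?thesis .
  qed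
  also have "on_arr \<nu>' (on_arr \<nu> (c \<cdot> \<phi>)) \<cdot> \<sigma> (on_obj \<nu>' (J d)) = \<sigma> (on_obj P y) \<cdot> (c \<cdot> \<phi>)"
    by (rule nak.unit_nat[OF Comp_in_Hom[OF \<phi>' c]])
  also have "s \<cdot> (\<sigma> (on_obj P y) \<cdot> (c \<cdot> \<phi>)) = c \<cdot> \<phi>" by (simp add: Comp_reassoc[OF s(2)])
  finally have "c \<cdot> \<phi> = t \<cdot> on_arr \<nu>' (\<delta> d)" by simp
  then show thesis using that[OF S N] t by (simp add: d_def)
qed

text \<open>
  Induction on \<open>m\<close>. Lift \<open>\<phi>\<close> to \<open>f\<close> with values in \<open>P (I M)\<close>. On the previous term of the complex \<open>f\<close> takes values in
  \<open>\<Omega> M\<close>, and the induction hypothesis extends this restriction to the whole of \<open>Q\<close>, after enlarging \<open>\<Omega> M\<close> to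
  \<open>L\<close> with Gorenstein quotient. In the pushout \<open>X\<close> of \<open>P (I M)\<close> and \<open>L\<close>, which is again Gorenstein, the difference
  of \<open>f\<close> and this extension is a lift of \<open>\<phi>\<close> that vanishes on the previous term, so the Gorenstein case applies
  to it; a second pushout transports the resulting extension from \<open>X\<close> to its quotient \<open>M\<close>. The index \<open>j\<close> drops
  with \<open>m\<close>, which is why \<open>m \<le> j\<close> is required.
\<close>

lemma syzygy_gorenstein_extend:
  assumes "gorenstein ((\<Omega> ^^ m) M)" "M \<in> Obj C" "a \<in> Obj C" "m \<le> j"
    and "b = (\<mho> ^^ j) a"
    and "\<phi> \<in> Hom C (on_obj \<nu>' (J (\<mho> b))) M"
    and "\<phi> \<cdot> on_arr \<nu>' (\<delta> b) = Zero C (on_obj \<nu>' (J b)) M"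
  shows "\<exists>L c w N t. ses C M c L w N \<and> gorenstein N \<and> t \<in> Hom C (on_obj \<nu>' (J (\<mho> (\<mho> b)))) L \<and>
    c \<cdot> \<phi> = t \<cdot> on_arr \<nu>' (\<delta> (\<mho> b))"
  using assms
proof (induction m arbitrary: M j b \<phi>)
  case 0
  have b: "b \<in> Obj C" using 0(3,5) by (induction j arbitrary: b) simp_all
  show ?case
    by (rule gorenstein_extend[OF _ b 0(6,7)]) (use 0(1) in \<open>simp, blast\<close>)
next
  case (Suc m)
  obtain j' where j': "j = Suc j'" "m \<le> j'" using Suc.prems(4) by (cases j) auto
  define b0 where "b0 = (\<mho> ^^ j') a"
  have b0 [simp]: "b0 \<in> Obj C" unfolding b0_def using Suc.prems(3) by (induction j') simp_all
  have bb: "b = \<mho> b0" using Suc.prems(5) j'(1) by (simp add: b0_def)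
  have b [simp]: "b \<in> Obj C" by (simp add: bb)
  have M [simp]: "M \<in> Obj C" by fact
  let ?Q = "\<lambda>b. on_obj \<nu>' (J b)" and ?D = "\<lambda>b. on_arr \<nu>' (\<delta> b)"
  have D: "?D b \<in> Hom C (?Q b) (?Q (\<mho> b))" if "b \<in> Obj C" for b
    by (rule nak.right.on_arr_in_Hom[OF \<delta>_hom[OF that]])
  have DD: "?D b \<cdot> ?D b0 = Zero C (?Q b0) (?Q (\<mho> b))"
    using \<delta>_comp_\<delta>[OF b0] HomD[OF \<delta>_hom[OF b0]] HomD[OF \<delta>_hom[OF b]]
    by (simp add: bb flip: nak.right.on_arr_Comp_arr)
  have D0: "?D b0 \<in> Hom C (?Q b0) (?Q b)" using D[OF b0] by (simp add: bb)
  have D1: "?D b \<in> Hom C (?Q b) (?Q (\<mho> b))" by (rule D[OF b])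
  have D2: "?D (\<mho> b) \<in> Hom C (?Q (\<mho> b)) (?Q (\<mho> (\<mho> b)))" by (rule D) simp
  note \<phi> = Suc.prems(6,7)
  have Pb: "on_obj P (\<mho> b) \<in> Obj C" by simp
  obtain i p where ip: "i \<in> Hom C (?Q (\<mho> b)) (on_obj P (on_obj P (\<mho> b)))"
    "p \<in> Hom C (on_obj P (on_obj P (\<mho> b))) (?Q (\<mho> b))" "p \<cdot> i = Id C (?Q (\<mho> b))"
    by (rule nu'_I_retract[OF Pb])
  obtain f where f: "f \<in> Hom C (?Q (\<mho> b)) (on_obj P (on_obj I M))" "\<epsilon> M \<cdot> f = \<phi>"
    by (rule lift_through_counit[OF ip Pb \<phi>(1)])
  note SM = syzygy_ses[OF M]
  note sm = sesD[OF SM]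
  note [THEN hom_simps, simp] = D0 D1 D2 f(1) \<phi>(1) sm(1)
  have fD: "f \<cdot> ?D b \<in> Hom C (?Q b) (on_obj P (on_obj I M))" by (rule Comp_in_Hom[OF D1 f(1)])
  have "\<epsilon> M \<cdot> (f \<cdot> ?D b) = Zero C (?Q b) M" by (simp add: Comp_reassoc[OF f(2)] \<phi>(2))
  then obtain \<psi> where \<psi>: "\<psi> \<in> Hom C (?Q b) (\<Omega> M)" "\<omega> M \<cdot> \<psi> = f \<cdot> ?D b"
    using ses_lift[OF SM fD] by blast
  note [THEN hom_simps, simp] = \<psi>(1)
  have "\<omega> M \<cdot> (\<psi> \<cdot> ?D b0) = Zero C (?Q b0) (on_obj P (on_obj I M))"
    by (simp add: Comp_reassoc2[OF \<psi>(2)] DD)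
  then have \<psi>0: "\<psi> \<cdot> ?D b0 = Zero C (?Q b0) (\<Omega> M)"
    by (rule mono_ZeroI[OF _ sm(5,1)]) (simp add: Hom_iff)
  have "\<exists>L c w N t. ses C (\<Omega> M) c L w N \<and> gorenstein N \<and> t \<in> Hom C (?Q (\<mho> (\<mho> b0))) L \<and>
      c \<cdot> \<psi> = t \<cdot> ?D (\<mho> b0)"
    by (rule Suc.IH[OF _ _ Suc.prems(3) j'(2) b0_def _ \<psi>0])
      (use Suc.prems(1) \<psi>(1) in \<open>simp_all add: funpow_swap1 bb\<close>)
  then obtain L c w N t where L: "ses C (\<Omega> M) c L w N" "gorenstein N"
    "t \<in> Hom C (?Q (\<mho> b)) L" "c \<cdot> \<psi> = t \<cdot> ?D b"
    unfolding bb[symmetric] by blast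
  note l = sesD[OF L(1)]
  \<comment> \<open>\<open>X\<close> is an extension of the Gorenstein object \<open>N\<close> by \<open>P (I M)\<close>.\<close>
  obtain X u v r where X: "ses C (on_obj P (on_obj I M)) u X r N" "v \<in> Hom C L X" "v \<cdot> c = u \<cdot> \<omega> M"
    "r \<cdot> v = w" "is_pullback (opposite C) X v u c (\<omega> M)"
    by (rule ses_pushout[OF L(1) sm(1)]) blast
  note x = sesD[OF X(1)]
  have GX: "gorenstein X" by (rule gorenstein_extension[OF X(1) gorenstein_P L(2)]) simp
  have "Zero C L M \<cdot> c = \<epsilon> M \<cdot> \<omega> M" using HomD[OF l(1)] sm(7) by simp
  \<comment> \<open>The projection of \<open>X\<close> onto its quotient by \<open>L\<close>, which is \<open>M\<close>.\<close>
  then obtain q where q: "q \<in> Hom C X M" "q \<cdot> v = Zero C L M" "q \<cdot> u = \<epsilon> M"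
    using pushout_lift[OF X(5) l(1) sm(1) Zero_hom[of L M] sm(2)] HomD(5)[OF l(1)] by auto
  note [THEN hom_simps, simp] = l(1) L(3) x(1) X(2) q(1)
  have h: "u \<cdot> f \<in> Hom C (?Q (\<mho> b)) X" "v \<cdot> t \<in> Hom C (?Q (\<mho> b)) X" by (simp_all add: Hom_iff)
  define f' where "f' = Sub (u \<cdot> f) (v \<cdot> t)"
  have f': "f' \<in> Hom C (?Q (\<mho> b)) X" unfolding f'_def by (rule Sub_hom[OF h])
  note [THEN hom_simps, simp] = f'
  have uv: "u \<cdot> (f \<cdot> ?D b) = v \<cdot> (t \<cdot> ?D b)"
    by (simp add: Comp_reassoc2[OF X(3)] flip: \<psi>(2) L(4))
  have "f' \<cdot> ?D b = Sub (u \<cdot> (f \<cdot> ?D b)) (v \<cdot> (t \<cdot> ?D b))"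
    unfolding f'_def using Sub_Comp[OF D1 h] by simp
  also have "\<dots> = Zero C (?Q b) X" unfolding uv by (rule Sub_self) (simp add: Hom_iff)
  finally have f'0: "f' \<cdot> ?D b = Zero C (?Q b) X" .
  have "q \<cdot> f' = Sub (q \<cdot> (u \<cdot> f)) (q \<cdot> (v \<cdot> t))" unfolding f'_def by (rule Comp_Sub[OF h q(1)])
  also have "\<dots> = Sub \<phi> (Zero C (?Q (\<mho> b)) M)"
    by (simp add: Comp_reassoc[OF q(2)] Comp_reassoc[OF q(3)] f(2))
  also have "\<dots> = \<phi>" by (rule Sub_Zero[OF \<phi>(1)])
  finally have qf: "q \<cdot> f' = \<phi>" .
  obtain L' c' w' N' t' where L': "ses C X c' L' w' N'" "gorenstein N'"
    "t' \<in> Hom C (?Q (\<mho> (\<mho> b))) L'" "c' \<cdot> f' = t' \<cdot> ?D (\<mho> b)"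
    by (rule gorenstein_extend[OF GX b f' f'0])
  note l' = sesD[OF L'(1)]
  \<comment> \<open>In the pushout \<open>Y\<close> of \<open>M\<close> and \<open>L'\<close> over \<open>X\<close>, \<open>M\<close> is a subobject with the same quotient \<open>N'\<close>.\<close>
  obtain Y u' v' r' where Y: "ses C M u' Y r' N'" "v' \<in> Hom C L' Y" "v' \<cdot> c' = u' \<cdot> q"
    by (rule ses_pushout[OF L'(1) q(1)]) blast
  note y = sesD[OF Y(1)]
  note [THEN hom_simps, simp] = l'(1) L'(3) y(1) Y(2)
  have "u' \<cdot> \<phi> = (v' \<cdot> t') \<cdot> ?D (\<mho> b)"
    by (simp add: Comp_reassoc2[OF Y(3)[symmetric]] L'(4) flip: qf)
  moreover have "v' \<cdot> t' \<in> Hom C (?Q (\<mho> (\<mho> b))) Y" by (simp add: Hom_iff)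
  ultimately show ?case using Y(1) L'(2) by blast
qed

text \<open>
  Applied to the cokernel \<open>q\<close> of the differential \<open>Q b \<rightarrow> Q (\<mho> b)\<close>, the extension property shows that \<open>q\<close> kills the cycles,
  so \<open>\<nu>' (J b) \<rightarrow> \<nu>' (\<mho> b)\<close> is epi.
\<close>

lemma Cotor_vanishes_of_GP_dim:
  assumes G: "\<And>M. M \<in> Obj C \<Longrightarrow> gorenstein ((\<Omega> ^^ n) M)" and k: "n \<le> k" and a: "a \<in> Obj C"
  shows "Cotor_zero k a"
proof -
  define b where "b = (\<mho> ^^ k) a"
  have b [simp]: "b \<in> Obj C" unfolding b_def using a by (induction k) simp_all
  let ?Q = "\<lambda>b. on_obj \<nu>' (J b)" and ?D = "\<lambda>b. on_arr \<nu>' (\<delta> b)"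
  note s = sesD[OF J_ses[OF b]] and s' = sesD[OF J_ses[of "\<mho> b"]] and s'' = sesD[OF J_ses[of "\<mho> (\<mho> b)"]]
  note [THEN hom_simps, simp] = s(2) s'(1,2) s''(1)
  have D: "?D b \<in> Hom C (?Q b) (?Q (\<mho> b))" by (rule nak.right.on_arr_in_Hom[OF \<delta>_hom[OF b]])
  have D': "?D (\<mho> b) \<in> Hom C (?Q (\<mho> b)) (?Q (\<mho> (\<mho> b)))"
    by (rule nak.right.on_arr_in_Hom[OF \<delta>_hom]) simp
  obtain q M where q: "q \<in> Hom C (?Q (\<mho> b)) M" "is_cokernel C q (?D b)" using cokernel_exists[OF D] by blast
  obtain L c w N t where L: "ses C M c L w N" "t \<in> Hom C (?Q (\<mho> (\<mho> b))) L" "c \<cdot> q = t \<cdot> ?D (\<mho> b)"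
    using syzygy_gorenstein_extend[OF G _ a k b_def q(1) cokernel_Zero[OF q(2) D q(1)]] HomD(5)[OF q(1)]
    by blast
  note l = sesD[OF L(1)]
  let ?e = "on_arr \<nu>' (\<eta> (\<mho> b))" and ?p = "on_arr \<nu>' (cosyzygy_arr b)"
  have e: "?e \<in> Hom C (on_obj \<nu>' (\<mho> b)) (?Q (\<mho> b))" by (simp add: Hom_iff)
  have p: "?p \<in> Hom C (?Q b) (on_obj \<nu>' (\<mho> b))" by (simp add: Hom_iff)
  have me: "is_mono C ?e" by (rule nak.right_preserves_mono[OF s'(5,1)]) simp_all
  note [THEN hom_simps, simp] = q(1) l(1) L(2)
  note [simp] = HomD(1-3)[OF D'] HomD(1-3)[OF D]
  have De: "?D b = ?e \<cdot> ?p" by (simp add: \<delta>_def)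
  have z: "?D (\<mho> b) \<cdot> ?e = Zero C (on_obj \<nu>' (\<mho> b)) (?Q (\<mho> (\<mho> b)))"
  proof -
    have "\<delta> (\<mho> b) \<cdot> \<eta> (\<mho> b) = Zero C (\<mho> b) (J (\<mho> (\<mho> b)))" by (simp add: \<delta>_def s'(7))
    then show ?thesis using HomD[OF \<delta>_hom[of "\<mho> b"]] by (simp flip: nak.right.on_arr_Comp_arr)
  qed
  have "c \<cdot> (q \<cdot> ?e) = Zero C (on_obj \<nu>' (\<mho> b)) L" by (simp add: Comp_reassoc2[OF L(3)] z)
  then have "q \<cdot> ?e = Zero C (on_obj \<nu>' (\<mho> b)) M" by (rule mono_ZeroI[OF _ l(5,1)]) (simp add: Hom_iff)
  then obtain r w' u where w: "w' \<in> Hom C r (on_obj \<nu>' (\<mho> b))" "is_epi C w'" "u \<in> Hom C r (?Q b)"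
    "?D b \<cdot> u = ?e \<cdot> w'"
    using cokernel_cover[OF q(2) D q(1) e] by blast
  note [THEN hom_simps, simp] = w(1,3)
  have "?e \<cdot> (?p \<cdot> u) = ?e \<cdot> w'" using w(4) by (simp add: De)
  then have "?p \<cdot> u = w'" by (rule mono_eqI[OF _ me e]) (simp_all add: Hom_iff)
  then have "is_epi C ?p" using epi_of_cover[OF p w(1-3)] by blast
  then have "Cotor_zero 0 b" by (rule coflat_by_copresentation[OF J_ses[OF b], rotated]) (simp add: Cotor_I)
  then show ?thesis by (simp add: b_def syzygy_flat_def)
qed

end

context abelian_category begin

section \<open>Gorenstein objects of the opposite category and the passage to the self-dual setting\<close>

text \<open>
  The kernel of \<open>s 0\<close> is the image of \<open>s 1\<close> and hence the cokernel of \<open>s 2\<close>, which is a kernel of the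
  reversed complex when degree \<open>i\<close> is renamed to \<open>1 - i\<close>.
\<close>

lemma acyclic_kernels_opposite_subset: "acyclic_kernels C S F \<subseteq> acyclic_kernels (opposite C) S F"
proof
  fix a assume "a \<in> acyclic_kernels C S F"
  then obtain X :: "int \<Rightarrow> 'a" and s k where a: "a \<in> Obj C" and X: "\<And>i. X i \<in> S"
    and s: "\<And>i. s i \<in> Hom C (X i) (X (i - 1))"
    and ex: "\<And>i. exact_pair C (s (i + 1)) (s i)"
    and Fex: "\<And>i. exact_pair C (on_arr F (s (i + 1))) (on_arr F (s i))"
    and k: "k \<in> Hom C a (X 0)" "is_kernel C k (s 0)"
    unfolding acyclic_kernels_def by blast
  have s1: "s 1 \<in> Hom C (X 1) (X 0)" and s2: "s 2 \<in> Hom C (X 2) (X 1)" and ex1: "exact_pair C (s 1) (s 0)"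
    and ex2: "exact_pair C (s 2) (s 1)"
    using s[of 1] s[of 2] ex[of 0] ex[of 1] by simp_all
  obtain e where e: "e \<in> Hom C (X 1) a" "is_epi C e" "k \<cdot> e = s 1"
    by (rule exact_pair_lift_epi[OF s1 s[of 0] ex1 k(2,1)])
  have "exact_pair C (s 2) e"
    using exact_pair_mono[OF s2 e(1) k(1) kernelD(3)[OF k(2) s]] ex2 by (simp add: e(3))
  then have c: "is_cokernel C e (s 2)" by (rule exact_pair_cokernel[OF _ s2 e(1,2)])
  define X' s' where "X' = (\<lambda>i. X (1 - i))" and "s' = (\<lambda>i. s (2 - i))"
  have 1: "s' i \<in> Hom C (X' (i - 1)) (X' i)" for i
    using s[of "2 - i"] by (simp add: X'_def s'_def)
  have 2: "exact_pair C (s' i) (s' (i + 1))" "exact_pair C (on_arr F (s' i)) (on_arr F (s' (i + 1)))" for i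
    using ex[of "1 - i"] Fex[of "1 - i"] by (simp_all add: s'_def)
  show "a \<in> acyclic_kernels (opposite C) S F"
    unfolding acyclic_kernels_def mem_Collect_eq
  proof (intro conjI exI allI)
    show "X' i \<in> S" for i using X by (simp add: X'_def)
    show "s' i \<in> Hom (opposite C) (X' i) (X' (i - 1))" for i using 1 by simp
    show "exact_pair (opposite C) (s' (i + 1)) (s' i)"
      "exact_pair (opposite C) (on_arr F (s' (i + 1))) (on_arr F (s' i))" for i
      using 2 by simp_all
    show "e \<in> Hom (opposite C) a (X' 0)" "is_kernel (opposite C) e (s' 0)" "a \<in> Obj (opposite C)"
      using e(1) c a by (simp_all add: X'_def s'_def)
  qed
qed

lemma acyclic_kernels_opposite: "acyclic_kernels (opposite C) S F = acyclic_kernels C S F"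
  using acyclic_kernels_opposite_subset[of S F]
    abelian_category.acyclic_kernels_opposite_subset[OF opposite_abelian, of S F] by auto

text \<open>
  Generation makes the counit epi. Exactness of \<open>P\<close> on the left and of \<open>\<nu>' \<circ> I\<close> on the right follow by
  comparing \<open>P\<close> with \<open>\<nu>' \<circ> I\<close> along the unit isomorphism. If the unit \<open>\<eta> a\<close> kills \<open>x\<close>, then \<open>P x = 0\<close>, so
  \<open>I x = \<nu> (P x) = 0\<close>, and \<open>x = 0\<close> because the counit is epi.
\<close>

lemma nakayama_dualityI:
  assumes "nakayama_functor C P \<nu> \<nu>' \<sigma> \<tau>"
  obtains \<eta> \<epsilon> where "nakayama_duality C P (\<nu> \<circ>\<^sub>F P) \<eta> \<epsilon> \<nu> \<nu>' \<sigma> \<tau>"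
proof -
  let ?I = "\<nu> \<circ>\<^sub>F P"
  note generating = generating_functor.generating[OF nakayama_functor.axioms(1)[OF assms]]
    and unit_iso = nakayama_functor.unit_iso[OF assms]
  interpret nu: adjunction C \<nu> \<nu>' \<sigma> \<tau> by (rule nakayama_functor.axioms(2)[OF assms])
  obtain \<eta> \<epsilon> where A: "adjunction C P ?I \<eta> \<epsilon>"
    using nakayama_functor.right_adjoint_of_P[OF assms] unfolding is_right_adjoint_def by blast
  interpret gen: adjunction C P ?I \<eta> \<epsilon> by (rule A)
  have homs: "f \<in> Hom C (Dom C f) (Cod C f)" if "f \<in> Arr C" for f using that by (simp add: Hom_iff)
  have ma: "f \<in> Arr C" if "is_mono C f" for f using that by (simp add: is_mono_def)
  have ea: "f \<in> Arr C" if "is_epi C f" for f using that by (simp add: is_epi_def)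
  have counit_epi: "is_epi C (\<epsilon> a)" if a: "a \<in> Obj C" for a
  proof -
    obtain b f where f: "b \<in> Obj C" "f \<in> Hom C (on_obj P b) a" "is_epi C f" using generating[OF a] by blast
    have t: "on_arr P (on_arr ?I f \<cdot> \<eta> b) \<in> Hom C (on_obj P b) (on_obj P (on_obj ?I a))"
      using f(1) HomD[OF f(2)] by (simp add: Hom_iff)
    show ?thesis
      using epi_left[OF _ t gen.counit_hom[OF a]] f(3) gen.transpose[OF f(1,2)] by simp
  qed
  have I_mono: "is_mono C (on_arr ?I f)" if "is_mono C f" for f
    by (rule gen.right_preserves_mono[OF that homs[OF ma[OF that]]])
  have P_epi: "is_epi C (on_arr P f)" if "is_epi C f" for f
    by (rule gen.left_preserves_epi[OF that homs[OF ea[OF that]]])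
  have I_epi: "is_epi C (on_arr ?I f)" if f: "is_epi C f" for f
    using nu.left_preserves_epi[OF P_epi[OF f] gen.on_arr_in_Hom[OF homs[OF ea[OF f]]]] by simp
  have nat: "on_arr \<nu>' (on_arr ?I f) \<cdot> \<sigma> (on_obj P (Dom C f)) = \<sigma> (on_obj P (Cod C f)) \<cdot> on_arr P f"
    if "f \<in> Arr C" for f
    using nu.unit_nat[OF gen.on_arr_in_Hom[OF homs[OF that]]] by simp
  have u: "\<sigma> (on_obj P a) \<in> Hom C (on_obj P a) (on_obj \<nu>' (on_obj ?I a))" if "a \<in> Obj C" for a
    using nu.unit_hom[of "on_obj P a"] that by simp
  have nI: "on_arr \<nu>' (on_arr ?I f) \<in> Hom C (on_obj \<nu>' (on_obj ?I (Dom C f))) (on_obj \<nu>' (on_obj ?I (Cod C f)))"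
    if "f \<in> Arr C" for f
    by (intro nu.right.on_arr_in_Hom gen.right.on_arr_in_Hom homs that)
  have P_mono: "is_mono C (on_arr P f)" if f: "is_mono C f" for f
  proof -
    note fa = ma[OF f]
    have "is_mono C (on_arr \<nu>' (on_arr ?I f))"
      by (rule nu.right_preserves_mono[OF I_mono[OF f] gen.right.on_arr_in_Hom[OF homs[OF fa]]])
    then have "is_mono C (\<sigma> (on_obj P (Cod C f)) \<cdot> on_arr P f)"
      unfolding nat[OF fa, symmetric]
      using mono_comp[OF iso_mono[OF unit_iso u] _ u nI[OF fa]] fa Dom_in_Obj by blast
    then show ?thesis
      by (rule mono_right[OF _ gen.on_arr_in_Hom[OF homs[OF fa]] u]) (simp add: fa Cod_in_Obj)
  qed
  have nu'_I_epi: "is_epi C (on_arr \<nu>' (on_arr ?I f))" if f: "is_epi C f" for f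
  proof -
    note fa = ea[OF f]
    have "is_epi C (on_arr \<nu>' (on_arr ?I f) \<cdot> \<sigma> (on_obj P (Dom C f)))"
      unfolding nat[OF fa]
      by (rule epi_comp[OF P_epi[OF f] iso_epi[OF unit_iso u] gen.on_arr_in_Hom[OF homs[OF fa]] u])
        (simp_all add: fa Cod_in_Obj)
    then show ?thesis by (rule epi_left[OF _ u nI[OF fa]]) (simp add: fa Dom_in_Obj)
  qed
  have unit_mono: "is_mono C (\<eta> a)" if a: "a \<in> Obj C" for a
  proof (rule monoI[OF gen.unit_hom[OF a]])
    fix t x assume x: "x \<in> Hom C t a" "\<eta> a \<cdot> x = Zero C t (on_obj ?I (on_obj P a))"
    note [THEN hom_simps, simp] = x(1)
    have "on_arr P x = (\<epsilon> (on_obj P a) \<cdot> on_arr P (\<eta> a)) \<cdot> on_arr P x" by (simp add: gen.triangle_left)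
    also have "\<dots> = \<epsilon> (on_obj P a) \<cdot> on_arr P (\<eta> a \<cdot> x)" by simp
    also have "\<dots> = Zero C (on_obj P t) (on_obj P a)" unfolding x(2) by simp
    finally have "on_arr ?I x = Zero C (on_obj ?I t) (on_obj ?I a)" by simp
    then have "x \<cdot> \<epsilon> t = Zero C (on_obj P (on_obj ?I t)) a"
      unfolding gen.counit_nat[OF x(1)] by (simp del: functor_comp_simps)
    then show "x = Zero C t a" by (rule epi_ZeroI[OF _ counit_epi gen.counit_hom x(1)]) simp_all
  qed
  have counit_iso: "is_iso C (\<tau> (on_obj ?I a))" if a: "a \<in> Obj C" for a
  proof -
    let ?p = "on_obj P a"
    have p: "?p \<in> Obj C" using a by simp
    obtain g where g: "g \<in> Hom C (on_obj \<nu>' (on_obj \<nu> ?p)) ?p" "g \<cdot> \<sigma> ?p = Id C ?p"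
      "\<sigma> ?p \<cdot> g = Id C (on_obj \<nu>' (on_obj \<nu> ?p))"
      using iso_obtain[OF unit_iso[OF a] nu.unit_hom[OF p]] by blast
    note [THEN hom_simps, simp] = g(1)
    note [simp] = p
    have e: "on_arr \<nu> (\<sigma> ?p) \<cdot> on_arr \<nu> g = Id C (on_obj \<nu> (on_obj \<nu>' (on_obj \<nu> ?p)))"
      by (simp add: g(3) flip: nu.on_arr_Comp_arr)
    have "\<tau> (on_obj \<nu> ?p) = (\<tau> (on_obj \<nu> ?p) \<cdot> on_arr \<nu> (\<sigma> ?p)) \<cdot> on_arr \<nu> g" by (simp add: e)
    also have "\<dots> = on_arr \<nu> g" by (simp add: nu.triangle_left del: Comp_assoc_arr)
    finally have "\<tau> (on_obj \<nu> ?p) = on_arr \<nu> g" .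
    moreover have "is_iso C (on_arr \<nu> g)" by (rule nu.functor_iso[OF isoI[OF g(1) nu.unit_hom[OF p] g(3,2)]])
    ultimately show ?thesis by simp
  qed
  have nu_P_iso: "\<exists>f\<in>Hom C (on_obj \<nu> (on_obj P a)) (on_obj ?I a). is_iso C f" if "a \<in> Obj C" for a
    using that isoI[OF Id_in_Hom Id_in_Hom, of "on_obj \<nu> (on_obj P a)"]
    by (intro bexI[of _ "Id C (on_obj \<nu> (on_obj P a))"]) (simp_all add: Id_in_Hom)
  have nu'_I_iso: "\<exists>f\<in>Hom C (on_obj \<nu>' (on_obj ?I a)) (on_obj P a). is_iso C f" if a: "a \<in> Obj C" for a
    using iso_obtain[OF unit_iso[OF a] u[OF a]] isoI[OF _ u[OF a]] by metis
  have "nakayama_duality C P ?I \<eta> \<epsilon> \<nu> \<nu>' \<sigma> \<tau>"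
    unfolding nakayama_duality_def nakayama_duality_axioms_def
    using abelian_category_axioms A nu.adjunction_axioms counit_epi unit_mono unit_iso counit_iso P_mono
      I_epi I_mono nu'_I_epi nu_P_iso nu'_I_iso
    by simp
  then show thesis by (rule that)
qed

end

context nakayama_duality begin

section \<open>Comparison of the dimensions\<close>

lemma gorenstein_injectives_opposite:
  "gorenstein_injectives C I \<nu>' = gorenstein_projectives (opposite C) I \<nu>'"
  by (simp add: gorenstein_injectives_def gorenstein_projectives_def acyclic_kernels_opposite)

lemma bounds_of_GP_dim:
  assumes "global_resolution_dim C GP \<le> enat n"
  shows "\<forall>i\<ge>n. \<forall>a\<in>Obj C. Tor_zero i a" "\<forall>i\<ge>n. \<forall>a\<in>Obj C. Cotor_zero i a"
proof -
  have R: "\<exists>m\<le>n. has_resolution_of_length C GP a m" if "a \<in> Obj C" for a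
    using assms that unfolding global_dim_le_iff by blast
  have T: "Tor_zero i a" if "n \<le> i" "a \<in> Obj C" for i a
    using R[OF that(2)] GP_resolution_Tor that(1) le_trans by blast
  then show "\<forall>i\<ge>n. \<forall>a\<in>Obj C. Tor_zero i a" by blast
  have "gorenstein ((\<Omega> ^^ n) a)" if a: "a \<in> Obj C" for a
  proof -
    have "Tor_zero i ((\<Omega> ^^ n) a)" for i
      using T[of "i + n" a] a by (simp add: syzygy_flat_def funpow_add)
    then show ?thesis using R[of "(\<Omega> ^^ n) a"] a acyclic_GP_resolution_gorenstein by auto
  qed
  then show "\<forall>i\<ge>n. \<forall>a\<in>Obj C. Cotor_zero i a" using Cotor_vanishes_of_GP_dim by blast
qed

lemma GP_dim_of_bounds:
  assumes L: "\<forall>i\<ge>n. \<forall>a\<in>Obj C. Tor_zero i a" and R: "\<forall>i\<ge>r. \<forall>a\<in>Obj C. Cotor_zero i a"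
  shows "global_resolution_dim C GP \<le> enat n"
  unfolding global_dim_le_iff
proof
  fix a assume a: "a \<in> Obj C"
  have "Tor_zero i ((\<Omega> ^^ n) a)" for i
  proof -
    have "Tor_zero (i + n) a" using L a by simp
    then show ?thesis by (simp add: syzygy_flat_def funpow_add)
  qed
  then have "gorenstein ((\<Omega> ^^ n) a)"
    using R a by (intro acyclic_gorenstein[of _ r]) simp_all
  then show "\<exists>m\<le>n. has_resolution_of_length C GP a m" using GP_resolution_of_syzygy[OF a] by blast
qed

text \<open>
  With \<open>l\<close> and \<open>r\<close> the least bounds, the two preceding lemmas and their duals give \<open>g \<le> l\<close>, \<open>h \<le> r\<close>, and that
  \<open>g\<close> and \<open>h\<close> are each at least \<open>l\<close> and \<open>r\<close>.
\<close>

theorem gorenstein_dimensions: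
  defines "g \<equiv> global_resolution_dim C (gorenstein_projectives C P \<nu>)"
    and "h \<equiv> global_coresolution_dim C (gorenstein_injectives C I \<nu>')"
    and "LB \<equiv> left_derived_vanishes_above C P \<nu>"
    and "RB \<equiv> right_derived_vanishes_above C I \<nu>'"
  shows "(\<exists>m. LB m \<and> RB m) \<longleftrightarrow> g < \<infinity>" "(\<exists>m. LB m \<and> RB m) \<longleftrightarrow> h < \<infinity>"
    "(\<exists>m. LB m \<and> RB m) \<Longrightarrow> g = enat (LEAST s. LB s)"
    "(\<exists>m. LB m \<and> RB m) \<Longrightarrow> h = enat (LEAST s. LB s)"
    "(\<exists>m. LB m \<and> RB m) \<Longrightarrow> (LEAST s. LB s) = (LEAST t. RB t)"
proof -
  have h: "h = global_resolution_dim (opposite C) (gorenstein_projectives (opposite C) I \<nu>')"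
    by (simp add: h_def coresolution_dim_opposite gorenstein_injectives_opposite)
  have g1: "LB n \<and> RB n" if "g \<le> enat n" for n
    using bounds_of_GP_dim[of n] that
    by (simp add: g_def LB_def RB_def left_vanishes_iff right_vanishes_iff)
  have g2: "g \<le> enat n" if "LB n" "RB r" for n r
    using GP_dim_of_bounds[of n r] that
    by (simp add: g_def LB_def RB_def left_vanishes_iff right_vanishes_iff)
  have h1: "LB n \<and> RB n" if "h \<le> enat n" for n
    using nakayama_duality.bounds_of_GP_dim[OF dual, of n] that
    by (simp add: h LB_def RB_def left_vanishes_iff right_vanishes_iff)
  have h2: "h \<le> enat n" if "RB n" "LB r" for n r
    using nakayama_duality.GP_dim_of_bounds[OF dual, of n r] that
    by (simp add: h LB_def RB_def left_vanishes_iff right_vanishes_iff)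
  have fin: "x < \<infinity> \<longleftrightarrow> (\<exists>n. x \<le> enat n)" for x :: enat by (cases x) auto
  show "(\<exists>m. LB m \<and> RB m) \<longleftrightarrow> g < \<infinity>" unfolding fin using g1 g2 by blast
  show "(\<exists>m. LB m \<and> RB m) \<longleftrightarrow> h < \<infinity>" unfolding fin using h1 h2 by blast
  assume ex: "\<exists>m. LB m \<and> RB m"
  define l r where "l = (LEAST s. LB s)" and "r = (LEAST t. RB t)"
  have l: "LB l" and r: "RB r" unfolding l_def r_def using ex by (blast intro: LeastI)+
  have l_le: "l \<le> n" if "LB n" for n unfolding l_def using that by (rule Least_le)
  have r_le: "r \<le> n" if "RB n" for n unfolding r_def using that by (rule Least_le)
  obtain g' where g': "g = enat g'" using g2[OF l r] by (cases g) auto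
  obtain h' where h': "h = enat h'" using h2[OF r l] by (cases h) auto
  have "g' \<le> l" "h' \<le> r" using g2[OF l r] h2[OF r l] g' h' by simp_all
  moreover have "l \<le> g'" "r \<le> g'" "l \<le> h'" "r \<le> h'"
    using g1[of g'] h1[of h'] g' h' l_le r_le by simp_all
  ultimately have "g' = l" "h' = l" "l = r" by linarith+
  then show "g = enat (LEAST s. LB s)" "h = enat (LEAST s. LB s)" "(LEAST s. LB s) = (LEAST t. RB t)"
    using g' h' l_def r_def by simp_all
qed

end

theorem theorem1p1p7:
  fixes C :: "('o, 'm) precat"
    and P \<nu> \<nu>' I :: "('o, 'm) endofunctor"
    and unit counit :: "'o \<Rightarrow> 'm"
  assumes "abelian_category C"
    and "generating_functor C P"
    and "nakayama_functor C P \<nu> \<nu>' unit counit"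
    and "I = \<nu> \<circ>\<^sub>F P"
  shows
    "(iwanaga_gorenstein C P \<nu> \<nu>' \<longleftrightarrow>
        global_resolution_dim C (gorenstein_projectives C P \<nu>) < \<infinity>) \<and>
     (iwanaga_gorenstein C P \<nu> \<nu>' \<longleftrightarrow>
        global_coresolution_dim C (gorenstein_injectives C I \<nu>') < \<infinity>) \<and>
     (iwanaga_gorenstein C P \<nu> \<nu>' \<longrightarrow>
        global_resolution_dim C (gorenstein_projectives C P \<nu>)
          = global_coresolution_dim C (gorenstein_injectives C I \<nu>') \<and>
        global_coresolution_dim C (gorenstein_injectives C I \<nu>')
          = enat (LEAST s. left_derived_vanishes_above C P \<nu> s) \<and>
        (LEAST s. left_derived_vanishes_above C P \<nu> s)
          = (LEAST t. right_derived_vanishes_above C I \<nu>' t))"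
proof -
  obtain \<eta> \<epsilon> where "nakayama_duality C P (\<nu> \<circ>\<^sub>F P) \<eta> \<epsilon> \<nu> \<nu>' unit counit"
    by (rule abelian_category.nakayama_dualityI[OF assms(1,3)])
  then interpret nakayama_duality C P I \<eta> \<epsilon> \<nu> \<nu>' unit counit by (simp add: assms(4))
  have "iwanaga_gorenstein C P \<nu> \<nu>' \<longleftrightarrow>
      (\<exists>m. left_derived_vanishes_above C P \<nu> m \<and> right_derived_vanishes_above C I \<nu>' m)"
    by (simp add: iwanaga_gorenstein_def assms(4))
  then show ?thesis using gorenstein_dimensions by simp
qed

end
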